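(* Let $(M,\langle\cdot,\cdot\rangle)$ be a Riemannian manifold and let $q$ be a curve on $M$. The second-jet lift $\Gamma=j^2q$ is a geodesic on $(T^{(2)}M,g^{(2)})$, where $g^{(2)}$ is the $2$-Sasaki metric, if and only if $q$ is a geodesic on $M$.
   Context: $\nabla$ is the Levi--Civita connection of $M$. $T^{(2)}M$ is the manifold of $2$-jets $u=j^2_0(q)$ at $0$ of smooth curves $q$ in $M$, with projection $\tau_2(j^2_0q)=q(0)$. The second-jet lift of a curve $q$ on $M$ is the curve $(j^2q)(t)=j^2_0(q_t)$ on $T^{(2)}M$, where $q_t(s)=q(t+s)$. For $W\in T_uT^{(2)}M$ choose a family of curves $\gamma_s(t)=\gamma(s,t)$ on $M$ such that $s\mapsto j^2_0(\gamma_s)$ passes through $u$ at $s=0$ with velocity $W$, and set $K_0(W)=\tau_{2*}W$ and $K_\alpha(W)=\frac1{\alpha!}\nabla^\alpha_{\partial\gamma/\partial t}\frac{\partial\gamma}{\partial s}\big|_{(s,t)=(0,0)}$ for $\alpha=1,2$. These are well defined and $(K_0,K_1,K_2):T_uT^{(2)}M\to(T_{\tau_2(u)}M)^{3}$ is a linear isomorphism. The $2$-Sasaki metric $g^{(2)}$ on $T^{(2)}M$ is $g^{(2)}_u(W,W')=\sum_{\alpha=0}^2\langle K_\alpha(W),K_\alpha(W')\rangle$. *)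

theory Defs
  imports "HOL-Analysis.Analysis"
begin

section \<open>Smooth maps between Euclidean spaces\<close>

primrec times_differentiable_on ::
  "nat \<Rightarrow> 'a::real_normed_vector set \<Rightarrow> ('a \<Rightarrow> 'b::real_normed_vector) \<Rightarrow> bool"
where
  "times_differentiable_on 0 S f \<longleftrightarrow> continuous_on S f"
| "times_differentiable_on (Suc n) S f \<longleftrightarrow>
     (\<forall>x\<in>S. f differentiable (at x)) \<and>
     (\<forall>v. times_differentiable_on n S (\<lambda>x. frechet_derivative f (at x) v))"

text \<open>Only used for open \<open>S\<close>.\<close>

definition smooth_on :: "'a::real_normed_vector set \<Rightarrow> ('a \<Rightarrow> 'b::real_normed_vector) \<Rightarrow> bool"
  where "smooth_on S f \<longleftrightarrow> (\<forall>n. times_differentiable_on n S f)"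

definition vderiv :: "(real \<Rightarrow> 'b::real_normed_vector) \<Rightarrow> real \<Rightarrow> 'b"
  where "vderiv f = (\<lambda>t. vector_derivative f (at t))"


section \<open>Smooth manifolds\<close>

text \<open>
  A manifold is given by an atlas. A chart is a domain together with a total function, of which
  only the values on the domain matter. The underlying set is the union of the chart domains,
  and its topology is the one determined by the charts; thus points may come from any type, in
  particular from the type of jets below. Charts take values in a fixed Euclidean space, whose
  dimension is the dimension of the manifold.
\<close>

type_synonym ('a, 'e) chart = "'a set \<times> ('a \<Rightarrow> 'e)"

definition points :: "('a, 'e) chart set \<Rightarrow> 'a set"
  where "points A = (\<Union>(D, \<phi>)\<in>A. D)"

definition manifold_topology :: "('a, 'e::euclidean_space) chart set \<Rightarrow> 'a topology"
  where "manifold_topology A =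
    topology_generated_by {{p \<in> D. \<phi> p \<in> V} | D \<phi> V. (D, \<phi>) \<in> A \<and> open V}"

definition smooth_atlas :: "('a, 'e::euclidean_space) chart set \<Rightarrow> bool"
  where "smooth_atlas A \<longleftrightarrow>
    (\<forall>(D, \<phi>)\<in>A. inj_on \<phi> D \<and> open (\<phi> ` D)) \<and>
    (\<forall>(D, \<phi>)\<in>A. \<forall>(E, \<psi>)\<in>A.
       open (\<phi> ` (D \<inter> E)) \<and> smooth_on (\<phi> ` (D \<inter> E)) (\<psi> \<circ> inv_into D \<phi>))"

definition smooth_manifold :: "('a, 'e::euclidean_space) chart set \<Rightarrow> bool"
  where "smooth_manifold A \<longleftrightarrow>
    smooth_atlas A \<and> Hausdorff_space (manifold_topology A) \<and> second_countable (manifold_topology A)"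

text \<open>The neighbourhoods \<open>U \<subseteq> S\<close> force \<open>S\<close> to be open.\<close>

definition smooth_map_on ::
  "('a, 'e::euclidean_space) chart set \<Rightarrow> 'b::euclidean_space set \<Rightarrow> ('b \<Rightarrow> 'a) \<Rightarrow> bool"
  where "smooth_map_on A S f \<longleftrightarrow>
    (\<forall>x\<in>S. f x \<in> points A \<and>
       (\<forall>(D, \<phi>)\<in>A. f x \<in> D \<longrightarrow>
          (\<exists>U\<subseteq>S. open U \<and> x \<in> U \<and> f ` U \<subseteq> D \<and> smooth_on U (\<phi> \<circ> f))))"


section \<open>Jets of curves\<close>

text \<open>
  Curves are total functions on the reals that are only required to be smooth near the parameter
  values in question. An \<open>r\<close>-jet at \<open>0\<close> is an equivalence class of such curves.
\<close>

definition curve_germs :: "('a, 'e::euclidean_space) chart set \<Rightarrow> (real \<Rightarrow> 'a) set"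
  where "curve_germs A = {c. \<exists>\<epsilon>>0. smooth_map_on A {-\<epsilon><..<\<epsilon>} c}"

type_synonym 'a jet = "(real \<Rightarrow> 'a) set"

definition jet :: "('a, 'e::euclidean_space) chart set \<Rightarrow> nat \<Rightarrow> (real \<Rightarrow> 'a) \<Rightarrow> 'a jet"
  where "jet A r c =
    {c' \<in> curve_germs A. c' 0 = c 0 \<and>
       (\<forall>(D, \<phi>)\<in>A. c 0 \<in> D \<longrightarrow>
          (\<forall>k\<le>r. (vderiv ^^ k) (\<phi> \<circ> c') 0 = (vderiv ^^ k) (\<phi> \<circ> c) 0))}"

definition repr :: "'a jet \<Rightarrow> real \<Rightarrow> 'a"
  where "repr u = (SOME c. c \<in> u)"

definition jet_base :: "'a jet \<Rightarrow> 'a"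
  where "jet_base u = repr u 0"

definition jet_coord :: "('a \<Rightarrow> 'e::euclidean_space) \<Rightarrow> nat \<Rightarrow> 'a jet \<Rightarrow> 'e"
  where "jet_coord \<phi> k u = (vderiv ^^ k) (\<phi> \<circ> repr u) 0"

definition jet_lift ::
  "('a, 'e::euclidean_space) chart set \<Rightarrow> nat \<Rightarrow> (real \<Rightarrow> 'a) \<Rightarrow> real \<Rightarrow> 'a jet"
  where "jet_lift A r q t = jet A r (\<lambda>s. q (t + s))"

text \<open>The atlas of the manifold \<open>T\<^sup>(\<^sup>2\<^sup>)M\<close> of \<open>2\<close>-jets.\<close>

definition jet2_atlas ::
  "('a, 'e::euclidean_space) chart set \<Rightarrow> ('a jet, 'e \<times> 'e \<times> 'e) chart set"
  where "jet2_atlas A =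
    (\<lambda>(D, \<phi>). ({jet A 2 c | c. c \<in> curve_germs A \<and> c 0 \<in> D},
               \<lambda>u. (jet_coord \<phi> 0 u, jet_coord \<phi> 1 u, jet_coord \<phi> 2 u))) ` A"


section \<open>Tangent vectors\<close>

text \<open>
  Tangent vectors are velocities of curves, that is, \<open>1\<close>-jets. The linear structure of a tangent
  space is the one making \<open>jet_coord \<phi> 1\<close> linear for the charts at the point; \<open>tangent_of\<close> is
  the inverse of that coordinate map.
\<close>

definition tangent_space :: "('a, 'e::euclidean_space) chart set \<Rightarrow> 'a \<Rightarrow> 'a jet set"
  where "tangent_space A p = {jet A 1 c | c. c \<in> curve_germs A \<and> c 0 = p}"

abbreviation velocity ::
  "('a, 'e::euclidean_space) chart set \<Rightarrow> (real \<Rightarrow> 'a) \<Rightarrow> real \<Rightarrow> 'a jet"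
  where "velocity A \<equiv> jet_lift A 1"

definition zero_tangent :: "('a, 'e::euclidean_space) chart set \<Rightarrow> 'a \<Rightarrow> 'a jet"
  where "zero_tangent A p = jet A 1 (\<lambda>_. p)"

definition scale_tangent :: "('a, 'e::euclidean_space) chart set \<Rightarrow> real \<Rightarrow> 'a jet \<Rightarrow> 'a jet"
  where "scale_tangent A a X = jet A 1 (\<lambda>s. repr X (a * s))"

text \<open>The differential of \<open>f\<close>; the atlas is that of the codomain.\<close>

definition pushforward ::
  "('b, 'e::euclidean_space) chart set \<Rightarrow> ('a \<Rightarrow> 'b) \<Rightarrow> 'a jet \<Rightarrow> 'b jet"
  where "pushforward B f X = jet B 1 (f \<circ> repr X)"

definition tangent_of ::
  "('a, 'e::euclidean_space) chart set \<Rightarrow> ('a, 'e) chart \<Rightarrow> 'a \<Rightarrow> 'e \<Rightarrow> 'a jet"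
  where "tangent_of A = (\<lambda>(D, \<phi>) p v. jet A 1 (\<lambda>t. inv_into D \<phi> (\<phi> p + t *\<^sub>R v)))"


section \<open>Riemannian metrics and the Levi-Civita connection\<close>

text \<open>
  A metric is a function of two tangent vectors, of which only the values on pairs of vectors at
  the same point matter. \<open>metric_coord\<close> is its expression in a chart.
\<close>

type_synonym 'a metric = "'a jet \<Rightarrow> 'a jet \<Rightarrow> real"

definition metric_coord ::
  "('a, 'e::euclidean_space) chart set \<Rightarrow> 'a metric \<Rightarrow> ('a, 'e) chart \<Rightarrow> 'e \<Rightarrow> 'e \<Rightarrow> 'e \<Rightarrow> real"
  where "metric_coord A g = (\<lambda>(D, \<phi>) x v w.
    g (tangent_of A (D, \<phi>) (inv_into D \<phi> x) v) (tangent_of A (D, \<phi>) (inv_into D \<phi> x) w))"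

definition riemannian_metric :: "('a, 'e::euclidean_space) chart set \<Rightarrow> 'a metric \<Rightarrow> bool"
  where "riemannian_metric A g \<longleftrightarrow>
    (\<forall>(D, \<phi>)\<in>A. let G = metric_coord A g (D, \<phi>) in
       (\<forall>x\<in>\<phi> ` D. bilinear (G x) \<and> (\<forall>v w. G x v w = G x w v) \<and> (\<forall>v. v \<noteq> 0 \<longrightarrow> G x v v > 0)) \<and>
       (\<forall>v w. smooth_on (\<phi> ` D) (\<lambda>x. G x v w)))"

definition riemannian_manifold :: "('a, 'e::euclidean_space) chart set \<Rightarrow> 'a metric \<Rightarrow> bool"
  where "riemannian_manifold A g \<longleftrightarrow> smooth_manifold A \<and> riemannian_metric A g"

text \<open>
  The Levi-Civita connection is given in a chart by the bilinear maps
  \<open>\<Gamma>\<^sub>x(v, w) = (\<nabla>\<^sub>v w)(x)\<close>, where \<open>v\<close> and \<open>w\<close> stand for the fields with constant coordinates. As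
  these fields commute, vanishing torsion means that \<open>\<Gamma>\<^sub>x\<close> is symmetric; the last condition says
  \<open>u\<langle>v, w\<rangle> = \<langle>\<nabla>\<^sub>u v, w\<rangle> + \<langle>v, \<nabla>\<^sub>u w\<rangle>\<close>.
\<close>

definition levi_civita ::
  "('a, 'e::euclidean_space) chart set \<Rightarrow> 'a metric \<Rightarrow> ('a, 'e) chart \<Rightarrow> 'e \<Rightarrow> 'e \<Rightarrow> 'e \<Rightarrow> 'e"
  where "levi_civita A g C x =
    (let G = metric_coord A g C in
     THE \<Gamma>. bilinear \<Gamma> \<and> (\<forall>v w. \<Gamma> v w = \<Gamma> w v) \<and>
       (\<forall>u v w. frechet_derivative (\<lambda>y. G y v w) (at x) u = G x (\<Gamma> u v) w + G x v (\<Gamma> u w)))"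

text \<open>
  The covariant derivative, along the curve \<open>c\<close>, of a vector field \<open>V\<close> along \<open>c\<close>. The
  connection is recovered from its local coefficients by requiring the coordinate expression
  in all charts at \<open>c t\<close>.
\<close>

definition cov_deriv ::
  "('a, 'e::euclidean_space) chart set \<Rightarrow> 'a metric \<Rightarrow> (real \<Rightarrow> 'a) \<Rightarrow> (real \<Rightarrow> 'a jet) \<Rightarrow> real \<Rightarrow> 'a jet"
  where "cov_deriv A g c V t =
    (THE X. X \<in> tangent_space A (c t) \<and>
       (\<forall>(D, \<phi>)\<in>A. c t \<in> D \<longrightarrow>
          jet_coord \<phi> 1 X = vderiv (\<lambda>s. jet_coord \<phi> 1 (V s)) t +
            levi_civita A g (D, \<phi>) (\<phi> (c t)) (vderiv (\<phi> \<circ> c) t) (jet_coord \<phi> 1 (V t))))"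

definition geodesic ::
  "('a, 'e::euclidean_space) chart set \<Rightarrow> 'a metric \<Rightarrow> real set \<Rightarrow> (real \<Rightarrow> 'a) \<Rightarrow> bool"
  where "geodesic A g I c \<longleftrightarrow> smooth_map_on A I c \<and>
    (\<forall>t\<in>I. cov_deriv A g c (velocity A c) t = zero_tangent A (c t))"


section \<open>The 2-Sasaki metric\<close>

text \<open>
  \<open>\<gamma> s t\<close> is a family of curves \<open>t \<mapsto> \<gamma> s t\<close> whose \<open>2\<close>-jets at \<open>t = 0\<close> form a curve in
  \<open>T\<^sup>(\<^sup>2\<^sup>)M\<close> with velocity \<open>W\<close> at \<open>s = 0\<close>. The base point of \<open>W\<close> is part of \<open>W\<close>.
\<close>

definition represents_tangent ::
  "('a, 'e::euclidean_space) chart set \<Rightarrow> (real \<Rightarrow> real \<Rightarrow> 'a) \<Rightarrow> 'a jet jet \<Rightarrow> bool"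
  where "represents_tangent A \<gamma> W \<longleftrightarrow>
    (\<exists>\<epsilon>>0. smooth_map_on A ({-\<epsilon><..<\<epsilon>} \<times> {-\<epsilon><..<\<epsilon>}) (\<lambda>(s, t). \<gamma> s t)) \<and>
    velocity (jet2_atlas A) (\<lambda>s. jet A 2 (\<gamma> s)) 0 = W"

definition sasaki_K ::
  "('a, 'e::euclidean_space) chart set \<Rightarrow> 'a metric \<Rightarrow> nat \<Rightarrow> 'a jet jet \<Rightarrow> 'a jet"
  where "sasaki_K A g \<alpha> W =
    (if \<alpha> = 0 then pushforward A jet_base W
     else let \<gamma> = (SOME \<gamma>. represents_tangent A \<gamma> W) in
       scale_tangent A (1 / fact \<alpha>)
         ((cov_deriv A g (\<gamma> 0) ^^ \<alpha>) (\<lambda>t. velocity A (\<lambda>s. \<gamma> s t) 0) 0))"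

definition sasaki2 :: "('a, 'e::euclidean_space) chart set \<Rightarrow> 'a metric \<Rightarrow> 'a jet metric"
  where "sasaki2 A g W W' = (\<Sum>\<alpha>\<le>2. g (sasaki_K A g \<alpha> W) (sasaki_K A g \<alpha> W'))"

end

(*
  In a chart, a point X = (x, y, z) of T2M (the jet with coordinates c, c', c'') and a tangent vector
  v = (xi, eta, zeta) give the coordinate expressions
    K_0 = xi,   K_1 = eta + Gamma(y, xi),
    2 K_2 = zeta + (D_y Gamma)(y, xi) + Gamma(z, xi) + Gamma(y, eta) + Gamma(y, K_1),
  by the symmetry of mixed partial derivatives. Along the lift of q, with a = q', A = nabla a and
  B = nabla A, they are (a, A, B/2) on the velocity, and no curvature has to be computed.

  The geodesic equation of the lift is used in the form d/dt <C', w> = 1/2 D_w <C', C'> for constant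
  coordinate vectors w. If A = 0, only the K_0 terms survive and this is the geodesic equation of q.
  Conversely, vertical directions w = (0, 0, zeta) yield nabla B = 0, and a geodesic has constant speed,
  so <a, A> + <A, B> = 0; differentiating three times gives <A, B> = 0, then B = 0, then A = 0.
*)
theory Submission
  imports Defs
begin

section \<open>Smooth maps\<close>

text \<open>The definitions shape the work. \<open>cov_deriv\<close> is a definite description that
  asks for the right coordinates in every chart, so the transformation law of the Christoffel
  symbols must be known before any covariant derivative can be computed. \<open>sasaki_K\<close>
  picks an arbitrary family, so its value has to be shown to depend on the tangent vector alone.
  \<open>levi_civita\<close> on the jet manifold is again a definite description, for a metric with
  complicated coefficients; existence and uniqueness are therefore proved for any metric on an open
  subset of a Euclidean space, and this one theory serves both the chart images of M and their
  products with the jet fibres. The Christoffel symbols of the jet metric are never written out: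
  pairing with a constant vector removes them. The repeated differentiation works because
  \<open>A\<close>, \<open>B\<close> and 0 are the covariant derivatives of \<open>a\<close>,
  \<open>A\<close> and \<open>B\<close>, so the inner products of these fields are closed under
  differentiation. The equivalence is local but not pointwise, since identities in t are
  differentiated.\<close>

abbreviation fd :: "('a::real_normed_vector \<Rightarrow> 'b::real_normed_vector) \<Rightarrow> 'a \<Rightarrow> 'a \<Rightarrow> 'b"
  where "fd f x \<equiv> frechet_derivative f (at x)"

section \<open>Closure properties of differentiable and smooth maps\<close>

lemma fd_eqI: "(f has_derivative f') (at x) \<Longrightarrow> fd f x = f'"
  by (rule frechet_derivative_at [symmetric])

text \<open>The recursion tests continuity only at the last level, so dropping a level has to
  recover it there: differentiable maps are continuous, and induction passes through the directional
  derivatives.\<close>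

lemma times_differentiable_on_Suc_D:
  assumes "times_differentiable_on (Suc n) S f"
  shows "times_differentiable_on n S f"
  using assms
proof (induction n arbitrary: f)
  case 0
  then show ?case
    by (auto intro!: differentiable_imp_continuous_on
        simp: differentiable_on_def differentiable_at_withinI)
next
  case (Suc n)
  from Suc.prems have "times_differentiable_on n S (\<lambda>x. fd f x v)" for v
    by (intro Suc.IH) simp
  with Suc.prems show ?case by simp
qed

text \<open>Derivatives are taken in the whole space, so agreement on \<open>S\<close> carries over
  to them because each point of the open set \<open>S\<close> has a neighbourhood inside it.\<close>

lemma times_differentiable_on_cong:
  assumes "open S" "times_differentiable_on n S f" "\<And>x. x \<in> S \<Longrightarrow> f x = g x"
  shows "times_differentiable_on n S g"
  using assms(2,3)
proof (induction n arbitrary: f g)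
  case 0
  then show ?case by (metis continuous_on_cong times_differentiable_on.simps(1))
next
  case (Suc n)
  have der: "(g has_derivative fd f x) (at x)" if "x \<in> S" for x
  proof (rule has_derivative_transform_within_open)
    show "(f has_derivative fd f x) (at x)"
      using Suc.prems that by (simp add: frechet_derivative_works)
  qed (use that assms(1) Suc.prems in auto)
  then have "g differentiable (at x)" if "x \<in> S" for x
    using that by (auto simp: differentiable_def)
  moreover have "times_differentiable_on n S (\<lambda>x. fd g x v)" for v
  proof (rule Suc.IH)
    show "times_differentiable_on n S (\<lambda>x. fd f x v)" using Suc.prems by simp
  qed (simp add: fd_eqI [OF der])
  ultimately show ?case by simp
qed

lemma times_differentiable_on_const: "times_differentiable_on n S (\<lambda>x. c)"
  by (induction n arbitrary: c) simp_all

lemma times_differentiable_on_bounded_linear: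
  assumes "bounded_linear f"
  shows "times_differentiable_on n S f"
proof (cases n)
  case 0
  then show ?thesis by (simp add: assms linear_continuous_on)
next
  case (Suc m)
  have der: "(f has_derivative f) (at x)" for x
    by (simp add: assms bounded_linear_imp_has_derivative)
  have "times_differentiable_on m S (\<lambda>x. fd f x v)" for v
    unfolding fd_eqI [OF der] by (rule times_differentiable_on_const)
  with der show ?thesis
    by (auto simp: Suc differentiable_def)
qed

lemma times_differentiable_on_add:
  assumes "open S" "times_differentiable_on n S f" "times_differentiable_on n S g"
  shows "times_differentiable_on n S (\<lambda>x. f x + g x)"
  using assms(2,3)
proof (induction n arbitrary: f g)
  case 0
  then show ?case by (simp add: continuous_on_add)
next
  case (Suc n)
  have der: "((\<lambda>x. f x + g x) has_derivative (\<lambda>v. fd f x v + fd g x v)) (at x)" if "x \<in> S" for x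
    using Suc.prems that by (auto intro!: has_derivative_add simp: frechet_derivative_works)
  have "times_differentiable_on n S (\<lambda>x. fd (\<lambda>x. f x + g x) x v)" for v
  proof (rule times_differentiable_on_cong [OF assms(1)])
    show "times_differentiable_on n S (\<lambda>x. fd f x v + fd g x v)"
      using Suc by simp
  qed (simp add: fd_eqI [OF der])
  with der show ?case by (auto simp: differentiable_def)
qed

text \<open>The Leibniz rule in the generality that covers scaling, multiplication and inner product
  at once.\<close>

lemma (in bounded_bilinear) times_differentiable_on:
  assumes "open S" "times_differentiable_on n S f" "times_differentiable_on n S g"
  shows "times_differentiable_on n S (\<lambda>x. prod (f x) (g x))"
  using assms(2,3)
proof (induction n arbitrary: f g)
  case 0
  then show ?case by (simp add: continuous_on)
next
  case (Suc n)
  have der: "((\<lambda>x. prod (f x) (g x)) has_derivative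
      (\<lambda>v. prod (f x) (fd g x v) + prod (fd f x v) (g x))) (at x)" if "x \<in> S" for x
    using Suc.prems that by (auto intro!: FDERIV simp: frechet_derivative_works)
  have "times_differentiable_on n S (\<lambda>x. fd (\<lambda>x. prod (f x) (g x)) x v)" for v
  proof (rule times_differentiable_on_cong [OF assms(1)])
    show "times_differentiable_on n S (\<lambda>x. prod (f x) (fd g x v) + prod (fd f x v) (g x))"
      using Suc.prems
      by (intro times_differentiable_on_add [OF assms(1)] Suc.IH
          times_differentiable_on_Suc_D [OF Suc.prems(1)] times_differentiable_on_Suc_D [OF Suc.prems(2)])
        simp_all
  qed (simp add: fd_eqI [OF der])
  with der show ?case by (auto simp: differentiable_def)
qed

lemma times_differentiable_on_sum:
  assumes "open S" "\<And>i. i \<in> I \<Longrightarrow> times_differentiable_on n S (f i)"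
  shows "times_differentiable_on n S (\<lambda>x. \<Sum>i\<in>I. f i x)"
  using assms(2)
  by (induction I rule: infinite_finite_induct)
     (simp_all add: times_differentiable_on_const times_differentiable_on_add [OF assms(1)])

text \<open>The device by which a moving vector is traded for moving scalar coefficients and
  finitely many fixed vectors.\<close>

lemma linear_basis_expansion:
  fixes f :: "'a::euclidean_space \<Rightarrow> 'b::real_vector"
  assumes "linear f"
  shows "f v = (\<Sum>b\<in>Basis. (v \<bullet> b) *\<^sub>R f b)"
proof -
  have "f v = f (\<Sum>b\<in>Basis. (v \<bullet> b) *\<^sub>R b)" by (simp add: euclidean_representation)
  also have "\<dots> = (\<Sum>b\<in>Basis. (v \<bullet> b) *\<^sub>R f b)"
    using assms by (simp add: linear_sum linear_scale)
  finally show ?thesis .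
qed

text \<open>The chain rule differentiates \<open>g\<close> in the direction \<open>fd f x v\<close>,
  which moves with \<open>x\<close>, while the induction hypothesis speaks of fixed directions only.
  Expanding over \<open>Basis\<close> repairs this, which is why the middle space is
  Euclidean.\<close>

lemma times_differentiable_on_compose:
  fixes g :: "'b::euclidean_space \<Rightarrow> 'c::real_normed_vector"
  assumes "open S" "times_differentiable_on n S f" "times_differentiable_on n T g" "f ` S \<subseteq> T"
  shows "times_differentiable_on n S (\<lambda>x. g (f x))"
  using assms(2,3)
proof (induction n arbitrary: g)
  case 0
  then show ?case
    using assms(4) by (auto intro: continuous_on_compose2)
next
  case (Suc n)
  have der: "((\<lambda>x. g (f x)) has_derivative (\<lambda>v. fd g (f x) (fd f x v))) (at x)" if "x \<in> S" for x
    by (rule has_derivative_compose) (use Suc.prems assms(4) that in \<open>auto simp: frechet_derivative_works\<close>)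
  have fd: "fd (\<lambda>x. g (f x)) x v = (\<Sum>b\<in>Basis. (fd f x v \<bullet> b) *\<^sub>R fd g (f x) b)" if "x \<in> S" for x v
    using that Suc.prems assms(4) 
    by (subst fd_eqI [OF der]) (auto intro!: linear_basis_expansion linear_frechet_derivative)
  have "times_differentiable_on n S (\<lambda>x. fd (\<lambda>x. g (f x)) x v)" for v
  proof (rule times_differentiable_on_cong [OF assms(1)])
    show "times_differentiable_on n S (\<lambda>x. \<Sum>b\<in>Basis. (fd f x v \<bullet> b) *\<^sub>R fd g (f x) b)"
    proof (intro times_differentiable_on_sum bounded_bilinear.times_differentiable_on
        [OF bounded_bilinear_scaleR] bounded_bilinear.times_differentiable_on
        [OF bounded_bilinear_inner] assms(1) times_differentiable_on_const)
      show "times_differentiable_on n S (\<lambda>x. fd f x v)" using Suc.prems by simp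
      show "times_differentiable_on n S (\<lambda>x. fd g (f x) b)" for b
        using Suc.prems times_differentiable_on_Suc_D [OF Suc.prems(1)] by (intro Suc.IH) simp_all
    qed
  qed (simp add: fd)
  with der show ?case by (auto simp: differentiable_def)
qed

lemma smooth_on_subset: "smooth_on S f \<Longrightarrow> T \<subseteq> S \<Longrightarrow> smooth_on T f"
proof -
  have "times_differentiable_on n S f \<Longrightarrow> T \<subseteq> S \<Longrightarrow> times_differentiable_on n T f" for n
    by (induction n arbitrary: f) (auto intro: continuous_on_subset)
  then show "smooth_on S f \<Longrightarrow> T \<subseteq> S \<Longrightarrow> smooth_on T f" by (auto simp: smooth_on_def)
qed

lemma smooth_on_cong:
  "open S \<Longrightarrow> smooth_on S f \<Longrightarrow> (\<And>x. x \<in> S \<Longrightarrow> f x = g x) \<Longrightarrow> smooth_on S g"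
  unfolding smooth_on_def using times_differentiable_on_cong by blast

lemma smooth_on_const: "smooth_on S (\<lambda>x. c)"
  by (simp add: smooth_on_def times_differentiable_on_const)

lemma smooth_on_bounded_linear: "bounded_linear f \<Longrightarrow> smooth_on S f"
  by (simp add: smooth_on_def times_differentiable_on_bounded_linear)

lemma smooth_on_ident: "smooth_on S (\<lambda>x. x)"
  by (simp add: smooth_on_bounded_linear)

lemma smooth_on_add:
  "open S \<Longrightarrow> smooth_on S f \<Longrightarrow> smooth_on S g \<Longrightarrow> smooth_on S (\<lambda>x. f x + g x)"
  by (simp add: smooth_on_def times_differentiable_on_add)

lemma smooth_on_sum:
  "open S \<Longrightarrow> (\<And>i. i \<in> I \<Longrightarrow> smooth_on S (f i)) \<Longrightarrow> smooth_on S (\<lambda>x. \<Sum>i\<in>I. f i x)"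
  by (simp add: smooth_on_def times_differentiable_on_sum)

lemma (in bounded_bilinear) smooth_on:
  "open S \<Longrightarrow> smooth_on S f \<Longrightarrow> smooth_on S g \<Longrightarrow> smooth_on S (\<lambda>x. prod (f x) (g x))"
  by (simp add: smooth_on_def times_differentiable_on)

lemmas smooth_on_scaleR = bounded_bilinear.smooth_on [OF bounded_bilinear_scaleR]
lemmas smooth_on_mult = bounded_bilinear.smooth_on [OF bounded_bilinear_mult]
lemmas smooth_on_inner = bounded_bilinear.smooth_on [OF bounded_bilinear_inner]

lemma smooth_on_compose:
  fixes g :: "'b::euclidean_space \<Rightarrow> 'c::real_normed_vector"
  shows "open S \<Longrightarrow> smooth_on S f \<Longrightarrow> smooth_on T g \<Longrightarrow> f ` S \<subseteq> T \<Longrightarrow> smooth_on S (\<lambda>x. g (f x))"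
  unfolding smooth_on_def using times_differentiable_on_compose by blast

text \<open>Seen as the bilinear map \<open>r *\<^sub>R h y\<close> with r constantly 1, the
  composition falls under the Leibniz rule; thus the middle space may be any normed space, unlike in
  \<open>smooth_on_compose\<close>.\<close>

lemma smooth_on_bounded_linear_compose:
  assumes "open S" "bounded_linear h" "smooth_on S f"
  shows "smooth_on S (\<lambda>x. h (f x))"
proof -
  have "bounded_bilinear (\<lambda>(r::real) y. r *\<^sub>R h y)"
    using bounded_bilinear.comp [OF bounded_bilinear_scaleR bounded_linear_ident assms(2)] .
  from bounded_bilinear.smooth_on [OF this assms(1) smooth_on_const [of S 1] assms(3)]
  show ?thesis by simp
qed

lemma smooth_on_uminus: "open S \<Longrightarrow> smooth_on S f \<Longrightarrow> smooth_on S (\<lambda>x. - f x)"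
  by (rule smooth_on_bounded_linear_compose) (auto intro: bounded_linear_minus bounded_linear_ident)

lemma smooth_on_diff:
  "open S \<Longrightarrow> smooth_on S f \<Longrightarrow> smooth_on S g \<Longrightarrow> smooth_on S (\<lambda>x. f x - g x)"
  using smooth_on_add [of S f "\<lambda>x. - g x"] by (simp add: smooth_on_uminus)

lemmas smooth_on_fst = smooth_on_bounded_linear_compose [OF _ bounded_linear_fst]
lemmas smooth_on_snd = smooth_on_bounded_linear_compose [OF _ bounded_linear_snd]

lemma smooth_on_Pair:
  assumes "open S" "smooth_on S f" "smooth_on S g"
  shows "smooth_on S (\<lambda>x. (f x, g x))"
proof -
  have "smooth_on S (\<lambda>x. (f x, 0) + (0, g x))"
  proof (intro smooth_on_add assms(1))
    show "smooth_on S (\<lambda>x. (f x, 0))"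
      by (rule smooth_on_bounded_linear_compose [OF assms(1) _ assms(2)])
         (intro bounded_linear_Pair bounded_linear_ident bounded_linear_zero)
    show "smooth_on S (\<lambda>x. (0, g x))"
      by (rule smooth_on_bounded_linear_compose [OF assms(1) _ assms(3)])
         (intro bounded_linear_Pair bounded_linear_ident bounded_linear_zero)
  qed
  then show ?thesis by simp
qed

lemma smooth_on_differentiable: "smooth_on S f \<Longrightarrow> x \<in> S \<Longrightarrow> f differentiable (at x)"
  unfolding smooth_on_def by (drule spec [of _ "Suc 0"]) simp

lemma smooth_on_has_derivative: "smooth_on S f \<Longrightarrow> x \<in> S \<Longrightarrow> (f has_derivative fd f x) (at x)"
  using smooth_on_differentiable frechet_derivative_works by blast

lemma smooth_on_fd: "smooth_on S f \<Longrightarrow> smooth_on S (\<lambda>x. fd f x v)"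
  unfolding smooth_on_def by (intro allI, drule_tac x = "Suc n" in spec) simp

lemma smooth_on_continuous_on: "smooth_on S f \<Longrightarrow> continuous_on S f"
  unfolding smooth_on_def by (drule spec [of _ 0]) simp

lemma linear_fd: "smooth_on S f \<Longrightarrow> x \<in> S \<Longrightarrow> linear (fd f x)"
  by (simp add: linear_frechet_derivative smooth_on_differentiable)

lemma smooth_on_inverse:
  fixes f :: "'a::real_normed_vector \<Rightarrow> real"
  assumes "open S" "smooth_on S f" "\<And>x. x \<in> S \<Longrightarrow> f x \<noteq> 0"
  shows "smooth_on S (\<lambda>x. inverse (f x))"
proof -
  have op: "open (- {0::real})" by auto
  have "times_differentiable_on n (- {0}) (inverse :: real \<Rightarrow> real)" for n
  proof (induction n)
    case 0
    then show ?case by (auto intro!: continuous_intros)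
  next
    case (Suc n)
    have der: "(inverse has_derivative (\<lambda>v. - (inverse x * v * inverse x))) (at x)" if "x \<noteq> 0" for x :: real
      using has_derivative_inverse' [OF that] .
    have "times_differentiable_on n (- {0}) (\<lambda>x. fd inverse x v)" for v :: real
    proof (rule times_differentiable_on_cong [OF op])
      \<comment> \<open>The derivative of the inverse is a polynomial in the inverse itself, so the
        induction closes.\<close>
      show "times_differentiable_on n (- {0}) (\<lambda>x. (- v) * (inverse x * inverse x))"
        by (intro bounded_bilinear.times_differentiable_on [OF bounded_bilinear_mult] op Suc
            times_differentiable_on_const)
    qed (auto simp: fd_eqI [OF der])
    with der show ?case by (auto simp: differentiable_def)
  qed
  then have "smooth_on (- {0}) (inverse :: real \<Rightarrow> real)" by (simp add: smooth_on_def)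
  from smooth_on_compose [OF assms(1,2) this] assms(3) show ?thesis by force
qed

section \<open>Maps that depend smoothly on a point and linearly on vectors\<close>

lemma smooth_on_family:
  fixes H :: "'b::euclidean_space \<Rightarrow> 'c::euclidean_space \<Rightarrow> 'd::real_normed_vector"
  assumes "open S" "\<And>v. smooth_on U (\<lambda>x. H x v)" "\<And>x. x \<in> U \<Longrightarrow> linear (H x)"
    "smooth_on S p" "p ` S \<subseteq> U" "smooth_on S a"
  shows "smooth_on S (\<lambda>s. H (p s) (a s))"
proof (rule smooth_on_cong [OF assms(1)])
  show "smooth_on S (\<lambda>s. \<Sum>b\<in>Basis. (a s \<bullet> b) *\<^sub>R H (p s) b)"
    by (intro smooth_on_sum smooth_on_scaleR smooth_on_inner smooth_on_const assms(1,6)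
        smooth_on_compose [OF assms(1,4,2,5)])
  show "(\<Sum>b\<in>Basis. (a s \<bullet> b) *\<^sub>R H (p s) b) = H (p s) (a s)" if "s \<in> S" for s
    using linear_basis_expansion [OF assms(3), of "p s" "a s"] that assms(5) by auto
qed

text \<open>Metrics and Christoffel symbols are known to be smooth in the point for fixed vectors.
  This lets the vectors move as well; the inner argument is expanded over the basis in
  \<open>smooth_on_family\<close>, the outer one here.\<close>

lemma smooth_on_bifamily:
  fixes H :: "'b::euclidean_space \<Rightarrow> 'c::euclidean_space \<Rightarrow> 'e::euclidean_space \<Rightarrow> 'd::real_normed_vector"
  assumes "open S" "\<And>v w. smooth_on U (\<lambda>x. H x v w)" "\<And>x. x \<in> U \<Longrightarrow> bilinear (H x)"
    "smooth_on S p" "p ` S \<subseteq> U" "smooth_on S a" "smooth_on S b"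
  shows "smooth_on S (\<lambda>s. H (p s) (a s) (b s))"
proof (rule smooth_on_cong [OF assms(1)])
  show "smooth_on S (\<lambda>s. \<Sum>i\<in>Basis. (b s \<bullet> i) *\<^sub>R H (p s) (a s) i)"
  proof (intro smooth_on_sum smooth_on_scaleR smooth_on_inner smooth_on_const assms(1,7))
    show "smooth_on S (\<lambda>s. H (p s) (a s) i)" for i
      by (rule smooth_on_family [OF assms(1), of U "\<lambda>x v. H x v i"])
         (use assms in \<open>auto simp: bilinear_def\<close>)
  qed
  show "(\<Sum>i\<in>Basis. (b s \<bullet> i) *\<^sub>R H (p s) (a s) i) = H (p s) (a s) (b s)" if "s \<in> S" for s
    using linear_basis_expansion [of "H (p s) (a s)" "b s"] assms(3,5) that by (auto simp: bilinear_def)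
qed

text \<open>Only partial information on \<open>H\<close> is available: differentiability in the
  point for each fixed vector, and linearity in the vector. The basis expansion turns this into a
  finite sum of products, so the total derivative exists and splits into its two parts.\<close>

lemma has_derivative_family:
  fixes H :: "'b::euclidean_space \<Rightarrow> 'c::euclidean_space \<Rightarrow> 'd::real_normed_vector"
  assumes "open U" "\<And>x. x \<in> U \<Longrightarrow> linear (H x)" "p s \<in> U"
    "\<And>v. (\<lambda>x. H x v) differentiable (at (p s))"
    "(p has_derivative p') (at s)" "(a has_derivative a') (at s)"
  shows "((\<lambda>s. H (p s) (a s)) has_derivative
    (\<lambda>u. fd (\<lambda>x. H x (a s)) (p s) (p' u) + H (p s) (a' u))) (at s)"
proof -
  have exp: "H x v = (\<Sum>b\<in>Basis. (v \<bullet> b) *\<^sub>R H x b)" if "x \<in> U" for x v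
    by (rule linear_basis_expansion) (use that assms in auto)
  have D: "((\<lambda>x. H x v) has_derivative fd (\<lambda>x. H x v) (p s)) (at (p s))" for v
    using assms(4) frechet_derivative_works by blast
  have "((\<lambda>x. H x v) has_derivative (\<lambda>u. \<Sum>b\<in>Basis. (v \<bullet> b) *\<^sub>R fd (\<lambda>x. H x b) (p s) u)) (at (p s))" for v
  proof (rule has_derivative_transform_within_open [OF _ assms(1,3)])
    show "((\<lambda>x. \<Sum>b\<in>Basis. (v \<bullet> b) *\<^sub>R H x b) has_derivative
        (\<lambda>u. \<Sum>b\<in>Basis. (v \<bullet> b) *\<^sub>R fd (\<lambda>x. H x b) (p s) u)) (at (p s))"
      by (intro has_derivative_sum has_derivative_scaleR_right D)
  qed (use exp in auto)
  from fd_eqI [OF this]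
  \<comment> \<open>The derivative in the point has the same basis expansion as \<open>H\<close>;
    this reassembles the first half of the sum below.\<close>
  have fdv: "fd (\<lambda>x. H x v) (p s) u = (\<Sum>b\<in>Basis. (v \<bullet> b) *\<^sub>R fd (\<lambda>x. H x b) (p s) u)" for u v
    by (rule fun_cong)
  have "isCont p s" using assms(5) has_derivative_continuous by blast
  with assms(1,3) obtain V where V: "open V" "s \<in> V" "\<And>y. y \<in> V \<Longrightarrow> p y \<in> U"
    using continuous_at_open by metis
  have "((\<lambda>s. \<Sum>b\<in>Basis. (a s \<bullet> b) *\<^sub>R H (p s) b) has_derivative
    (\<lambda>u. \<Sum>b\<in>Basis. (a s \<bullet> b) *\<^sub>R fd (\<lambda>x. H x b) (p s) (p' u) + (a' u \<bullet> b) *\<^sub>R H (p s) b)) (at s)"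
    by (intro has_derivative_sum has_derivative_scaleR has_derivative_inner_left assms
        has_derivative_compose [OF assms(5) D])
  then have "((\<lambda>s. H (p s) (a s)) has_derivative
    (\<lambda>u. \<Sum>b\<in>Basis. (a s \<bullet> b) *\<^sub>R fd (\<lambda>x. H x b) (p s) (p' u) + (a' u \<bullet> b) *\<^sub>R H (p s) b)) (at s)"
    by (rule has_derivative_transform_within_open [OF _ V(1,2)]) (use V(3) exp in auto)
  then show ?thesis
    unfolding sum.distrib fdv [symmetric] exp [OF assms(3), symmetric] .
qed

lemma has_derivative_bifamily:
  fixes H :: "'b::euclidean_space \<Rightarrow> 'c::euclidean_space \<Rightarrow> 'e::euclidean_space \<Rightarrow> 'd::real_normed_vector"
    and s :: "'a::euclidean_space"
  assumes "open U" "\<And>x. x \<in> U \<Longrightarrow> bilinear (H x)" "p s \<in> U"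
    "\<And>v w. (\<lambda>x. H x v w) differentiable (at (p s))"
    "(p has_derivative p') (at s)" "(a has_derivative a') (at s)" "(b has_derivative b') (at s)"
  shows "((\<lambda>s. H (p s) (a s) (b s)) has_derivative
    (\<lambda>u. fd (\<lambda>x. H x (a s) (b s)) (p s) (p' u) + H (p s) (a' u) (b s) + H (p s) (a s) (b' u))) (at s)"
proof -
  have "isCont p s" using assms(5) has_derivative_continuous by blast
  with assms(1,3) obtain V where V: "open V" "s \<in> V" "\<And>y. y \<in> V \<Longrightarrow> p y \<in> U"
    using continuous_at_open by metis
  have 1: "((\<lambda>s. H (p s) (a s) w) has_derivative
    (\<lambda>u. fd (\<lambda>x. H x (a s) w) (p s) (p' u) + H (p s) (a' u) w)) (at s)" for w
    by (rule has_derivative_family [where H = "\<lambda>x v. H x v w", OF assms(1)])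
       (use assms in \<open>auto simp: bilinear_def\<close>)
  have "((\<lambda>s. H (p s) (a s) (b s)) has_derivative
    (\<lambda>u. fd (\<lambda>x. H (p x) (a x) (b s)) s u + H (p s) (a s) (b' u))) (at s)"
  \<comment> \<open>Second use of the one-vector rule, with the parameter \<open>s\<close> itself as
    the base point: the pair of \<open>p\<close> and \<open>a\<close> is absorbed into the family,
    whose derivative for fixed \<open>w\<close> is given by 1.\<close>
  proof (rule has_derivative_family [where H = "\<lambda>s w. H (p s) (a s) w" and p = "\<lambda>s. s", OF V(1)])
    show "(\<lambda>x. H (p x) (a x) v) differentiable (at s)" for v
      using 1 unfolding differentiable_def by blast
  qed (use assms V in \<open>auto simp: bilinear_def\<close>)
  then show ?thesis unfolding fd_eqI [OF 1] .
qed

text \<open>Additivity and homogeneity are identities on a neighbourhood of \<open>x\<close> and may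
  be differentiated there. Needed for the terms in which the metric or the Christoffel symbols are
  differentiated in the base point.\<close>

lemma linear_fd_family:
  assumes "open U" "x \<in> U" "\<And>y. y \<in> U \<Longrightarrow> linear (H y)" "\<And>v. (\<lambda>y. H y v) differentiable (at x)"
  shows "linear (\<lambda>v. fd (\<lambda>y. H y v) x u)"
proof (rule linearI)
  have D: "((\<lambda>y. H y v) has_derivative fd (\<lambda>y. H y v) x) (at x)" for v
    using assms(4) frechet_derivative_works by blast
  fix v w r
  have "((\<lambda>y. H y (v + w)) has_derivative (\<lambda>u. fd (\<lambda>y. H y v) x u + fd (\<lambda>y. H y w) x u)) (at x)"
    by (rule has_derivative_transform_within_open [OF has_derivative_add [OF D D] assms(1,2)])
       (simp add: linear_add [OF assms(3)])
  from fd_eqI [OF this] show "fd (\<lambda>y. H y (v + w)) x u = fd (\<lambda>y. H y v) x u + fd (\<lambda>y. H y w) x u"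
    by (rule fun_cong)
  have "((\<lambda>y. H y (r *\<^sub>R v)) has_derivative (\<lambda>u. r *\<^sub>R fd (\<lambda>y. H y v) x u)) (at x)"
    by (rule has_derivative_transform_within_open [OF has_derivative_scaleR_right [OF D] assms(1,2)])
       (simp add: linear_scale [OF assms(3)])
  from fd_eqI [OF this] show "fd (\<lambda>y. H y (r *\<^sub>R v)) x u = r *\<^sub>R fd (\<lambda>y. H y v) x u"
    by (rule fun_cong)
qed

section \<open>Velocities of curves\<close>

lemma vderiv_eqI: "(f has_vector_derivative f') (at t) \<Longrightarrow> vderiv f t = f'"
  by (simp add: vderiv_def vector_derivative_at)

lemma vderiv_eq_fd: "f differentiable (at t) \<Longrightarrow> vderiv f t = fd f t 1"
  by (simp add: vderiv_def frechet_derivative_eq_vector_derivative)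

lemma smooth_on_has_vderiv:
  "smooth_on U f \<Longrightarrow> t \<in> U \<Longrightarrow> (f has_vector_derivative vderiv f t) (at t)"
  unfolding vderiv_def
  using smooth_on_differentiable vector_derivative_works by blast

lemma smooth_on_vderiv:
  assumes "open U" "smooth_on U f"
  shows "smooth_on U (vderiv f)"
  by (rule smooth_on_cong [OF assms(1) smooth_on_fd [OF assms(2), of 1]])
     (simp add: vderiv_eq_fd smooth_on_differentiable [OF assms(2)])

text \<open>\<open>vector_derivative\<close> is a choice among the derivatives at the point. Both
  functions have the same ones, so the values agree even where no derivative exists.\<close>

lemma vderiv_cong:
  assumes "open U" "t \<in> U" "\<And>s. s \<in> U \<Longrightarrow> f s = g s"
  shows "vderiv f t = vderiv g t"
proof -
  have "(f has_vector_derivative d) (at t) \<longleftrightarrow> (g has_vector_derivative d) (at t)" for d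
    using assms has_vector_derivative_transform_within_open by metis
  then show ?thesis by (simp add: vderiv_def vector_derivative_def)
qed

lemma funpow_vderiv_cong:
  assumes "open U" "t \<in> U" "\<And>s. s \<in> U \<Longrightarrow> f s = g s"
  shows "(vderiv ^^ k) f t = (vderiv ^^ k) g t"
  using assms(2)
proof (induction k arbitrary: t)
  case (Suc k)
  then show ?case by (auto intro: vderiv_cong [OF assms(1)])
qed (use assms in simp)

lemma vderiv_shift: "vderiv (\<lambda>s. f (t + s)) s = vderiv f (t + s)"
proof -
  have "((\<lambda>s. f (t + s)) has_vector_derivative d) (at s) \<longleftrightarrow>
      (f has_vector_derivative d) (at (t + s))" for d
  proof
    assume "((\<lambda>s. f (t + s)) has_vector_derivative d) (at s)"
    then have 1: "((\<lambda>s. f (t + s)) has_vector_derivative d) (at (t + s - t))" by simp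
    have 2: "((\<lambda>r. r - t) has_vector_derivative 1) (at (t + s))"
      by (auto intro!: derivative_eq_intros)
    show "(f has_vector_derivative d) (at (t + s))"
      using vector_diff_chain_at [OF 2 1] by (simp add: o_def)
  next
    assume 1: "(f has_vector_derivative d) (at (t + s))"
    have 2: "((\<lambda>s. t + s) has_vector_derivative 1) (at s)"
      by (auto intro!: derivative_eq_intros)
    show "((\<lambda>s. f (t + s)) has_vector_derivative d) (at s)"
      using vector_diff_chain_at [OF 2 1] by (simp add: o_def)
  qed
  then show ?thesis by (simp add: vderiv_def vector_derivative_def)
qed

lemma funpow_vderiv_shift: "(vderiv ^^ k) (\<lambda>s. f (t + s)) = (\<lambda>s. (vderiv ^^ k) f (t + s))"
proof (induction k)
  case (Suc k)
  then show ?case by (simp add: vderiv_shift [abs_def])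
qed simp

lemma has_vector_derivative_compose_fd:
  assumes "f differentiable (at (c t))" "(c has_vector_derivative c') (at t)"
  shows "((\<lambda>s. f (c s)) has_vector_derivative fd f (c t) c') (at t)"
  using has_derivative_compose [of c "\<lambda>h. h *\<^sub>R c'" t UNIV f "fd f (c t)"] assms
  by (simp add: has_vector_derivative_def frechet_derivative_works
      linear_frechet_derivative linear_scale)

section \<open>Symmetry of second derivatives\<close>

lemma has_vector_derivative_line: "((\<lambda>s. x + s *\<^sub>R v) has_vector_derivative v) (at s)"
  by (auto intro!: derivative_eq_intros simp: has_vector_derivative_def)

text \<open>The second difference on the left is symmetric in \<open>u\<close> and \<open>v\<close>,
  whereas the right side is one of the two mixed derivatives at a nearby point. Two applications of
  the mean value theorem give it.\<close>

lemma second_difference_mean_value: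
  fixes f :: "'a::real_normed_vector \<Rightarrow> real"
  assumes "smooth_on (ball x r) f" "0 < h" "h * (norm u + norm v) < r"
  shows "\<exists>y. norm (y - x) \<le> h * (norm u + norm v) \<and>
    f (x + h *\<^sub>R u + h *\<^sub>R v) - f (x + h *\<^sub>R u) - f (x + h *\<^sub>R v) + f x = h\<^sup>2 * fd (\<lambda>y. fd f y u) y v"
proof -
  have bd: "norm (s *\<^sub>R u + t *\<^sub>R v) \<le> h * (norm u + norm v)"
    if "0 \<le> s" "s \<le> h" "0 \<le> t" "t \<le> h" for s t
  proof -
    have "norm (s *\<^sub>R u + t *\<^sub>R v) \<le> s * norm u + t * norm v"
      using norm_triangle_ineq [of "s *\<^sub>R u" "t *\<^sub>R v"] that by simp
    also have "\<dots> \<le> h * norm u + h * norm v"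
      using that by (intro add_mono mult_right_mono) auto
    finally show ?thesis by (simp add: algebra_simps)
  qed
  have inb: "x + s *\<^sub>R u + t *\<^sub>R v \<in> ball x r"
    if "0 \<le> s" "s \<le> h" "0 \<le> t" "t \<le> h" for s t
  proof -
    have "dist x (x + (s *\<^sub>R u + t *\<^sub>R v)) = norm (s *\<^sub>R u + t *\<^sub>R v)"
      by (metis add_diff_cancel_left' dist_commute dist_norm)
    then show ?thesis using bd [OF that] assms(3) by (simp add: add.assoc)
  qed
  \<comment> \<open>The second difference is the increment of this function between 0 and
    \<open>h\<close>. The mean value theorem first moves \<open>s\<close>, and then moves
    \<open>t\<close> in the resulting difference of derivatives.\<close>
  define \<phi> where "\<phi> s = f (x + s *\<^sub>R u + h *\<^sub>R v) - f (x + s *\<^sub>R u + 0 *\<^sub>R v)" for s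
  have D: "((\<lambda>s. f (x + s *\<^sub>R u + t *\<^sub>R v)) has_vector_derivative fd f (x + s *\<^sub>R u + t *\<^sub>R v) u) (at s)"
    if "0 \<le> s" "s \<le> h" "0 \<le> t" "t \<le> h" for s t
    using has_vector_derivative_line [of "x + t *\<^sub>R v" u s] inb [OF that]
      smooth_on_differentiable [OF assms(1)]
    by (intro has_vector_derivative_compose_fd) (auto simp: algebra_simps)
  have "(\<phi> has_real_derivative
      (fd f (x + s *\<^sub>R u + h *\<^sub>R v) u - fd f (x + s *\<^sub>R u + 0 *\<^sub>R v) u)) (at s)" if "0 \<le> s" "s \<le> h" for s
    unfolding \<phi>_def has_real_derivative_iff_has_vector_derivative
    using that assms(2) by (intro has_vector_derivative_diff D) auto
  from MVT2 [OF assms(2) this] obtain s where s: "0 < s" "s < h"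
    "\<phi> h - \<phi> 0 = h * (fd f (x + s *\<^sub>R u + h *\<^sub>R v) u - fd f (x + s *\<^sub>R u + 0 *\<^sub>R v) u)" by auto
  have "((\<lambda>t. fd f (x + s *\<^sub>R u + t *\<^sub>R v) u) has_real_derivative
      fd (\<lambda>y. fd f y u) (x + s *\<^sub>R u + t *\<^sub>R v) v) (at t)" if "0 \<le> t" "t \<le> h" for t
    unfolding has_real_derivative_iff_has_vector_derivative
    using smooth_on_differentiable [OF smooth_on_fd [OF assms(1)]] inb [of s t] s that
    by (intro has_vector_derivative_compose_fd has_vector_derivative_line) auto
  from MVT2 [OF assms(2) this] obtain t where t: "0 < t" "t < h"
    "fd f (x + s *\<^sub>R u + h *\<^sub>R v) u - fd f (x + s *\<^sub>R u + 0 *\<^sub>R v) u =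
      h * fd (\<lambda>y. fd f y u) (x + s *\<^sub>R u + t *\<^sub>R v) v" by auto
  show ?thesis
  proof (intro exI conjI)
    show "norm (x + s *\<^sub>R u + t *\<^sub>R v - x) \<le> h * (norm u + norm v)"
      using bd [of s t] s t by (simp add: add.assoc)
    show "f (x + h *\<^sub>R u + h *\<^sub>R v) - f (x + h *\<^sub>R u) - f (x + h *\<^sub>R v) + f x =
        h\<^sup>2 * fd (\<lambda>y. fd f y u) (x + s *\<^sub>R u + t *\<^sub>R v) v"
      using s(3) unfolding t(3) \<phi>_def by (simp add: power2_eq_square)
  qed
qed

lemma fd_bounded_linear:
  assumes "bounded_linear h" "f differentiable (at x)"
  shows "fd (\<lambda>x. h (f x)) x = (\<lambda>v. h (fd f x v))"
  using assms bounded_linear.has_derivative frechet_derivative_works by (blast intro: fd_eqI)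

lemma symmetric_second_derivative_real:
  fixes f :: "'a::real_normed_vector \<Rightarrow> real"
  assumes "open S" "smooth_on S f" "x \<in> S"
  shows "fd (\<lambda>y. fd f y u) x v = fd (\<lambda>y. fd f y v) x u"
proof (rule ccontr)
  let ?D = "\<lambda>u v y. fd (\<lambda>y. fd f y u) y v"
  assume ne: "?D u v x \<noteq> ?D v u x"
  \<comment> \<open>Half the gap: two numbers within this distance of the two mixed derivatives at
    \<open>x\<close> cannot coincide.\<close>
  define e where "e = \<bar>?D u v x - ?D v u x\<bar> / 2"
  have e: "e > 0" using ne by (simp add: e_def)
  obtain r0 where r0: "r0 > 0" "ball x r0 \<subseteq> S" using assms openE by blast
  have ex: "\<exists>r>0. \<forall>y\<in>ball x r. \<bar>?D u v y - ?D u v x\<bar> < e" for u v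
  proof -
    have "continuous_on S (?D u v)"
      by (intro smooth_on_continuous_on smooth_on_fd assms)
    then have "isCont (?D u v) x" using assms by (simp add: continuous_on_eq_continuous_at)
    then show ?thesis using e by (force simp: continuous_at_eps_delta dist_norm norm_minus_commute)
  qed
  obtain r1 where r1: "r1 > 0" "\<And>y. y \<in> ball x r1 \<Longrightarrow> \<bar>?D u v y - ?D u v x\<bar> < e" using ex by blast
  obtain r2 where r2: "r2 > 0" "\<And>y. y \<in> ball x r2 \<Longrightarrow> \<bar>?D v u y - ?D v u x\<bar> < e" using ex by blast
  define r where "r = min r0 (min r1 r2)"
  \<comment> \<open>Small enough that the parallelogram spanned by \<open>h *\<^sub>R u\<close> and
    \<open>h *\<^sub>R v\<close> stays in the ball of radius \<open>r\<close>; the summand 1 keeps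
    the denominator positive when both directions vanish.\<close>
  define h where "h = r / (2 * (norm u + norm v + 1))"
  have nn: "norm u + norm v + 1 > 0" by (intro add_nonneg_pos) auto
  have r: "r > 0" using r0 r1 r2 by (simp add: r_def)
  have h: "h > 0" using r nn by (simp add: h_def)
  have "h * (norm u + norm v) \<le> h * (norm u + norm v + 1)" using h by simp
  also have "\<dots> = r / 2" unfolding h_def using nn by (simp add: field_simps)
  also have "\<dots> < r" using r by simp
  finally have hr: "h * (norm u + norm v) < r" .
  have sm: "smooth_on (ball x r) f"
    by (rule smooth_on_subset [OF assms(2)]) (use r0 in \<open>auto simp: r_def\<close>)
  obtain y where y: "norm (y - x) \<le> h * (norm u + norm v)"
    "f (x + h *\<^sub>R u + h *\<^sub>R v) - f (x + h *\<^sub>R u) - f (x + h *\<^sub>R v) + f x = h\<^sup>2 * ?D u v y"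
    using second_difference_mean_value [OF sm h hr] by blast
  obtain z where z: "norm (z - x) \<le> h * (norm v + norm u)"
    "f (x + h *\<^sub>R v + h *\<^sub>R u) - f (x + h *\<^sub>R v) - f (x + h *\<^sub>R u) + f x = h\<^sup>2 * ?D v u z"
    using second_difference_mean_value [OF sm h, of v u] hr by (auto simp: add.commute)
  have "h\<^sup>2 * ?D u v y = h\<^sup>2 * ?D v u z"
    using y(2) z(2) by (simp add: add.commute add.left_commute algebra_simps)
  then have eq: "?D u v y = ?D v u z" using h by simp
  have "y \<in> ball x r1" "z \<in> ball x r2"
    using y(1) z(1) hr by (auto simp: r_def dist_norm norm_minus_commute add.commute)
  then have "\<bar>?D u v y - ?D u v x\<bar> < e" "\<bar>?D v u z - ?D v u x\<bar> < e" using r1 r2 by auto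
  then show False using eq unfolding e_def by (auto simp: abs_if field_simps split: if_splits)
qed

text \<open>The mean value theorem is about real functions, so the vector-valued case is reduced to
  inner products with basis vectors.\<close>

lemma symmetric_second_derivative:
  fixes f :: "'a::real_normed_vector \<Rightarrow> 'b::euclidean_space"
  assumes "open S" "smooth_on S f" "x \<in> S"
  shows "fd (\<lambda>y. fd f y u) x v = fd (\<lambda>y. fd f y v) x u"
proof (rule euclidean_eqI)
  fix b :: 'b
  have bl: "bounded_linear (\<lambda>z. z \<bullet> b)" by (rule bounded_linear_inner_left)
  have sm: "smooth_on S (\<lambda>x. f x \<bullet> b)" by (rule smooth_on_bounded_linear_compose [OF assms(1) bl assms(2)])
  have 1: "fd (\<lambda>y. f y \<bullet> b) y u = fd f y u \<bullet> b" if "y \<in> S" for y u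
    using fd_bounded_linear [OF bl smooth_on_differentiable [OF assms(2) that]] by simp
  have 2: "fd (\<lambda>y. fd (\<lambda>y. f y \<bullet> b) y u) x v = fd (\<lambda>y. fd f y u) x v \<bullet> b" for u v
  proof -
    have "(\<lambda>y. fd f y u \<bullet> b) differentiable (at x)"
      using smooth_on_differentiable [OF smooth_on_bounded_linear_compose
          [OF assms(1) bl smooth_on_fd [OF assms(2)]] assms(3)] .
    then have "fd (\<lambda>y. fd f y u \<bullet> b) x = fd (\<lambda>y. fd (\<lambda>y. f y \<bullet> b) y u) x"
      by (rule frechet_derivative_transform_within_open [OF _ assms(1,3)]) (simp add: 1)
    then show ?thesis
      using fun_cong [OF fd_bounded_linear [OF bl smooth_on_differentiable [OF smooth_on_fd [OF assms(2)] assms(3)]]]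
      by metis
  qed
  show "fd (\<lambda>y. fd f y u) x v \<bullet> b = fd (\<lambda>y. fd f y v) x u \<bullet> b"
    using symmetric_second_derivative_real [OF assms(1) sm assms(3), of u v] by (simp add: 2)
qed

section \<open>Algebra of bilinear maps\<close>

lemma bilinear_simps:
  assumes "bilinear B"
  shows "B (x + y) z = B x z + B y z" "B x (y + z) = B x y + B x z"
    "B (x - y) z = B x z - B y z" "B x (y - z) = B x y - B x z"
    "B (r *\<^sub>R x) y = r *\<^sub>R B x y" "B x (r *\<^sub>R y) = r *\<^sub>R B x y"
    "B 0 y = 0" "B x 0 = 0"
  using assms by (simp_all add: bilinear_ladd bilinear_radd bilinear_lsub bilinear_rsub
      bilinear_lmul bilinear_rmul bilinear_lzero bilinear_rzero)

lemma bilinear_lincomb_left: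
  assumes "bilinear B"
  shows "B (\<Sum>i\<in>I. r i *\<^sub>R x i) y = (\<Sum>i\<in>I. r i *\<^sub>R B (x i) y)"
proof -
  have lin: "linear (\<lambda>v. B v y)" using assms by (simp add: bilinear_def)
  show ?thesis by (simp add: linear_sum [OF lin] linear_scale [OF lin])
qed

section \<open>Metrics and Christoffel symbols on open sets\<close>

text \<open>The description inside \<open>levi_civita\<close>, detached from atlases and tangent
  vectors, so that it applies to any coordinate expression of a metric, in particular to that of the
  jet metric.\<close>

definition christoffel ::
  "('e::euclidean_space \<Rightarrow> 'e \<Rightarrow> 'e \<Rightarrow> real) \<Rightarrow> 'e \<Rightarrow> 'e \<Rightarrow> 'e \<Rightarrow> 'e"
  where "christoffel G x =
    (THE \<Gamma>. bilinear \<Gamma> \<and> (\<forall>v w. \<Gamma> v w = \<Gamma> w v) \<and>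
       (\<forall>u v w. fd (\<lambda>y. G y v w) x u = G x (\<Gamma> u v) w + G x v (\<Gamma> u w)))"

lemma levi_civita_eq_christoffel: "levi_civita A g C x = christoffel (metric_coord A g C) x"
  by (simp add: levi_civita_def christoffel_def Let_def)

text \<open>A Riemannian metric on an open subset of a Euclidean space. Each chart of M gives two
  instances: its image, and the product of that image with the space of velocities and
  accelerations.\<close>

locale local_metric =
  fixes U :: "'e::euclidean_space set" and G :: "'e \<Rightarrow> 'e \<Rightarrow> 'e \<Rightarrow> real"
  assumes open_dom: "open U"
    and bilinear: "x \<in> U \<Longrightarrow> bilinear (G x)"
    and sym: "x \<in> U \<Longrightarrow> G x v w = G x w v"
    and pos: "x \<in> U \<Longrightarrow> v \<noteq> 0 \<Longrightarrow> G x v v > 0"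
    and smooth: "smooth_on U (\<lambda>x. G x v w)"
begin

lemmas G_simps = bilinear_simps [OF bilinear]

lemma nondegenerate: "x \<in> U \<Longrightarrow> (\<And>w. G x v w = G x v' w) \<Longrightarrow> v = v'"
  using pos [of x "v - v'"] G_simps(3) [of x v v' "v - v'"] by force

lemma zero_iff: "x \<in> U \<Longrightarrow> G x v v = 0 \<longleftrightarrow> v = 0"
  using pos [of x v] G_simps(7) [of x v] by force

text \<open>
  The dual frame makes the Christoffel symbols smooth without inverting the Gram matrix.
\<close>

lemma dual_frame:
  assumes "finite S" "independent S"
  shows "\<exists>d. \<forall>b\<in>S. smooth_on U (d b) \<and> (\<forall>x\<in>U. d b x \<in> span S \<and>
    (\<forall>c\<in>S. G x (d b x) c = (if b = c then 1 else 0)))"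
  using assms
proof (induction S rule: finite_induct)
  case empty
  then show ?case by simp
next
  case (insert c S)
  then have ind: "independent S" and c: "c \<notin> span S" by (simp_all add: independent_insert)
  obtain d where d: "\<And>b. b \<in> S \<Longrightarrow> smooth_on U (d b)"
    "\<And>b x. b \<in> S \<Longrightarrow> x \<in> U \<Longrightarrow> d b x \<in> span S"
    "\<And>b x a. b \<in> S \<Longrightarrow> x \<in> U \<Longrightarrow> a \<in> S \<Longrightarrow> G x (d b x) a = (if b = a then 1 else 0)"
    using insert.IH [OF ind] by blast
  \<comment> \<open>\<open>e\<close> is the component of \<open>c\<close> orthogonal to \<open>S\<close>, of squared length \<open>N\<close>.\<close>
  define p where "p x = (\<Sum>b\<in>S. G x c b *\<^sub>R d b x)" for x
  define e where "e x = c - p x" for x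
  define N where "N x = G x (e x) (e x)" for x
  have p: "p x \<in> span S" if "x \<in> U" for x
    unfolding p_def using d(2) that by (intro span_sum span_scale)
  have smG: "smooth_on U f \<Longrightarrow> smooth_on U h \<Longrightarrow> smooth_on U (\<lambda>x. G x (f x) (h x))" for f h
    by (rule smooth_on_bifamily [OF open_dom smooth bilinear smooth_on_ident]) auto
  have sp: "smooth_on U p" unfolding p_def
    by (intro smooth_on_sum smooth_on_scaleR open_dom d smooth)
  have se: "smooth_on U e" unfolding e_def
    by (intro smooth_on_diff open_dom smooth_on_const sp)
  have N: "N x > 0" if "x \<in> U" for x
  proof -
    have "e x \<noteq> 0" using p [OF that] c by (auto simp: e_def)
    then show ?thesis using pos that by (simp add: N_def)
  qed
  have sN: "smooth_on U (\<lambda>x. inverse (N x))"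
    using N smG [OF se se] unfolding N_def
    by (intro smooth_on_inverse open_dom) force+
  have eS: "G x (e x) b = 0" if "x \<in> U" "b \<in> S" for x b
  proof -
    have "G x (p x) b = (\<Sum>a\<in>S. G x c a * G x (d a x) b)"
      by (simp add: p_def bilinear_lincomb_left [OF bilinear [OF that(1)]])
    also have "\<dots> = (\<Sum>a\<in>S. if a = b then G x c b else 0)"
      by (rule sum.cong) (use d(3) that in auto)
    also have "\<dots> = G x c b" using insert.hyps that by simp
    finally show ?thesis using that by (simp add: e_def G_simps)
  qed
  have espan: "G x (e x) v = 0" if "x \<in> U" "v \<in> span S" for x v
    using that(2)
    by (induction rule: span_induct_alt) (use that(1) eS in \<open>simp_all add: G_simps\<close>)
  \<comment> \<open>Here \<open>c\<close> is \<open>e x + p x\<close>, and \<open>p x\<close> lies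
    in the span of \<open>S\<close>, to which \<open>e x\<close> is orthogonal.\<close>
  have ec: "G x (e x) c = N x" if "x \<in> U" for x
    using espan [OF that p [OF that]] that
    by (simp add: N_def e_def G_simps)
  \<comment> \<open>The new dual vector is the normalized orthogonal component of \<open>c\<close>.
    The old ones are corrected by a multiple of \<open>e x\<close>, which makes them annihilate
    \<open>c\<close> and leaves their pairings with \<open>S\<close> unchanged.\<close>
  define d' where "d' b x = (if b = c then inverse (N x) *\<^sub>R e x
    else d b x - (G x (d b x) c * inverse (N x)) *\<^sub>R e x)" for b x
  have "smooth_on U (d' b)" if "b \<in> insert c S" for b
    using that insert.hyps unfolding d'_def
    by (cases "b = c") (auto intro!: smooth_on_diff smooth_on_scaleR smooth_on_mult open_dom sN se d smG
        smooth_on_const simp del: mult_cancel_left)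
  moreover have "d' b x \<in> span (insert c S)" if "b \<in> insert c S" "x \<in> U" for b x
  proof -
    have "e x \<in> span (insert c S)" unfolding e_def
      using p [OF that(2)] span_mono [of S "insert c S"] by (auto intro!: span_diff intro: span_base)
    moreover have "b \<in> S \<Longrightarrow> d b x \<in> span (insert c S)"
      using d(2) that span_mono [of S "insert c S"] by auto
    ultimately show ?thesis using that by (auto simp: d'_def intro!: span_diff span_scale)
  qed
  moreover have "G x (d' b x) a = (if b = a then 1 else 0)" if "b \<in> insert c S" "x \<in> U" "a \<in> insert c S" for a b x
    using that insert.hyps N [OF that(2)] ec [OF that(2)] eS [OF that(2)] d(3)
    by (auto simp: d'_def G_simps)
  ultimately show ?case by (intro exI [of _ d']) blast
qed

text \<open>The right side of the Koszul formula for coordinate fields with constant coefficients,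
  whose Lie brackets vanish.\<close>

definition koszul :: "'e \<Rightarrow> 'e \<Rightarrow> 'e \<Rightarrow> 'e \<Rightarrow> real"
  where "koszul x u v w =
    (fd (\<lambda>y. G y v w) x u + fd (\<lambda>y. G y u w) x v - fd (\<lambda>y. G y u v) x w) / 2"

lemma fd_G_linear: "x \<in> U \<Longrightarrow> linear (fd (\<lambda>y. G y v w) x)"
  using linear_fd [OF smooth] .

lemma fd_G_cong:
  assumes "x \<in> U" "\<And>y. y \<in> U \<Longrightarrow> f y = G y v w"
  shows "fd f x = fd (\<lambda>y. G y v w) x"
  by (rule frechet_derivative_transform_within_open [OF _ open_dom assms(1), symmetric])
     (use assms smooth_on_differentiable [OF smooth] in auto)

lemma fd_G_bilinear:
  assumes x: "x \<in> U"
  shows "bilinear (\<lambda>v w. fd (\<lambda>y. G y v w) x u)"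
  unfolding bilinear_def
proof (intro conjI allI)
  note D = smooth_on_differentiable [OF smooth x]
  show "linear (\<lambda>w. fd (\<lambda>y. G y v w) x u)" for v
    by (rule linear_fd_family [OF open_dom x _ D]) (use bilinear in \<open>simp add: bilinear_def\<close>)
  show "linear (\<lambda>v. fd (\<lambda>y. G y v w) x u)" for w
    by (rule linear_fd_family [OF open_dom x _ D]) (use bilinear in \<open>simp add: bilinear_def\<close>)
qed

lemmas fd_G_simps = bilinear_simps [OF fd_G_bilinear] linear_add [OF fd_G_linear] linear_scale [OF fd_G_linear]

lemma fd_G_sym: "x \<in> U \<Longrightarrow> fd (\<lambda>y. G y v w) x = fd (\<lambda>y. G y w v) x"
  by (rule fd_G_cong) (auto simp: sym)

text \<open>The cyclic combination of the compatibility condition: by symmetry of the connection all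
  terms cancel except two equal ones. Uniqueness of the Levi-Civita connection follows.\<close>

lemma connection_koszul:
  assumes x: "x \<in> U" and s: "\<And>v w. \<Gamma> v w = \<Gamma> w v"
    and m: "\<And>u v w. fd (\<lambda>y. G y v w) x u = G x (\<Gamma> u v) w + G x v (\<Gamma> u w)"
  shows "G x (\<Gamma> u v) w = koszul x u v w"
  unfolding koszul_def m using s [of v u] s [of w u] s [of w v] sym [OF x, of v "\<Gamma> u w"]
    sym [OF x, of "\<Gamma> v w" u]
  by simp

lemma koszul_linear:
  assumes x: "x \<in> U"
  shows "linear (koszul x u v)" "linear (\<lambda>u. koszul x u v w)" "linear (\<lambda>v. koszul x u v w)"
  by (auto intro!: linearI simp: koszul_def fd_G_simps [OF x] field_simps)

text \<open>Raising an index: a functional is represented by its values on the basis against the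
  dual frame. The frame is chosen once for all points and arguments, so smoothness of the
  representing vector in the point will follow.\<close>

lemma koszul_representation:
  "\<exists>d. \<forall>b\<in>Basis. smooth_on U (d b) \<and>
    (\<forall>x\<in>U. \<forall>u v w. G x (\<Sum>b\<in>Basis. koszul x u v b *\<^sub>R d b x) w = koszul x u v w)"
proof -
  obtain d where d: "\<And>b. b \<in> Basis \<Longrightarrow> smooth_on U (d b)"
    "\<And>b x c. b \<in> Basis \<Longrightarrow> x \<in> U \<Longrightarrow> c \<in> Basis \<Longrightarrow> G x (d b x) c = (if b = c then 1 else 0)"
    using dual_frame [OF finite_Basis independent_Basis] by metis
  have "G x (\<Sum>b\<in>Basis. koszul x u v b *\<^sub>R d b x) w = koszul x u v w" if x: "x \<in> U" for x u v w
  proof -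
    have lin: "linear (G x (\<Sum>b\<in>Basis. koszul x u v b *\<^sub>R d b x))" using bilinear [OF x] by (simp add: bilinear_def)
    have "G x (\<Sum>b\<in>Basis. koszul x u v b *\<^sub>R d b x) c = koszul x u v c" if c: "c \<in> Basis" for c
    proof -
      have "G x (\<Sum>b\<in>Basis. koszul x u v b *\<^sub>R d b x) c = (\<Sum>b\<in>Basis. koszul x u v b * G x (d b x) c)"
        by (simp add: bilinear_lincomb_left [OF bilinear [OF x]])
      also have "\<dots> = (\<Sum>b\<in>Basis. if b = c then koszul x u v c else 0)"
        by (rule sum.cong) (use d(2) x c in auto)
      finally show ?thesis using c by simp
    qed
    then show ?thesis
      using linear_basis_expansion [OF lin, of w] linear_basis_expansion [OF koszul_linear(1) [OF x, of u v], of w]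
      by simp
  qed
  then show ?thesis using d(1) by blast
qed

text \<open>The fundamental theorem of Riemannian geometry in coordinates. Existence comes from
  representing the Koszul functional; bilinearity and symmetry are then checked by pairing with an
  arbitrary vector.\<close>

lemma christoffel_ex1:
  assumes x: "x \<in> U"
  shows "\<exists>!\<Gamma>. bilinear \<Gamma> \<and> (\<forall>v w. \<Gamma> v w = \<Gamma> w v) \<and>
       (\<forall>u v w. fd (\<lambda>y. G y v w) x u = G x (\<Gamma> u v) w + G x v (\<Gamma> u w))"
proof (rule ex_ex1I)
  \<comment> \<open>The representation stands under the quantifier over \<open>Basis\<close>, so
    some basis vector is required to extract it.\<close>
  obtain d where d: "\<And>u v w. G x (\<Sum>b\<in>Basis. koszul x u v b *\<^sub>R d b x) w = koszul x u v w"
    using koszul_representation x nonempty_Basis by blast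
  define \<Gamma> where "\<Gamma> u v = (\<Sum>b\<in>Basis. koszul x u v b *\<^sub>R d b x)" for u v
  have k: "G x (\<Gamma> u v) w = koszul x u v w" for u v w using d by (simp add: \<Gamma>_def)
  have "bilinear \<Gamma>"
    unfolding bilinear_def
    by (auto intro!: linearI nondegenerate [OF x]
        simp: k G_simps [OF x] linear_add [OF koszul_linear(2) [OF x]] linear_scale [OF koszul_linear(2) [OF x]]
        linear_add [OF koszul_linear(3) [OF x]] linear_scale [OF koszul_linear(3) [OF x]])
  moreover have "\<Gamma> v w = \<Gamma> w v" for v w
    by (rule nondegenerate [OF x]) (simp add: k, simp add: koszul_def fd_G_sym [OF x, of v w])
  moreover have "fd (\<lambda>y. G y v w) x u = G x (\<Gamma> u v) w + G x v (\<Gamma> u w)" for u v w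
    by (simp add: k sym [OF x, of v "\<Gamma> u w"], simp add: koszul_def fd_G_sym [OF x, of v w] field_simps)
  ultimately show "\<exists>\<Gamma>. bilinear \<Gamma> \<and> (\<forall>v w. \<Gamma> v w = \<Gamma> w v) \<and>
       (\<forall>u v w. fd (\<lambda>y. G y v w) x u = G x (\<Gamma> u v) w + G x v (\<Gamma> u w))" by blast
next
  fix \<Gamma> \<Gamma>' :: "'e \<Rightarrow> 'e \<Rightarrow> 'e"
  assume 1: "bilinear \<Gamma> \<and> (\<forall>v w. \<Gamma> v w = \<Gamma> w v) \<and>
       (\<forall>u v w. fd (\<lambda>y. G y v w) x u = G x (\<Gamma> u v) w + G x v (\<Gamma> u w))"
    and 2: "bilinear \<Gamma>' \<and> (\<forall>v w. \<Gamma>' v w = \<Gamma>' w v) \<and>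
       (\<forall>u v w. fd (\<lambda>y. G y v w) x u = G x (\<Gamma>' u v) w + G x v (\<Gamma>' u w))"
  show "\<Gamma> = \<Gamma>'"
  proof (intro ext nondegenerate [OF x])
    fix u v w
    show "G x (\<Gamma> u v) w = G x (\<Gamma>' u v) w"
      using connection_koszul [OF x, of \<Gamma> u v w] connection_koszul [OF x, of \<Gamma>' u v w] 1 2 by metis
  qed
qed

lemma
  assumes "x \<in> U"
  shows christoffel_bilinear: "bilinear (christoffel G x)"
    and christoffel_sym: "christoffel G x v w = christoffel G x w v"
    and christoffel_metric:
      "fd (\<lambda>y. G y v w) x u = G x (christoffel G x u v) w + G x v (christoffel G x u w)"
  using theI' [OF christoffel_ex1 [OF assms], folded christoffel_def] by blast+

lemma christoffel_eqI:
  assumes "x \<in> U" "bilinear \<Gamma>" "\<And>v w. \<Gamma> v w = \<Gamma> w v"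
    "\<And>u v w. fd (\<lambda>y. G y v w) x u = G x (\<Gamma> u v) w + G x v (\<Gamma> u w)"
  shows "christoffel G x = \<Gamma>"
  unfolding christoffel_def by (rule the1_equality [OF christoffel_ex1]) (use assms in blast)+

lemma christoffel_smooth: "smooth_on U (\<lambda>x. christoffel G x u v)"
proof -
  obtain d where d: "\<And>b. b \<in> Basis \<Longrightarrow> smooth_on U (d b)"
    "\<And>x u v w. x \<in> U \<Longrightarrow> G x (\<Sum>b\<in>Basis. koszul x u v b *\<^sub>R d b x) w = koszul x u v w"
    using koszul_representation nonempty_Basis by blast
  have k: "smooth_on U (\<lambda>x. koszul x u v w)" for w
  proof -
    have "smooth_on U (\<lambda>x. (1/2) * (fd (\<lambda>y. G y v w) x u + fd (\<lambda>y. G y u w) x v - fd (\<lambda>y. G y u v) x w))"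
      by (intro smooth_on_mult smooth_on_const smooth_on_diff smooth_on_add smooth_on_fd smooth open_dom)
    then show ?thesis by (simp add: koszul_def)
  qed
  show ?thesis
  proof (rule smooth_on_cong [OF open_dom])
    show "smooth_on U (\<lambda>x. \<Sum>b\<in>Basis. koszul x u v b *\<^sub>R d b x)"
      by (intro smooth_on_sum smooth_on_scaleR k d open_dom)
    fix x assume x: "x \<in> U"
    show "(\<Sum>b\<in>Basis. koszul x u v b *\<^sub>R d b x) = christoffel G x u v"
      using d(2) [OF x] connection_koszul [OF x christoffel_sym [OF x] christoffel_metric [OF x]]
      by (intro nondegenerate [OF x]) simp
  qed
qed

text \<open>The derivative of the metric in the direction of the curve is distributed over both
  arguments by metric compatibility, which completes the ordinary derivatives of the fields to
  covariant ones.\<close>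

lemma covariant_product_rule:
  assumes "c t \<in> U" "(c has_vector_derivative c') (at t)"
    "(a has_vector_derivative a') (at t)" "(b has_vector_derivative b') (at t)"
  shows "((\<lambda>s. G (c s) (a s) (b s)) has_vector_derivative
    G (c t) (a' + christoffel G (c t) c' (a t)) (b t) +
    G (c t) (a t) (b' + christoffel G (c t) c' (b t))) (at t)"
proof -
  have "((\<lambda>s. G (c s) (a s) (b s)) has_derivative (\<lambda>h. fd (\<lambda>x. G x (a t) (b t)) (c t) (h *\<^sub>R c') +
      G (c t) (h *\<^sub>R a') (b t) + G (c t) (a t) (h *\<^sub>R b'))) (at t)"
    by (rule has_derivative_bifamily [where H = G and p = c, OF open_dom bilinear assms(1)
      smooth_on_differentiable [OF smooth assms(1)] assms(2-4) [unfolded has_vector_derivative_def]])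
  then show ?thesis
    unfolding has_vector_derivative_def
    by (rule has_derivative_eq_rhs)
       (rule ext, simp add: fd_G_simps assms(1) christoffel_metric
         christoffel_bilinear [THEN bilinear_simps(5)] G_simps algebra_simps)
qed

text \<open>The product rule with a second field of constant coordinates. Its covariant derivative
  contributes the pairing of the velocity with \<Gamma>(v, w), which by symmetry and compatibility
  is half the derivative of the squared speed in the base point. The Christoffel symbols thus occur
  only inside the covariant acceleration.\<close>

lemma euler_lagrange:
  assumes "c t \<in> U" "(c has_vector_derivative v t) (at t)" "(v has_vector_derivative a) (at t)"
  shows "((\<lambda>s. G (c s) (v s) w) has_vector_derivative
    G (c t) (a + christoffel G (c t) (v t) (v t)) w + fd (\<lambda>y. G y (v t) (v t)) (c t) w / 2) (at t)"
proof -
  have "fd (\<lambda>y. G y (v t) (v t)) (c t) w / 2 = G (c t) (v t) (0 + christoffel G (c t) (v t) w)"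
    using christoffel_metric [OF assms(1), of "v t" "v t" w]
      sym [OF assms(1), of "christoffel G (c t) w (v t)" "v t"] christoffel_sym [OF assms(1), of w "v t"]
    by simp
  then show ?thesis
    using covariant_product_rule [OF assms has_vector_derivative_const [of w]] by metis
qed

end

text \<open>The connection of the target is pulled back along the local isometry \<tau>. The result
  is bilinear, symmetric and compatible with the metric, so by uniqueness it is the connection of
  the source.\<close>

lemma christoffel_transform:
  fixes \<tau> :: "'e::euclidean_space \<Rightarrow> 'e"
  assumes "local_metric U G" "local_metric U' G'"
    and V: "open V" "V \<subseteq> U" "smooth_on V \<tau>" "\<tau> ` V \<subseteq> U'"
    and G: "\<And>y v w. y \<in> V \<Longrightarrow> G y v w = G' (\<tau> y) (fd \<tau> y v) (fd \<tau> y w)"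
    and x: "x \<in> V"
  shows "fd \<tau> x (christoffel G x u v) =
    fd (\<lambda>y. fd \<tau> y v) x u + christoffel G' (\<tau> x) (fd \<tau> x u) (fd \<tau> x v)"
proof -
  interpret M: local_metric U G by fact
  interpret M': local_metric U' G' by fact
  have xU: "x \<in> U" and xU': "\<tau> x \<in> U'" using x V by auto
  have lin: "linear (fd \<tau> x)" using linear_fd [OF V(3) x] .
  \<comment> \<open>A kernel vector has length zero, as \<tau> preserves the metric. The equal
    dimensions then give the inverse \<open>L\<close> needed for the pullback.\<close>
  have "inj (fd \<tau> x)"
    unfolding linear_injective_0 [OF lin]
  proof (intro allI impI)
    fix v assume "fd \<tau> x v = 0"
    then have "G x v v = 0" using G [OF x, of v v] M'.G_simps [OF xU'] by simp
    then show "v = 0" using M.zero_iff xU by simp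
  qed
  then obtain L where L: "linear L" "\<And>v. L (fd \<tau> x v) = v" "\<And>v. fd \<tau> x (L v) = v"
    using linear_injective_isomorphism [OF lin] by blast
  define \<Gamma> where "\<Gamma> u v = L (fd (\<lambda>y. fd \<tau> y v) x u + christoffel G' (\<tau> x) (fd \<tau> x u) (fd \<tau> x v))" for u v
  \<comment> \<open>Symmetry of the second derivative of \<tau> is what makes the pulled-back
    connection torsion-free; it also yields linearity in the other argument.\<close>
  have sym2: "fd (\<lambda>y. fd \<tau> y v) x u = fd (\<lambda>y. fd \<tau> y u) x v" for u v
    using symmetric_second_derivative [OF V(1,3) x] .
  have l2: "linear (fd (\<lambda>y. fd \<tau> y v) x)" for v using linear_fd [OF smooth_on_fd [OF V(3)] x] .
  note bl = bilinear_simps [OF M'.christoffel_bilinear [OF xU']]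
  have "linear (\<Gamma> u)" for u
    unfolding \<Gamma>_def sym2 [of _ u]
    by (auto intro!: linearI simp: bl linear_add [OF lin] linear_scale [OF lin] linear_add [OF L(1)]
        linear_scale [OF L(1)] linear_add [OF l2] linear_scale [OF l2] algebra_simps)
  moreover have \<Gamma>s: "\<Gamma> u v = \<Gamma> v u" for u v
    unfolding \<Gamma>_def sym2 [of v u] by (simp add: M'.christoffel_sym [OF xU'])
  ultimately have "bilinear \<Gamma>" unfolding bilinear_def by (auto simp: \<Gamma>s [of _ "_ :: 'e"]) 
  moreover have "fd (\<lambda>y. G y v w) x u = G x (\<Gamma> u v) w + G x v (\<Gamma> u w)" for u v w
  proof -
    have D: "(\<lambda>y. fd \<tau> y v) differentiable (at x)" for v
      using smooth_on_differentiable [OF smooth_on_fd [OF V(3)] x] .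
    have "((\<lambda>y. G' (\<tau> y) (fd \<tau> y v) (fd \<tau> y w)) has_derivative
      (\<lambda>u. fd (\<lambda>z. G' z (fd \<tau> x v) (fd \<tau> x w)) (\<tau> x) (fd \<tau> x u) +
        G' (\<tau> x) (fd (\<lambda>y. fd \<tau> y v) x u) (fd \<tau> x w) + G' (\<tau> x) (fd \<tau> x v) (fd (\<lambda>y. fd \<tau> y w) x u))) (at x)"
      by (rule has_derivative_bifamily [where H = G' and p = \<tau>, OF M'.open_dom M'.bilinear xU'])
         (use D smooth_on_has_derivative [OF V(3) x] smooth_on_differentiable [OF M'.smooth xU'] in
            \<open>auto simp: frechet_derivative_works\<close>)
    then have "((\<lambda>y. G y v w) has_derivative
      (\<lambda>u. fd (\<lambda>z. G' z (fd \<tau> x v) (fd \<tau> x w)) (\<tau> x) (fd \<tau> x u) +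
        G' (\<tau> x) (fd (\<lambda>y. fd \<tau> y v) x u) (fd \<tau> x w) + G' (\<tau> x) (fd \<tau> x v) (fd (\<lambda>y. fd \<tau> y w) x u))) (at x)"
      by (rule has_derivative_transform_within_open [OF _ V(1) x]) (simp add: G)
    from fd_eqI [OF this] show ?thesis
      unfolding G [OF x] \<Gamma>_def L(3) by (simp add: M'.christoffel_metric [OF xU'] M'.G_simps [OF xU'])
  qed
  ultimately have "christoffel G x = \<Gamma>" using \<Gamma>s M.christoffel_eqI [OF xU] by blast
  then show ?thesis by (simp add: \<Gamma>_def L(3))
qed

section \<open>Jets, tangent vectors and covariant derivatives in charts\<close>

lemma
  fixes \<tau> :: "'e::euclidean_space \<Rightarrow> 'b::real_normed_vector"
  assumes "open U" "smooth_on U c" "smooth_on V \<tau>" "c ` U \<subseteq> V" "open V" "t \<in> U"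
  shows vderiv_compose: "vderiv (\<tau> \<circ> c) t = fd \<tau> (c t) (vderiv c t)"
    and vderiv2_compose: "vderiv (vderiv (\<tau> \<circ> c)) t =
      fd (\<lambda>x. fd \<tau> x (vderiv c t)) (c t) (vderiv c t) + fd \<tau> (c t) (vderiv (vderiv c) t)"
proof -
  have 1: "vderiv (\<tau> \<circ> c) s = fd \<tau> (c s) (vderiv c s)" if "s \<in> U" for s
    unfolding o_def
    by (rule vderiv_eqI, rule has_vector_derivative_compose_fd)
       (use assms that in \<open>auto intro: smooth_on_differentiable smooth_on_has_vderiv\<close>)
  show "vderiv (\<tau> \<circ> c) t = fd \<tau> (c t) (vderiv c t)" using 1 assms by blast
  have ct: "c t \<in> V" using assms by auto
  have "((\<lambda>s. fd \<tau> (c s) (vderiv c s)) has_derivative (\<lambda>h. fd (\<lambda>x. fd \<tau> x (vderiv c t)) (c t) (h *\<^sub>R vderiv c t) +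
      fd \<tau> (c t) (h *\<^sub>R vderiv (vderiv c) t))) (at t)"
    by (rule has_derivative_family [where H = "\<lambda>x v. fd \<tau> x v" and p = c, OF assms(5) linear_fd [OF assms(3)] ct
      smooth_on_differentiable [OF smooth_on_fd [OF assms(3)] ct]
      smooth_on_has_vderiv [OF assms(2,6), unfolded has_vector_derivative_def]
      smooth_on_has_vderiv [OF smooth_on_vderiv [OF assms(1,2)] assms(6), unfolded has_vector_derivative_def]])
  then have "((\<lambda>s. fd \<tau> (c s) (vderiv c s)) has_vector_derivative
      (fd (\<lambda>x. fd \<tau> x (vderiv c t)) (c t) (vderiv c t) + fd \<tau> (c t) (vderiv (vderiv c) t))) (at t)"
    unfolding has_vector_derivative_def
    by (simp add: linear_scale [OF linear_fd [OF assms(3) ct]] scaleR_add_right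
        linear_scale [OF linear_fd [OF smooth_on_fd [OF assms(3)] ct]])
  from vderiv_eqI [OF this] vderiv_cong [OF assms(1,6) 1]
  show "vderiv (vderiv (\<tau> \<circ> c)) t =
      fd (\<lambda>x. fd \<tau> x (vderiv c t)) (c t) (vderiv c t) + fd \<tau> (c t) (vderiv (vderiv c) t)" by simp
qed

lemma le2_cases: "(k::nat) \<le> 2 \<Longrightarrow> (k = 0 \<Longrightarrow> P) \<Longrightarrow> (k = 1 \<Longrightarrow> P) \<Longrightarrow> (k = 2 \<Longrightarrow> P) \<Longrightarrow> P"
  by linarith

text \<open>The explicit chain rules of orders one and two express the derivatives of the
  composition through those of the curve. Only 1-jets and 2-jets occur, so these two orders
  suffice.\<close>

lemma jets_compose_eq:
  fixes \<tau> :: "'e::euclidean_space \<Rightarrow> 'b::real_normed_vector"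
  assumes "open U" "smooth_on U c" "c ` U \<subseteq> V" "t \<in> U"
    "open U'" "smooth_on U' c'" "c' ` U' \<subseteq> V" "t \<in> U'"
    "open V" "smooth_on V \<tau>" "r \<le> 2"
    "\<And>k. k \<le> r \<Longrightarrow> (vderiv ^^ k) c t = (vderiv ^^ k) c' t" "k \<le> r"
  shows "(vderiv ^^ k) (\<tau> \<circ> c) t = (vderiv ^^ k) (\<tau> \<circ> c') t"
proof (rule le2_cases [of k])
  show "k \<le> 2" using assms by simp
next
  assume "k = 0" then show ?thesis using assms(12) [of 0] by simp
next
  assume "k = 1" then show ?thesis using assms(12) [of 0] assms(12) [of 1] assms(13)
    by (simp add: vderiv_compose [OF assms(1,2,10,3,9,4)] vderiv_compose [OF assms(5,6,10,7,9,8)])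
next
  assume k: "k = 2"
  then have "r = 2" using assms by simp
  with k show ?thesis using assms(12) [of 0] assms(12) [of 1] assms(12) [of 2]
    by (simp add: vderiv2_compose [OF assms(1,2,10,3,9,4)] vderiv2_compose [OF assms(5,6,10,7,9,8)] numeral_2_eq_2)
qed

section \<open>Charts, smooth maps and germs of curves\<close>

locale atlas =
  fixes A :: "('a, 'e::euclidean_space) chart set"
  assumes smooth_atlas: "smooth_atlas A"
begin

lemma
  assumes "(D, \<phi>) \<in> A"
  shows chart_inj: "inj_on \<phi> D" and chart_open: "open (\<phi> ` D)"
  using smooth_atlas assms by (auto simp: smooth_atlas_def)

lemma
  assumes "(D, \<phi>) \<in> A" "(E, \<psi>) \<in> A"
  shows overlap_open: "open (\<phi> ` (D \<inter> E))"
    and transition_smooth: "smooth_on (\<phi> ` (D \<inter> E)) (\<psi> \<circ> inv_into D \<phi>)"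
  using smooth_atlas assms unfolding smooth_atlas_def by blast+

lemma inv_chart: "(D, \<phi>) \<in> A \<Longrightarrow> p \<in> D \<Longrightarrow> inv_into D \<phi> (\<phi> p) = p"
  using chart_inj by (simp add: inv_into_f_f)

lemma chart_inv: "x \<in> \<phi> ` D \<Longrightarrow> \<phi> (inv_into D \<phi> x) = x"
  by (rule f_inv_into_f)

lemma inv_chart_mem: "x \<in> \<phi> ` D \<Longrightarrow> inv_into D \<phi> x \<in> D"
  by (rule inv_into_into)

lemma chart_mem_overlap: "(D, \<phi>) \<in> A \<Longrightarrow> p \<in> D \<Longrightarrow> \<phi> p \<in> \<phi> ` (D \<inter> E) \<longleftrightarrow> p \<in> E"
  using inj_on_image_mem_iff [OF chart_inj, of D \<phi> p "D \<inter> E"] by auto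

text \<open>The change of charts used throughout: the domain is cut down to the part mapped into the
  overlap, which is open by continuity in the first chart, and there the second coordinate
  expression is the first one followed by a transition map.\<close>

lemma curve_meets_overlap:
  fixes f :: "'b::real_normed_vector \<Rightarrow> 'a"
  assumes "(D, \<phi>) \<in> A" "(E, \<psi>) \<in> A" "open U" "f ` U \<subseteq> D" "smooth_on U (\<phi> \<circ> f)" "x \<in> U" "f x \<in> E"
  obtains W where "open W" "W \<subseteq> U" "x \<in> W" "f ` W \<subseteq> D \<inter> E" "smooth_on W (\<phi> \<circ> f)"
    "smooth_on W (\<psi> \<circ> f)" "(\<phi> \<circ> f) ` W \<subseteq> \<phi> ` (D \<inter> E)"
    "\<forall>y\<in>W. ((\<psi> \<circ> inv_into D \<phi>) \<circ> (\<phi> \<circ> f)) y = (\<psi> \<circ> f) y"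
proof -
  define W where "W = U \<inter> (\<phi> \<circ> f) -` (\<phi> ` (D \<inter> E))"
  have W: "open W" unfolding W_def
    by (rule continuous_open_preimage [OF smooth_on_continuous_on [OF assms(5)] assms(3)
          overlap_open [OF assms(1,2)]])
  have fW: "f ` W \<subseteq> D \<inter> E"
  proof -
    have "f y \<in> D \<inter> E" if "y \<in> W" for y
      using that assms(4) chart_mem_overlap [OF assms(1), of "f y" E] by (auto simp: W_def)
    then show ?thesis by auto
  qed
  have eq: "((\<psi> \<circ> inv_into D \<phi>) \<circ> (\<phi> \<circ> f)) y = (\<psi> \<circ> f) y" if "y \<in> W" for y
    using fW that inv_chart [OF assms(1), of "f y"] by auto
  have sW: "smooth_on W (\<phi> \<circ> f)" by (rule smooth_on_subset [OF assms(5)]) (auto simp: W_def)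
  have "smooth_on W (\<lambda>y. (\<psi> \<circ> inv_into D \<phi>) ((\<phi> \<circ> f) y))"
    by (rule smooth_on_compose [OF W sW transition_smooth [OF assms(1,2)]]) (auto simp: W_def)
  then have "smooth_on W (\<psi> \<circ> f)" by (rule smooth_on_cong [OF W]) (use eq in auto)
  moreover have "x \<in> W"
    using assms(4,6,7) chart_mem_overlap [OF assms(1), of "f x" E] by (auto simp: W_def)
  moreover have "W \<subseteq> U" "(\<phi> \<circ> f) ` W \<subseteq> \<phi> ` (D \<inter> E)" by (auto simp: W_def)
  ultimately show ?thesis using that W fW sW eq by blast
qed

text \<open>One chart is enough to test smoothness, since the transition maps are smooth.\<close>

lemma smooth_map_onI:
  fixes f :: "'b::euclidean_space \<Rightarrow> 'a"
  assumes "(D, \<phi>) \<in> A" "open U" "f ` U \<subseteq> D" "smooth_on U (\<phi> \<circ> f)"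
  shows "smooth_map_on A U f"
  unfolding smooth_map_on_def
proof (intro ballI conjI)
  fix x assume x: "x \<in> U"
  show "f x \<in> points A" using assms x by (auto simp: points_def)
  fix C assume C: "C \<in> A"
  show "case C of (E, \<psi>) \<Rightarrow> f x \<in> E \<longrightarrow> (\<exists>W\<subseteq>U. open W \<and> x \<in> W \<and> f ` W \<subseteq> E \<and> smooth_on W (\<psi> \<circ> f))"
  proof (clarsimp split: prod.splits)
    fix E \<psi> assume "C = (E, \<psi>)" "f x \<in> E"
    with C have E: "(E, \<psi>) \<in> A" "f x \<in> E" by auto
    obtain W where "open W" "W \<subseteq> U" "x \<in> W" "f ` W \<subseteq> D \<inter> E" "smooth_on W (\<psi> \<circ> f)"
      by (rule curve_meets_overlap [OF assms(1) E(1) assms(2-4) x E(2)])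
    then show "\<exists>W\<subseteq>U. open W \<and> x \<in> W \<and> f ` W \<subseteq> E \<and> smooth_on W (\<psi> \<circ> f)"
      by (intro exI [of _ W]) auto
  qed
qed

lemma smooth_map_onE:
  fixes f :: "'b::euclidean_space \<Rightarrow> 'a"
  assumes "smooth_map_on A S f" "x \<in> S" "(D, \<phi>) \<in> A" "f x \<in> D"
  obtains U where "open U" "U \<subseteq> S" "x \<in> U" "f ` U \<subseteq> D" "smooth_on U (\<phi> \<circ> f)"
proof -
  have "\<forall>(D, \<phi>)\<in>A. f x \<in> D \<longrightarrow> (\<exists>U\<subseteq>S. open U \<and> x \<in> U \<and> f ` U \<subseteq> D \<and> smooth_on U (\<phi> \<circ> f))"
    using assms(1,2) unfolding smooth_map_on_def by simp
  from bspec [OF this assms(3)] assms(4) that show ?thesis by auto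
qed

lemma smooth_map_on_chart_ex:
  assumes "smooth_map_on A S f" "x \<in> S"
  obtains D \<phi> where "(D, \<phi>) \<in> A" "f x \<in> D"
  using assms unfolding smooth_map_on_def points_def by fast

lemma curve_germsI:
  assumes "(D, \<phi>) \<in> A" "open U" "0 \<in> U" "c ` U \<subseteq> D" "smooth_on U (\<phi> \<circ> c)"
  shows "c \<in> curve_germs A"
proof -
  obtain e where e: "e > 0" "ball 0 e \<subseteq> U" using assms openE by blast
  have ball: "ball 0 e = {- e<..<e}" by (auto simp: dist_real_def)
  have "smooth_map_on A {- e<..<e} c"
    by (rule smooth_map_onI [OF assms(1)])
       (use e assms ball smooth_on_subset [OF assms(5)] in auto)
  then show ?thesis using e unfolding curve_germs_def by blast
qed

lemma curve_germsE:
  assumes "c \<in> curve_germs A" "(D, \<phi>) \<in> A" "c 0 \<in> D"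
  obtains U where "open U" "0 \<in> U" "c ` U \<subseteq> D" "smooth_on U (\<phi> \<circ> c)"
proof -
  obtain e where e: "0 \<in> {- e<..<e}" "smooth_map_on A {- e<..<e} c"
    using assms by (auto simp: curve_germs_def)
  show ?thesis by (rule smooth_map_onE [OF e(2,1) assms(2,3)]) (rule that)
qed

lemma shift_curve_germ:
  assumes "smooth_map_on A S c" "t \<in> S"
  shows "(\<lambda>s. c (t + s)) \<in> curve_germs A"
proof -
  obtain D \<phi> where D: "(D, \<phi>) \<in> A" "c t \<in> D" using smooth_map_on_chart_ex [OF assms] .
  obtain U where U: "open U" "U \<subseteq> S" "t \<in> U" "c ` U \<subseteq> D" "smooth_on U (\<phi> \<circ> c)"
    using smooth_map_onE [OF assms D] .
  have op: "open ((+) t -` U)" using U(1) by (simp add: open_vimage continuous_intros)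
  have "smooth_on ((+) t -` U) (\<lambda>s. (\<phi> \<circ> c) (t + s))"
    by (rule smooth_on_compose [OF op _ U(5)])
       (auto intro!: smooth_on_add smooth_on_const smooth_on_ident op)
  then show ?thesis using U op by (intro curve_germsI [OF D(1) op]) (auto simp: o_def)
qed

section \<open>Jets and their coordinates\<close>

definition same_jet :: "nat \<Rightarrow> (real \<Rightarrow> 'a) \<Rightarrow> (real \<Rightarrow> 'a) \<Rightarrow> bool"
  where "same_jet r c c' \<longleftrightarrow> c 0 = c' 0 \<and>
    (\<forall>(D, \<phi>)\<in>A. c 0 \<in> D \<longrightarrow> (\<forall>k\<le>r. (vderiv ^^ k) (\<phi> \<circ> c) 0 = (vderiv ^^ k) (\<phi> \<circ> c') 0))"

lemma same_jetD:
  "same_jet r c c' \<Longrightarrow> (D, \<phi>) \<in> A \<Longrightarrow> c 0 \<in> D \<Longrightarrow> k \<le> r \<Longrightarrow>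
    (vderiv ^^ k) (\<phi> \<circ> c) 0 = (vderiv ^^ k) (\<phi> \<circ> c') 0"
  unfolding same_jet_def by auto

lemma mem_jet_iff: "c' \<in> jet A r c \<longleftrightarrow> c' \<in> curve_germs A \<and> same_jet r c' c"
  unfolding jet_def same_jet_def by auto

lemma same_jet_sym: "same_jet r c c' \<Longrightarrow> same_jet r c' c"
  unfolding same_jet_def by fastforce

lemma same_jet_trans: "same_jet r c c' \<Longrightarrow> same_jet r c' c'' \<Longrightarrow> same_jet r c c''"
  unfolding same_jet_def by fastforce

lemma jet_eqI: "same_jet r c c' \<Longrightarrow> jet A r c = jet A r c'"
  using mem_jet_iff same_jet_sym same_jet_trans by blast

lemma self_mem_jet: "c \<in> curve_germs A \<Longrightarrow> c \<in> jet A r c"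
  unfolding mem_jet_iff same_jet_def by auto

text \<open>A germ lies in its own class, hence in the other one. The curve \<open>c'\<close> may be
  one whose smoothness is still unknown, such as the curve of jets of a family.\<close>

lemma jet_eq_iff: "c \<in> curve_germs A \<Longrightarrow> jet A r c = jet A r c' \<longleftrightarrow> same_jet r c c'"
  using self_mem_jet jet_eqI mem_jet_iff by blast

text \<open>Contact up to order two in one chart carries over to every other chart by the chain
  rules for the transition map, after both curves have been restricted to the overlap.\<close>

lemma same_jetI:
  assumes c: "c \<in> curve_germs A" "c' \<in> curve_germs A" and D: "(D, \<phi>) \<in> A" "c 0 \<in> D" "c 0 = c' 0" "r \<le> 2"
    and eq: "\<And>k. k \<le> r \<Longrightarrow> (vderiv ^^ k) (\<phi> \<circ> c) 0 = (vderiv ^^ k) (\<phi> \<circ> c') 0"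
  shows "same_jet r c c'"
proof -
  have "(vderiv ^^ k) (\<psi> \<circ> c) 0 = (vderiv ^^ k) (\<psi> \<circ> c') 0"
    if E: "(E, \<psi>) \<in> A" "c 0 \<in> E" and k: "k \<le> r" for E \<psi> k
  proof -
    obtain U where U: "open U" "0 \<in> U" "c ` U \<subseteq> D" "smooth_on U (\<phi> \<circ> c)"
      using curve_germsE [OF c(1) D(1,2)] .
    obtain U' where U': "open U'" "0 \<in> U'" "c' ` U' \<subseteq> D" "smooth_on U' (\<phi> \<circ> c')"
      using curve_germsE [OF c(2) D(1)] D by metis
    obtain W where W: "open W" "W \<subseteq> U" "0 \<in> W" "c ` W \<subseteq> D \<inter> E" "smooth_on W (\<phi> \<circ> c)"
      "smooth_on W (\<psi> \<circ> c)" "(\<phi> \<circ> c) ` W \<subseteq> \<phi> ` (D \<inter> E)"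
      "\<forall>y\<in>W. ((\<psi> \<circ> inv_into D \<phi>) \<circ> (\<phi> \<circ> c)) y = (\<psi> \<circ> c) y"
      by (rule curve_meets_overlap [OF D(1) E(1) U(1,3,4,2) E(2)])
    obtain W' where W': "open W'" "W' \<subseteq> U'" "0 \<in> W'" "c' ` W' \<subseteq> D \<inter> E" "smooth_on W' (\<phi> \<circ> c')"
      "smooth_on W' (\<psi> \<circ> c')" "(\<phi> \<circ> c') ` W' \<subseteq> \<phi> ` (D \<inter> E)"
      "\<forall>y\<in>W'. ((\<psi> \<circ> inv_into D \<phi>) \<circ> (\<phi> \<circ> c')) y = (\<psi> \<circ> c') y"
      by (rule curve_meets_overlap [OF D(1) E(1) U'(1,3,4,2) E(2) [unfolded D(3)]])
    have "(vderiv ^^ k) ((\<psi> \<circ> inv_into D \<phi>) \<circ> (\<phi> \<circ> c)) 0 = (vderiv ^^ k) ((\<psi> \<circ> inv_into D \<phi>) \<circ> (\<phi> \<circ> c')) 0"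
      by (rule jets_compose_eq [OF W(1,5,7,3) W'(1,5,7,3) overlap_open [OF D(1) E(1)] transition_smooth [OF D(1) E(1)]
        D(4) eq k])
    moreover have "(vderiv ^^ k) ((\<psi> \<circ> inv_into D \<phi>) \<circ> (\<phi> \<circ> c)) 0 = (vderiv ^^ k) (\<psi> \<circ> c) 0"
      by (rule funpow_vderiv_cong [OF W(1,3)]) (rule bspec [OF W(8)])
    moreover have "(vderiv ^^ k) ((\<psi> \<circ> inv_into D \<phi>) \<circ> (\<phi> \<circ> c')) 0 = (vderiv ^^ k) (\<psi> \<circ> c') 0"
      by (rule funpow_vderiv_cong [OF W'(1,3)]) (rule bspec [OF W'(8)])
    ultimately show ?thesis by simp
  qed
  then show ?thesis using D(3) by (auto simp: same_jet_def)
qed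

lemma repr_jet:
  assumes "c \<in> curve_germs A"
  shows "repr (jet A r c) \<in> curve_germs A" "same_jet r (repr (jet A r c)) c" "repr (jet A r c) 0 = c 0"
proof -
  have "repr (jet A r c) \<in> jet A r c"
    unfolding repr_def by (rule someI [of "\<lambda>d. d \<in> jet A r c"]) (rule self_mem_jet [OF assms])
  then show "repr (jet A r c) \<in> curve_germs A" "same_jet r (repr (jet A r c)) c" "repr (jet A r c) 0 = c 0"
    by (auto simp: mem_jet_iff same_jet_def)
qed

lemma jet_base_jet: "c \<in> curve_germs A \<Longrightarrow> jet_base (jet A r c) = c 0"
  by (simp add: jet_base_def repr_jet)

lemma jet_coord_jet:
  "c \<in> curve_germs A \<Longrightarrow> (D, \<phi>) \<in> A \<Longrightarrow> c 0 \<in> D \<Longrightarrow> k \<le> r \<Longrightarrow>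
    jet_coord \<phi> k (jet A r c) = (vderiv ^^ k) (\<phi> \<circ> c) 0"
  unfolding jet_coord_def using repr_jet [of c r] same_jetD by metis

lemma
  assumes "smooth_map_on A S c" "t \<in> S"
  shows jet_coord_jet_lift: "(D, \<phi>) \<in> A \<Longrightarrow> c t \<in> D \<Longrightarrow> k \<le> r \<Longrightarrow>
      jet_coord \<phi> k (jet_lift A r c t) = (vderiv ^^ k) (\<phi> \<circ> c) t"
    and velocity_mem: "velocity A c t \<in> tangent_space A (c t)"
proof -
  note germ = shift_curve_germ [OF assms]
  show "velocity A c t \<in> tangent_space A (c t)"
    unfolding tangent_space_def jet_lift_def using germ by force
  show "jet_coord \<phi> k (jet_lift A r c t) = (vderiv ^^ k) (\<phi> \<circ> c) t"
    if "(D, \<phi>) \<in> A" "c t \<in> D" "k \<le> r" 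
  proof -
    have "(\<phi> \<circ> (\<lambda>s. c (t + s))) = (\<lambda>s. (\<phi> \<circ> c) (t + s))" by auto
    then show ?thesis
      unfolding jet_lift_def using jet_coord_jet [OF germ that(1) _ that(3)] that
        funpow_vderiv_shift [of k "\<phi> \<circ> c" t] by simp
  qed
qed

section \<open>Tangent vectors in charts\<close>

lemma tangent_eqI:
  assumes "X \<in> tangent_space A p" "Y \<in> tangent_space A p" "(D, \<phi>) \<in> A" "p \<in> D"
    "jet_coord \<phi> 1 X = jet_coord \<phi> 1 Y"
  shows "X = Y"
proof -
  obtain c where c: "X = jet A 1 c" "c \<in> curve_germs A" "c 0 = p" using assms by (auto simp: tangent_space_def)
  obtain d where d: "Y = jet A 1 d" "d \<in> curve_germs A" "d 0 = p" using assms by (auto simp: tangent_space_def)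
  have eq: "vderiv (\<phi> \<circ> c) 0 = vderiv (\<phi> \<circ> d) 0"
    using assms(5) jet_coord_jet [OF c(2) assms(3), of 1 1] jet_coord_jet [OF d(2) assms(3), of 1 1] assms(4) c d
    by simp
  have "same_jet 1 c d"
  proof (rule same_jetI [OF c(2) d(2) assms(3)])
    show "(vderiv ^^ k) (\<phi> \<circ> c) 0 = (vderiv ^^ k) (\<phi> \<circ> d) 0" if "k \<le> 1" for k
      using that eq c d by (cases k) auto
  qed (use c d assms in auto)
  then show ?thesis using c d jet_eqI by simp
qed

lemma chart_line_germ:
  assumes "(D, \<phi>) \<in> A" "p \<in> D"
  shows "(\<lambda>t. inv_into D \<phi> (\<phi> p + t *\<^sub>R v)) \<in> curve_germs A"
    "vderiv (\<phi> \<circ> (\<lambda>t. inv_into D \<phi> (\<phi> p + t *\<^sub>R v))) 0 = v"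
proof -
  define U where "U = (\<lambda>t::real. \<phi> p + t *\<^sub>R v) -` (\<phi> ` D)"
  have U: "open U" unfolding U_def
    by (intro open_vimage chart_open assms continuous_intros)
  have U0: "0 \<in> U" using assms by (auto simp: U_def)
  have eq: "\<phi> p + t *\<^sub>R v = (\<phi> \<circ> (\<lambda>t. inv_into D \<phi> (\<phi> p + t *\<^sub>R v))) t" if "t \<in> U" for t
    using that chart_inv [of _ \<phi> D] by (simp add: U_def)
  show "(\<lambda>t. inv_into D \<phi> (\<phi> p + t *\<^sub>R v)) \<in> curve_germs A"
  proof (rule curve_germsI [OF assms(1) U U0])
    show "(\<lambda>t. inv_into D \<phi> (\<phi> p + t *\<^sub>R v)) ` U \<subseteq> D" by (auto simp: U_def inv_chart_mem)
    show "smooth_on U (\<phi> \<circ> (\<lambda>t. inv_into D \<phi> (\<phi> p + t *\<^sub>R v)))"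
      by (rule smooth_on_cong [OF U _ eq])
         (intro smooth_on_add smooth_on_scaleR smooth_on_const smooth_on_ident U)
  qed
  show "vderiv (\<phi> \<circ> (\<lambda>t. inv_into D \<phi> (\<phi> p + t *\<^sub>R v))) 0 = v"
    by (rule trans [OF sym [OF vderiv_cong [OF U U0 eq]] vderiv_eqI [OF has_vector_derivative_line]])
qed

lemma
  assumes "(D, \<phi>) \<in> A" "p \<in> D"
  shows tangent_of_mem: "tangent_of A (D, \<phi>) p v \<in> tangent_space A p"
    and tangent_of_coord: "jet_coord \<phi> 1 (tangent_of A (D, \<phi>) p v) = v"
proof -
  note germ = chart_line_germ [OF assms, of v]
  have 0: "inv_into D \<phi> (\<phi> p + 0 *\<^sub>R v) = p" using inv_chart [OF assms] by simp
  show "tangent_of A (D, \<phi>) p v \<in> tangent_space A p"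
    unfolding tangent_of_def tangent_space_def using germ 0 by fastforce
  show "jet_coord \<phi> 1 (tangent_of A (D, \<phi>) p v) = v"
    unfolding tangent_of_def using jet_coord_jet [OF germ(1) assms(1), of 1 1] 0 assms(2) germ(2) by simp
qed

lemma tangent_of_jet_coord:
  "(D, \<phi>) \<in> A \<Longrightarrow> p \<in> D \<Longrightarrow> X \<in> tangent_space A p \<Longrightarrow> tangent_of A (D, \<phi>) p (jet_coord \<phi> 1 X) = X"
  by (rule tangent_eqI [OF tangent_of_mem _ _ _ tangent_of_coord])

lemma tangent_coord_transition:
  assumes "X \<in> tangent_space A p" "(D, \<phi>) \<in> A" "(E, \<psi>) \<in> A" "p \<in> D" "p \<in> E"
  shows "jet_coord \<psi> 1 X = fd (\<psi> \<circ> inv_into D \<phi>) (\<phi> p) (jet_coord \<phi> 1 X)"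
proof -
  obtain c where c: "X = jet A 1 c" "c \<in> curve_germs A" "c 0 = p" using assms by (auto simp: tangent_space_def)
  obtain U where U: "open U" "0 \<in> U" "c ` U \<subseteq> D" "smooth_on U (\<phi> \<circ> c)"
    using curve_germsE [OF c(2) assms(2)] c assms by metis
  obtain W where W: "open W" "W \<subseteq> U" "0 \<in> W" "c ` W \<subseteq> D \<inter> E" "smooth_on W (\<phi> \<circ> c)"
      "smooth_on W (\<psi> \<circ> c)" "(\<phi> \<circ> c) ` W \<subseteq> \<phi> ` (D \<inter> E)"
    "\<forall>y\<in>W. ((\<psi> \<circ> inv_into D \<phi>) \<circ> (\<phi> \<circ> c)) y = (\<psi> \<circ> c) y"
    by (rule curve_meets_overlap [OF assms(2,3) U(1,3,4,2)]) (use c assms in auto)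
  have "vderiv (\<psi> \<circ> c) 0 = vderiv ((\<psi> \<circ> inv_into D \<phi>) \<circ> (\<phi> \<circ> c)) 0"
    by (rule vderiv_cong [OF W(1,3)]) (rule bspec [OF W(8), symmetric])
  also have "\<dots> = fd (\<psi> \<circ> inv_into D \<phi>) (\<phi> p) (vderiv (\<phi> \<circ> c) 0)"
    using vderiv_compose [OF W(1,5) transition_smooth [OF assms(2,3)] W(7) overlap_open [OF assms(2,3)] W(3)] c
    by simp
  finally show ?thesis
    using jet_coord_jet [OF c(2) assms(2), of 1 1] jet_coord_jet [OF c(2) assms(3), of 1 1] c assms by simp
qed

lemma zero_tangent:
  assumes "(D, \<phi>) \<in> A" "p \<in> D"
  shows "zero_tangent A p = tangent_of A (D, \<phi>) p 0"
  unfolding zero_tangent_def tangent_of_def using inv_chart [OF assms] by simp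

text \<open>\<open>scale_tangent\<close> reparametrizes a chosen representative; by the chain rule
  only the velocity of that representative enters.\<close>

lemma scale_tangent:
  assumes "X \<in> tangent_space A p" "(D, \<phi>) \<in> A" "p \<in> D"
  shows "scale_tangent A a X \<in> tangent_space A p"
    "jet_coord \<phi> 1 (scale_tangent A a X) = a *\<^sub>R jet_coord \<phi> 1 X"
proof -
  obtain c where c: "X = jet A 1 c" "c \<in> curve_germs A" "c 0 = p" using assms by (auto simp: tangent_space_def)
  define d where "d = repr X"
  have d: "d \<in> curve_germs A" "d 0 = p" using repr_jet [OF c(2)] c by (auto simp: d_def)
  obtain U where U: "open U" "0 \<in> U" "d ` U \<subseteq> D" "smooth_on U (\<phi> \<circ> d)"
    using curve_germsE [OF d(1) assms(2)] d assms by metis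
  have op: "open ((*) a -` U)" using U(1) by (simp add: open_vimage continuous_intros)
  have sm: "smooth_on ((*) a -` U) (\<lambda>s. (\<phi> \<circ> d) (a * s))"
    by (rule smooth_on_compose [OF op _ U(4)])
       (auto intro!: smooth_on_mult smooth_on_const smooth_on_ident op)
  have germ: "(\<lambda>s. d (a * s)) \<in> curve_germs A"
    by (rule curve_germsI [OF assms(2) op]) (use U sm in \<open>auto simp: o_def\<close>)
  show "scale_tangent A a X \<in> tangent_space A p"
    unfolding scale_tangent_def tangent_space_def d_def [symmetric] using germ d by fastforce
  have "((\<lambda>s. (\<phi> \<circ> d) (a * s)) has_vector_derivative a *\<^sub>R vderiv (\<phi> \<circ> d) 0) (at 0)"
  proof -
    have "((\<lambda>s. a * s) has_vector_derivative a) (at 0)"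
      unfolding has_real_derivative_iff_has_vector_derivative [symmetric]
      by (auto intro!: derivative_eq_intros)
    from vector_diff_chain_at [OF this, of "\<phi> \<circ> d"] smooth_on_has_vderiv [OF U(4,2)]
    show ?thesis by (simp add: o_def)
  qed
  then have "vderiv (\<phi> \<circ> (\<lambda>s. d (a * s))) 0 = a *\<^sub>R vderiv (\<phi> \<circ> d) 0"
    using vderiv_eqI by (simp add: o_def)
  then show "jet_coord \<phi> 1 (scale_tangent A a X) = a *\<^sub>R jet_coord \<phi> 1 X"
    unfolding scale_tangent_def d_def [symmetric]
    using jet_coord_jet [OF germ assms(2), of 1 1] d assms by (simp add: jet_coord_def d_def)
qed

lemma velocity_coord_near:
  assumes "open U" "t \<in> U" "(D, \<phi>) \<in> A" "c ` U \<subseteq> D" "smooth_on U (\<phi> \<circ> c)"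
  shows "velocity A c t \<in> tangent_space A (c t)" "jet_coord \<phi> 1 (velocity A c t) = vderiv (\<phi> \<circ> c) t"
  using velocity_mem [OF smooth_map_onI [OF assms(3,1,4,5)] assms(2)]
    jet_coord_jet_lift [OF smooth_map_onI [OF assms(3,1,4,5)] assms(2,3), of 1 1] assms by auto

end

section \<open>Metric, connection and covariant derivative in charts\<close>

locale riemannian_atlas = atlas +
  fixes g :: "'a metric"
  assumes riemannian_metric: "riemannian_metric A g"
begin

lemma local_metric: "(D, \<phi>) \<in> A \<Longrightarrow> local_metric (\<phi> ` D) (metric_coord A g (D, \<phi>))"
proof
  assume D: "(D, \<phi>) \<in> A"
  then show "open (\<phi> ` D)" by (rule chart_open)
  note R = bspec [OF riemannian_metric [unfolded riemannian_metric_def Let_def] D, unfolded prod.case]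
  show "bilinear (metric_coord A g (D, \<phi>) x)" if "x \<in> \<phi> ` D" for x using R that by blast
  show "metric_coord A g (D, \<phi>) x v w = metric_coord A g (D, \<phi>) x w v" if "x \<in> \<phi> ` D" for x v w
    using R that by blast
  show "0 < metric_coord A g (D, \<phi>) x v v" if "x \<in> \<phi> ` D" "v \<noteq> 0" for x v using R that by blast
  show "smooth_on (\<phi> ` D) (\<lambda>x. metric_coord A g (D, \<phi>) x v w)" for v w using R by blast
qed

text \<open>\<open>metric_coord\<close> evaluates the metric on vectors built by
  \<open>tangent_of\<close> only, but every tangent vector is of this form.\<close>

lemma metric_eq_coord:
  assumes "(D, \<phi>) \<in> A" "p \<in> D" "X \<in> tangent_space A p" "Y \<in> tangent_space A p"
  shows "g X Y = metric_coord A g (D, \<phi>) (\<phi> p) (jet_coord \<phi> 1 X) (jet_coord \<phi> 1 Y)"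
  using tangent_of_jet_coord [OF assms(1,2,3)] tangent_of_jet_coord [OF assms(1,2,4)]
  by (simp add: metric_coord_def inv_chart [OF assms(1,2)])

text \<open>Transition maps are isometries between the two coordinate expressions of the metric.
  This is the hypothesis under which Christoffel symbols transform.\<close>

lemma metric_coord_transition:
  assumes "(D, \<phi>) \<in> A" "(E, \<psi>) \<in> A" "x \<in> \<phi> ` (D \<inter> E)"
  defines "\<tau> \<equiv> \<psi> \<circ> inv_into D \<phi>"
  shows "metric_coord A g (D, \<phi>) x v w = metric_coord A g (E, \<psi>) (\<tau> x) (fd \<tau> x v) (fd \<tau> x w)"
proof -
  obtain p where p: "p \<in> D" "p \<in> E" "x = \<phi> p" using assms by auto
  have t: "tangent_of A (D, \<phi>) p v \<in> tangent_space A p" for v using tangent_of_mem assms p by blast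
  have "metric_coord A g (D, \<phi>) x v w = g (tangent_of A (D, \<phi>) p v) (tangent_of A (D, \<phi>) p w)"
    unfolding metric_eq_coord [OF assms(1) p(1) t t] tangent_of_coord [OF assms(1) p(1)] p(3) ..
  also have "\<dots> = metric_coord A g (E, \<psi>) (\<psi> p) (fd \<tau> x v) (fd \<tau> x w)"
    unfolding metric_eq_coord [OF assms(2) p(2) t t] tangent_coord_transition [OF t assms(1,2) p(1,2)]
      tangent_of_coord [OF assms(1) p(1)] \<tau>_def p(3) ..
  finally show ?thesis using inv_chart [OF assms(1) p(1)] by (simp add: \<tau>_def p(3))
qed

lemma levi_civita_transition:
  assumes "(D, \<phi>) \<in> A" "(E, \<psi>) \<in> A" "x \<in> \<phi> ` (D \<inter> E)"
  defines "\<tau> \<equiv> \<psi> \<circ> inv_into D \<phi>"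
  shows "fd \<tau> x (levi_civita A g (D, \<phi>) x u v) =
    fd (\<lambda>y. fd \<tau> y v) x u + levi_civita A g (E, \<psi>) (\<tau> x) (fd \<tau> x u) (fd \<tau> x v)"
  unfolding levi_civita_eq_christoffel
proof (rule christoffel_transform [OF local_metric [OF assms(1)] local_metric [OF assms(2)] overlap_open [OF assms(1,2)]
    _ _ _ _ assms(3)])
  show "\<phi> ` (D \<inter> E) \<subseteq> \<phi> ` D" by auto
  show "smooth_on (\<phi> ` (D \<inter> E)) \<tau>" unfolding \<tau>_def using transition_smooth assms by blast
  show "\<tau> ` \<phi> ` (D \<inter> E) \<subseteq> \<psi> ` E" using inv_chart [OF assms(1)] by (auto simp: \<tau>_def)
qed (use metric_coord_transition [OF assms(1,2)] \<tau>_def in auto)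

text \<open>The definite description in \<open>cov_deriv\<close> prescribes coordinates in all
  charts at once, so these must be consistent. A candidate is built in one chart; in another one,
  differentiating the transformed field produces a second derivative of the transition map, and the
  transformation law of the Christoffel symbols produces the same term.\<close>

lemma cov_deriv_coord:
  assumes D: "(D, \<phi>) \<in> A" and U: "open U" "t \<in> U" "c ` U \<subseteq> D" "smooth_on U (\<phi> \<circ> c)"
    and V: "\<And>s. s \<in> U \<Longrightarrow> V s \<in> tangent_space A (c s)"
    and V': "(\<lambda>s. jet_coord \<phi> 1 (V s)) differentiable (at t)"
  shows "cov_deriv A g c V t \<in> tangent_space A (c t)"
    "jet_coord \<phi> 1 (cov_deriv A g c V t) = vderiv (\<lambda>s. jet_coord \<phi> 1 (V s)) t +
       levi_civita A g (D, \<phi>) (\<phi> (c t)) (vderiv (\<phi> \<circ> c) t) (jet_coord \<phi> 1 (V t))"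
proof -
  define F where "F = (\<lambda>(D, \<phi>). vderiv (\<lambda>s. jet_coord \<phi> 1 (V s)) t +
       levi_civita A g (D, \<phi>) (\<phi> (c t)) (vderiv (\<phi> \<circ> c) t) (jet_coord \<phi> 1 (V t)))"
  define X where "X = tangent_of A (D, \<phi>) (c t) (F (D, \<phi>))"
  have ct: "c t \<in> D" using U by auto
  have X: "X \<in> tangent_space A (c t)" unfolding X_def using D ct by (rule tangent_of_mem)
  have XD: "jet_coord \<phi> 1 X = F (D, \<phi>)" unfolding X_def using D ct by (rule tangent_of_coord)
  have "jet_coord \<psi> 1 X = F (E, \<psi>)" if E: "(E, \<psi>) \<in> A" "c t \<in> E" for E \<psi>
  proof -
    define \<tau> where "\<tau> = \<psi> \<circ> inv_into D \<phi>"
    define N where "N = \<phi> ` (D \<inter> E)"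
    have N: "open N" "smooth_on N \<tau>"
      using overlap_open [OF D E(1)] transition_smooth [OF D E(1)] by (auto simp: N_def \<tau>_def)
    obtain W where W: "open W" "W \<subseteq> U" "t \<in> W" "c ` W \<subseteq> D \<inter> E" "smooth_on W (\<phi> \<circ> c)"
      "smooth_on W (\<psi> \<circ> c)" "(\<phi> \<circ> c) ` W \<subseteq> N" "\<forall>y\<in>W. (\<tau> \<circ> (\<phi> \<circ> c)) y = (\<psi> \<circ> c) y"
      unfolding N_def \<tau>_def by (rule curve_meets_overlap [OF D E(1) U(1,3,4,2) E(2)])
    have x: "\<phi> (c t) \<in> N" using W by auto
    have Vtr: "jet_coord \<psi> 1 (V s) = fd \<tau> (\<phi> (c s)) (jet_coord \<phi> 1 (V s))" if "s \<in> W" for s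
      unfolding \<tau>_def by (rule tangent_coord_transition [OF V D E(1)]) (use that W in auto)
    have V1: "((\<lambda>s. jet_coord \<phi> 1 (V s)) has_vector_derivative vderiv (\<lambda>s. jet_coord \<phi> 1 (V s)) t) (at t)"
      using V' vector_derivative_works unfolding vderiv_def by blast
    have "((\<lambda>s. fd \<tau> ((\<phi> \<circ> c) s) (jet_coord \<phi> 1 (V s))) has_derivative
        (\<lambda>h. fd (\<lambda>x. fd \<tau> x (jet_coord \<phi> 1 (V t))) ((\<phi> \<circ> c) t) (h *\<^sub>R vderiv (\<phi> \<circ> c) t) +
          fd \<tau> ((\<phi> \<circ> c) t) (h *\<^sub>R vderiv (\<lambda>s. jet_coord \<phi> 1 (V s)) t))) (at t)"
      by (rule has_derivative_family [where H = "\<lambda>x v. fd \<tau> x v" and p = "\<phi> \<circ> c", OF N(1) linear_fd [OF N(2)] _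
          smooth_on_differentiable [OF smooth_on_fd [OF N(2)]]
          smooth_on_has_vderiv [OF W(5,3), unfolded has_vector_derivative_def]
          V1 [unfolded has_vector_derivative_def]])
         (use x in simp_all)
    then have *: "((\<lambda>s. fd \<tau> (\<phi> (c s)) (jet_coord \<phi> 1 (V s))) has_vector_derivative
        (fd (\<lambda>x. fd \<tau> x (jet_coord \<phi> 1 (V t))) (\<phi> (c t)) (vderiv (\<phi> \<circ> c) t) +
          fd \<tau> (\<phi> (c t)) (vderiv (\<lambda>s. jet_coord \<phi> 1 (V s)) t))) (at t)"
      unfolding has_vector_derivative_def
      by (simp add: linear_scale [OF linear_fd [OF N(2) x]] scaleR_add_right
          linear_scale [OF linear_fd [OF smooth_on_fd [OF N(2)] x]])
    have "vderiv (\<lambda>s. jet_coord \<psi> 1 (V s)) t = vderiv (\<lambda>s. fd \<tau> (\<phi> (c s)) (jet_coord \<phi> 1 (V s))) t"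
      by (rule vderiv_cong [OF W(1,3)]) (rule Vtr)
    also note vderiv_eqI [OF *]
    finally have 1: "vderiv (\<lambda>s. jet_coord \<psi> 1 (V s)) t =
      fd (\<lambda>x. fd \<tau> x (jet_coord \<phi> 1 (V t))) (\<phi> (c t)) (vderiv (\<phi> \<circ> c) t) +
          fd \<tau> (\<phi> (c t)) (vderiv (\<lambda>s. jet_coord \<phi> 1 (V s)) t)"
      .
    have 2: "vderiv (\<psi> \<circ> c) t = fd \<tau> (\<phi> (c t)) (vderiv (\<phi> \<circ> c) t)"
    proof -
      have "vderiv (\<psi> \<circ> c) t = vderiv (\<tau> \<circ> (\<phi> \<circ> c)) t"
        by (rule vderiv_cong [OF W(1,3)]) (rule bspec [OF W(8), symmetric])
      with vderiv_compose [OF W(1,5) N(2) W(7) N(1) W(3)] show ?thesis by simp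
    qed
    have 3: "\<psi> (c t) = \<tau> (\<phi> (c t))" using bspec [OF W(8) W(3)] by simp
    \<comment> \<open>The two second-derivative terms are matched here: one comes from
      differentiating the field (1), the other from \<open>levi_civita_transition\<close>.\<close>
    have "jet_coord \<psi> 1 X = fd \<tau> (\<phi> (c t)) (F (D, \<phi>))"
      using tangent_coord_transition [OF X D E(1) ct E(2)] XD by (simp add: \<tau>_def)
    also have "\<dots> = F (E, \<psi>)"
      unfolding F_def prod.case 1 2 3 linear_add [OF linear_fd [OF N(2) x]] Vtr [OF W(3)]
        levi_civita_transition [OF D E(1) x [unfolded N_def], folded \<tau>_def]
      by simp
    finally show ?thesis .
  qed
  note XF = this
  have "cov_deriv A g c V t = (THE X. X \<in> tangent_space A (c t) \<and>
      (\<forall>(D, \<phi>)\<in>A. c t \<in> D \<longrightarrow> jet_coord \<phi> 1 X = F (D, \<phi>)))"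
    unfolding cov_deriv_def F_def prod.case ..
  also have "\<dots> = X"
  proof (rule the_equality)
    show "X \<in> tangent_space A (c t) \<and> (\<forall>(D, \<phi>)\<in>A. c t \<in> D \<longrightarrow> jet_coord \<phi> 1 X = F (D, \<phi>))"
      using X XF by blast
    fix Y assume Y: "Y \<in> tangent_space A (c t) \<and> (\<forall>(D, \<phi>)\<in>A. c t \<in> D \<longrightarrow> jet_coord \<phi> 1 Y = F (D, \<phi>))"
    then have "jet_coord \<phi> 1 Y = F (D, \<phi>)" using D ct by blast
    then show "Y = X" using tangent_eqI [OF conjunct1 [OF Y] X D ct] XD by simp
  qed
  finally have "cov_deriv A g c V t = X" .
  then show "cov_deriv A g c V t \<in> tangent_space A (c t)"
    "jet_coord \<phi> 1 (cov_deriv A g c V t) = vderiv (\<lambda>s. jet_coord \<phi> 1 (V s)) t +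
       levi_civita A g (D, \<phi>) (\<phi> (c t)) (vderiv (\<phi> \<circ> c) t) (jet_coord \<phi> 1 (V t))"
    using X XD by (simp_all add: F_def)
qed

lemma geodesic_iff:
  assumes c: "smooth_map_on A I c"
  shows "geodesic A g I c \<longleftrightarrow> (\<forall>t\<in>I. \<forall>(D, \<phi>)\<in>A. c t \<in> D \<longrightarrow>
    vderiv (vderiv (\<phi> \<circ> c)) t +
      levi_civita A g (D, \<phi>) (\<phi> (c t)) (vderiv (\<phi> \<circ> c) t) (vderiv (\<phi> \<circ> c) t) = 0)"
proof -
  have "cov_deriv A g c (velocity A c) t = zero_tangent A (c t) \<longleftrightarrow>
    vderiv (vderiv (\<phi> \<circ> c)) t +
      levi_civita A g (D, \<phi>) (\<phi> (c t)) (vderiv (\<phi> \<circ> c) t) (vderiv (\<phi> \<circ> c) t) = 0"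
    if t: "t \<in> I" and D: "(D, \<phi>) \<in> A" "c t \<in> D" for t D \<phi>
  proof -
    obtain U where U: "open U" "U \<subseteq> I" "t \<in> U" "c ` U \<subseteq> D" "smooth_on U (\<phi> \<circ> c)"
      using smooth_map_onE [OF c t D] .
    have vel: "velocity A c s \<in> tangent_space A (c s)" "vderiv (\<phi> \<circ> c) s = jet_coord \<phi> 1 (velocity A c s)"
      if "s \<in> U" for s
      using velocity_coord_near [OF U(1) that D(1) U(4,5)] by auto
    have sm: "smooth_on U (\<lambda>s. jet_coord \<phi> 1 (velocity A c s))"
      by (rule smooth_on_cong [OF U(1) smooth_on_vderiv [OF U(1,5)] vel(2)])
    note cd = cov_deriv_coord [OF D(1) U(1,3,4,5) vel(1) smooth_on_differentiable [OF sm U(3)]]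
    have "jet_coord \<phi> 1 (cov_deriv A g c (velocity A c) t) = vderiv (vderiv (\<phi> \<circ> c)) t +
      levi_civita A g (D, \<phi>) (\<phi> (c t)) (vderiv (\<phi> \<circ> c) t) (vderiv (\<phi> \<circ> c) t)"
      using cd(2) vderiv_cong [OF U(1,3) vel(2)] vel(2) [OF U(3)] by simp
    moreover have "jet_coord \<phi> 1 (zero_tangent A (c t)) = 0" "zero_tangent A (c t) \<in> tangent_space A (c t)"
      using zero_tangent [OF D] tangent_of_coord [OF D] tangent_of_mem [OF D] by simp_all
    ultimately show ?thesis using tangent_eqI [OF cd(1) _ D] by metis
  qed
  note * = this
  show ?thesis
    unfolding geodesic_def
  proof (intro iffI conjI ballI c)
    fix t assume t: "t \<in> I" and all: "\<forall>t\<in>I. \<forall>(D, \<phi>)\<in>A. c t \<in> D \<longrightarrow>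
      vderiv (vderiv (\<phi> \<circ> c)) t +
        levi_civita A g (D, \<phi>) (\<phi> (c t)) (vderiv (\<phi> \<circ> c) t) (vderiv (\<phi> \<circ> c) t) = 0"
    obtain D \<phi> where D: "(D, \<phi>) \<in> A" "c t \<in> D" by (rule smooth_map_on_chart_ex [OF c t])
    show "cov_deriv A g c (velocity A c) t = zero_tangent A (c t)"
      using bspec [OF bspec [OF all t] D(1)] D(2) * [OF t D] by simp
  qed (use * in auto)
qed

end

section \<open>The 2-Sasaki metric in coordinates\<close>

context local_metric
begin

abbreviation "\<Gamma> \<equiv> christoffel G"

lemmas \<Gamma>_simps = bilinear_simps [OF christoffel_bilinear]

lemma has_vector_derivative_christoffel:
  assumes "c t \<in> U" "(c has_vector_derivative c') (at t)"
    "(a has_vector_derivative a') (at t)" "(b has_vector_derivative b') (at t)"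
  shows "((\<lambda>s. \<Gamma> (c s) (a s) (b s)) has_vector_derivative
    fd (\<lambda>p. \<Gamma> p (a t) (b t)) (c t) c' + \<Gamma> (c t) a' (b t) + \<Gamma> (c t) (a t) b') (at t)"
proof -
  have "((\<lambda>s. \<Gamma> (c s) (a s) (b s)) has_derivative
    (\<lambda>h. fd (\<lambda>p. \<Gamma> p (a t) (b t)) (c t) (h *\<^sub>R c') + \<Gamma> (c t) (h *\<^sub>R a') (b t) + \<Gamma> (c t) (a t) (h *\<^sub>R b'))) (at t)"
    by (rule has_derivative_bifamily [where H = \<Gamma> and p = c, OF open_dom christoffel_bilinear assms(1)
      smooth_on_differentiable [OF christoffel_smooth assms(1)] assms(2-4) [unfolded has_vector_derivative_def]])
  then show ?thesis
    unfolding has_vector_derivative_def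
    by (simp add: \<Gamma>_simps assms(1) linear_scale [OF linear_fd [OF christoffel_smooth assms(1)]] scaleR_add_right)
qed

definition K1 :: "'e \<times> 'e \<times> 'e \<Rightarrow> 'e \<times> 'e \<times> 'e \<Rightarrow> 'e"
  where "K1 X v = fst (snd v) + \<Gamma> (fst X) (fst (snd X)) (fst v)"

text \<open>The factor is 1/2!, from the normalization of the second connection map; the bracket is
  a second covariant derivative along a curve with 2-jet \<open>X\<close>, with \<open>v\<close>
  holding the 2-jet of the field.\<close>

definition K2 :: "'e \<times> 'e \<times> 'e \<Rightarrow> 'e \<times> 'e \<times> 'e \<Rightarrow> 'e"
  where "K2 X v = (1/2) *\<^sub>R (snd (snd v) + fd (\<lambda>p. \<Gamma> p (fst (snd X)) (fst v)) (fst X) (fst (snd X)) +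
    \<Gamma> (fst X) (snd (snd X)) (fst v) + \<Gamma> (fst X) (fst (snd X)) (fst (snd v)) +
    \<Gamma> (fst X) (fst (snd X)) (K1 X v))"

definition jet_metric :: "'e \<times> 'e \<times> 'e \<Rightarrow> 'e \<times> 'e \<times> 'e \<Rightarrow> 'e \<times> 'e \<times> 'e \<Rightarrow> real"
  where "jet_metric X v w = G (fst X) (fst v) (fst w) + G (fst X) (K1 X v) (K1 X w) +
    G (fst X) (K2 X v) (K2 X w)"

text \<open>The origin of both formulas: \<open>N\<close> is the covariant derivative of the field
  \<open>h\<close> along \<open>c\<close>, and 2 \<open>K2\<close> is the covariant derivative of
  \<open>N\<close>. It is used twice, with the variation field of a family to compute the connection
  maps, and with the velocity of \<open>c\<close> for the lift.\<close>

lemma K2_along_curve: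
  assumes "open J" "smooth_on J c" "smooth_on J h" "t \<in> J" "c ` J \<subseteq> U"
  defines "N \<equiv> \<lambda>s. vderiv h s + \<Gamma> (c s) (vderiv c s) (h s)"
    and "X \<equiv> (c t, vderiv c t, vderiv (vderiv c) t)"
    and "v \<equiv> (h t, vderiv h t, vderiv (vderiv h) t)"
  shows "(N has_vector_derivative (2 *\<^sub>R K2 X v - \<Gamma> (c t) (vderiv c t) (N t))) (at t)" "N t = K1 X v"
proof -
  have ct: "c t \<in> U" using assms by auto
  show "N t = K1 X v" by (simp add: N_def K1_def X_def v_def)
  have "(N has_vector_derivative vderiv (vderiv h) t + (fd (\<lambda>p. \<Gamma> p (vderiv c t) (h t)) (c t) (vderiv c t) +
      \<Gamma> (c t) (vderiv (vderiv c) t) (h t) + \<Gamma> (c t) (vderiv c t) (vderiv h t))) (at t)"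
    unfolding N_def using assms(1-4)
    by (intro has_vector_derivative_add has_vector_derivative_christoffel ct)
       (auto intro: smooth_on_has_vderiv smooth_on_vderiv)
  then show "(N has_vector_derivative (2 *\<^sub>R K2 X v - \<Gamma> (c t) (vderiv c t) (N t))) (at t)"
    using \<open>N t = K1 X v\<close> by (simp add: K2_def X_def v_def add.assoc)
qed

lemma dom_jets: "open (U \<times> (UNIV :: ('e \<times> 'e) set))"
  by (intro open_Times open_dom open_UNIV)

lemma fd_christoffel_linear:
  assumes "x \<in> U"
  shows "linear (\<lambda>y. fd (\<lambda>p. \<Gamma> p y v) x u)" "linear (\<lambda>v. fd (\<lambda>p. \<Gamma> p y v) x u)"
  by (rule linear_fd_family [OF open_dom assms _ smooth_on_differentiable [OF christoffel_smooth assms]];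
      use christoffel_bilinear in \<open>simp add: bilinear_def\<close>)+

lemma
  assumes "X \<in> U \<times> UNIV"
  shows K1_linear: "linear (K1 X)" and K2_linear: "linear (K2 X)"
proof -
  have x: "fst X \<in> U" using assms by auto
  show K1: "linear (K1 X)"
    by (rule linearI) (simp_all add: K1_def \<Gamma>_simps [OF x] scaleR_add_right)
  show "linear (K2 X)"
    by (rule linearI) (simp_all add: K2_def linear_add [OF K1] linear_scale [OF K1] \<Gamma>_simps [OF x]
        linear_add [OF fd_christoffel_linear(2) [OF x]] linear_scale [OF fd_christoffel_linear(2) [OF x]]
        scaleR_add_right)
qed

lemma
  shows K1_smooth: "smooth_on (U \<times> UNIV) (\<lambda>X. K1 X v)"
    and K2_smooth: "smooth_on (U \<times> UNIV) (\<lambda>X. K2 X v)"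
proof -
  note S = smooth_on_fst smooth_on_snd smooth_on_ident smooth_on_const dom_jets
  have \<Gamma>s: "smooth_on (U \<times> UNIV) a \<Longrightarrow> smooth_on (U \<times> UNIV) b \<Longrightarrow>
      smooth_on (U \<times> UNIV) (\<lambda>X. \<Gamma> (fst X) (a X) (b X))" for a b :: "'e \<times> 'e \<times> 'e \<Rightarrow> 'e"
    by (rule smooth_on_bifamily [where H = \<Gamma> and p = fst, OF dom_jets christoffel_smooth christoffel_bilinear])
       (auto intro!: S)
  show K1: "smooth_on (U \<times> UNIV) (\<lambda>X. K1 X v)"
    unfolding K1_def by (intro smooth_on_add \<Gamma>s S)
  have "smooth_on (U \<times> UNIV) (\<lambda>X. fd (\<lambda>p. \<Gamma> p (fst (snd X)) (fst v)) (fst X) (fst (snd X)))"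
    by (rule smooth_on_bifamily [where H = "\<lambda>x y u. fd (\<lambda>p. \<Gamma> p y (fst v)) x u" and p = fst and U = U])
       (auto intro!: S smooth_on_fd open_Times open_dom christoffel_smooth
          simp: bilinear_def linear_fd [OF christoffel_smooth] fd_christoffel_linear)
  then show "smooth_on (U \<times> UNIV) (\<lambda>X. K2 X v)"
    unfolding K2_def by (intro smooth_on_scaleR smooth_on_add \<Gamma>s S K1)
qed

lemma local_metric_jet: "local_metric (U \<times> UNIV) jet_metric"
proof
  show "open (U \<times> (UNIV :: ('e \<times> 'e) set))" by (rule dom_jets)
next
  fix X :: "'e \<times> 'e \<times> 'e" assume X: "X \<in> U \<times> UNIV"
  then have x: "fst X \<in> U" by auto
  note K = K1_linear [OF X] K2_linear [OF X]
  show "bilinear (jet_metric X)"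
    unfolding bilinear_def jet_metric_def
    by (intro conjI allI linearI)
       (simp_all add: K [THEN linear_add] K [THEN linear_scale] G_simps [OF x] algebra_simps)
  show "jet_metric X v w = jet_metric X w v" for v w
    by (simp add: jet_metric_def sym [OF x])
  fix v :: "'e \<times> 'e \<times> 'e" assume v: "v \<noteq> 0"
  have nn: "0 \<le> G (fst X) a a" for a using pos [OF x, of a] zero_iff [OF x, of a] by (cases "a = 0") auto
  \<comment> \<open>The three components determine \<open>v\<close> triangularly: each involves one
    further entry of \<open>v\<close>, with a nonzero constant coefficient, and otherwise only
    earlier entries.\<close>
  have "\<not> (fst v = 0 \<and> K1 X v = 0 \<and> K2 X v = 0)"
  proof
    assume "fst v = 0 \<and> K1 X v = 0 \<and> K2 X v = 0"
    then have 0: "fst v = 0" "K1 X v = 0" "K2 X v = 0" by auto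
    from 0(1,2) have 1: "fst (snd v) = 0" by (simp add: K1_def \<Gamma>_simps [OF x])
    from 0 1 have "snd (snd v) = 0"
      by (simp add: K2_def \<Gamma>_simps [OF x] linear_0 [OF fd_christoffel_linear(2) [OF x]])
    then show False using v 0 1 by (simp add: prod_eq_iff)
  qed
  then show "0 < jet_metric X v v"
    unfolding jet_metric_def
    using nn [of "fst v"] nn [of "K1 X v"] nn [of "K2 X v"] pos [OF x, of "fst v"] pos [OF x, of "K1 X v"]
      pos [OF x, of "K2 X v"] by fastforce
next
  fix v w
  have Gs: "smooth_on (U \<times> UNIV) a \<Longrightarrow> smooth_on (U \<times> UNIV) b \<Longrightarrow>
      smooth_on (U \<times> UNIV) (\<lambda>X. G (fst X) (a X) (b X))" for a b :: "'e \<times> 'e \<times> 'e \<Rightarrow> 'e"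
    by (rule smooth_on_bifamily [where H = G and p = fst, OF dom_jets smooth bilinear])
       (auto intro!: smooth_on_fst smooth_on_ident dom_jets)
  show "smooth_on (U \<times> UNIV) (\<lambda>X. jet_metric X v w)"
    unfolding jet_metric_def
    by (intro smooth_on_add Gs K1_smooth K2_smooth dom_jets smooth_on_const)
qed

text \<open>Each of the three terms is a product in the metric of the base, so along a straight line
  in the direction \<open>w\<close> the covariant product rule applies to it. The vector
  \<open>v\<close> is held constant; the connection maps still vary with the jet.\<close>

lemma fd_jet_metric:
  assumes X: "X \<in> U \<times> UNIV"
  shows "fd (\<lambda>Y. jet_metric Y v v) X w / 2 = G (fst X) (fst v) (\<Gamma> (fst X) (fst w) (fst v)) +
    G (fst X) (K1 X v) (fd (\<lambda>Y. K1 Y v) X w + \<Gamma> (fst X) (fst w) (K1 X v)) +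
    G (fst X) (K2 X v) (fd (\<lambda>Y. K2 Y v) X w + \<Gamma> (fst X) (fst w) (K2 X v))"
proof -
  interpret J: local_metric "U \<times> UNIV" jet_metric by (rule local_metric_jet)
  have x: "fst (X + 0 *\<^sub>R w) \<in> U" using X by auto
  note line = has_vector_derivative_line [of X w 0]
  have f: "((\<lambda>s::real. fst (X + s *\<^sub>R w)) has_vector_derivative fst w) (at 0)"
    using bounded_linear.has_vector_derivative [OF bounded_linear_fst line] .
  have K: "((\<lambda>s::real. k (X + s *\<^sub>R w)) has_vector_derivative fd k X w) (at 0)"
    if "smooth_on (U \<times> UNIV) k" for k :: "'e \<times> 'e \<times> 'e \<Rightarrow> 'c::real_normed_vector"
    using has_vector_derivative_compose_fd [OF _ line, of k] smooth_on_differentiable [OF that X] by simp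
  have "((\<lambda>s. jet_metric (X + s *\<^sub>R w) v v) has_vector_derivative
     (2 * (G (fst X) (fst v) (\<Gamma> (fst X) (fst w) (fst v)) +
    G (fst X) (K1 X v) (fd (\<lambda>Y. K1 Y v) X w + \<Gamma> (fst X) (fst w) (K1 X v)) +
    G (fst X) (K2 X v) (fd (\<lambda>Y. K2 Y v) X w + \<Gamma> (fst X) (fst w) (K2 X v))))) (at 0)"
    unfolding jet_metric_def
    using covariant_product_rule [OF x f K [OF K1_smooth [of v]] K [OF K1_smooth [of v]]]
      covariant_product_rule [OF x f K [OF K2_smooth [of v]] K [OF K2_smooth [of v]]]
      covariant_product_rule [OF x f has_vector_derivative_const has_vector_derivative_const, of "fst v" "fst v"]
    using x sym [of "fst X"]
    by (auto intro!: derivative_eq_intros simp: distrib_left)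
  from vderiv_eqI [OF this] vderiv_eqI [OF K [OF J.smooth [of v v]]] show ?thesis by simp
qed

section \<open>The geodesic equation of the lift in one chart\<close>

lemma has_vector_derivative_const_on:
  assumes "open J" "t \<in> J" "\<And>s. s \<in> J \<Longrightarrow> f s = k" "(f has_vector_derivative d) (at t)"
  shows "d = 0"
  using has_vector_derivative_transform_within_open [OF assms(4,1,2), of "\<lambda>_. k"] assms(3)
    vector_derivative_unique_at has_vector_derivative_const by blast

theorem jet_geodesic_equation_iff:
  assumes J: "open J" and c: "smooth_on J c" "c ` J \<subseteq> U"
  defines "C \<equiv> \<lambda>t. (c t, vderiv c t, vderiv (vderiv c) t)"
  shows "(\<forall>t\<in>J. vderiv (vderiv C) t + christoffel jet_metric (C t) (vderiv C t) (vderiv C t) = 0) \<longleftrightarrow>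
    (\<forall>t\<in>J. vderiv (vderiv c) t + \<Gamma> (c t) (vderiv c t) (vderiv c t) = 0)"
proof -
  interpret J: local_metric "U \<times> UNIV" jet_metric by (rule local_metric_jet)
  define a where "a = vderiv c"
  define A where "A t = vderiv a t + \<Gamma> (c t) (a t) (a t)" for t
  define B where "B t = vderiv A t + \<Gamma> (c t) (a t) (A t)" for t
  \<comment> \<open>The covariant acceleration of the lift. It is treated as a single vector and
    only its pairings are ever used.\<close>
  define Z where "Z t = vderiv (vderiv C) t + christoffel jet_metric (C t) (vderiv C t) (vderiv C t)" for t
  have cU: "c t \<in> U" if "t \<in> J" for t using c that by auto
  have sa: "smooth_on J a" unfolding a_def by (intro smooth_on_vderiv J c)
  have s\<Gamma>: "smooth_on J f \<Longrightarrow> smooth_on J h \<Longrightarrow> smooth_on J (\<lambda>t. \<Gamma> (c t) (f t) (h t))" for f h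
    by (rule smooth_on_bifamily [where H = \<Gamma>, OF J christoffel_smooth christoffel_bilinear c])
  have sA: "smooth_on J A" unfolding A_def by (intro smooth_on_add J smooth_on_vderiv s\<Gamma> sa)
  have sB: "smooth_on J B" unfolding B_def by (intro smooth_on_add J smooth_on_vderiv s\<Gamma> sa sA)
  have sC: "smooth_on J C" unfolding C_def by (intro smooth_on_Pair J smooth_on_vderiv c)
  note D = smooth_on_has_vderiv
  have dc: "(c has_vector_derivative a t) (at t)" if "t \<in> J" for t
    unfolding a_def by (rule D [OF c(1) that])
  have CU: "C t \<in> U \<times> UNIV" if "t \<in> J" for t using cU that by (simp add: C_def)
  have C': "vderiv C t = (a t, vderiv a t, vderiv (vderiv a) t)" if "t \<in> J" for t
    unfolding C_def a_def
    by (rule vderiv_eqI) (intro has_vector_derivative_Pair D [OF _ that] smooth_on_vderiv J c)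
  have fstC: "fst (C t) = c t" for t by (simp add: C_def)
  have fstC': "fst (vderiv C t) = a t" if "t \<in> J" for t by (simp add: C' [OF that])
  have K1: "K1 (C t) (vderiv C t) = A t" if "t \<in> J" for t
    unfolding C' [OF that] unfolding A_def K1_def C_def a_def by simp
  \<comment> \<open>Here the field along the curve is the velocity \<open>a\<close> itself, with
    covariant derivatives \<open>A\<close> and \<open>B\<close>.\<close>
  have K2: "K2 (C t) (vderiv C t) = (1/2) *\<^sub>R B t" if "t \<in> J" for t
  proof -
    note k = K2_along_curve [OF J c(1) sa that c(2), folded a_def]
    have "(A has_vector_derivative (2 *\<^sub>R K2 (C t) (vderiv C t) - \<Gamma> (c t) (a t) (A t))) (at t)"
      using k(1) unfolding C' [OF that] unfolding C_def A_def a_def .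
    from vderiv_eqI [OF this] show ?thesis by (simp add: B_def)
  qed
  have metric: "jet_metric (C t) (vderiv C t) w =
      G (c t) (a t) (fst w) + G (c t) (A t) (K1 (C t) w) + G (c t) ((1/2) *\<^sub>R B t) (K2 (C t) w)"
    if "t \<in> J" for t w
    unfolding jet_metric_def K1 [OF that] K2 [OF that] by (simp add: fstC fstC' [OF that])
  have EL: "((\<lambda>s. jet_metric (C s) (vderiv C s) w) has_vector_derivative
    jet_metric (C t) (Z t) w + fd (\<lambda>Y. jet_metric Y (vderiv C t) (vderiv C t)) (C t) w / 2) (at t)"
    if "t \<in> J" for t w
    unfolding Z_def
    by (rule J.euler_lagrange [OF CU [OF that] D [OF sC that] D [OF smooth_on_vderiv [OF J sC] that]])
  have prod: "((\<lambda>s. G (c s) (f s) (h s)) has_vector_derivative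
      G (c t) (vderiv f t + \<Gamma> (c t) (a t) (f t)) (h t) + G (c t) (f t) (vderiv h t + \<Gamma> (c t) (a t) (h t))) (at t)"
    if "t \<in> J" "smooth_on J f" "smooth_on J h" for t f h
    by (rule covariant_product_rule [OF cU [OF that(1)] dc [OF that(1)] D [OF that(2,1)] D [OF that(3,1)]])
  have "(\<forall>t\<in>J. Z t = 0) \<longleftrightarrow> (\<forall>t\<in>J. A t = 0)"
  proof
    assume Z: "\<forall>t\<in>J. Z t = 0"
    have par: "vderiv B t + \<Gamma> (c t) (a t) (B t) = 0" if t: "t \<in> J" for t
    proof (rule nondegenerate [OF cU [OF t]])
      fix \<zeta> :: 'e
      \<comment> \<open>A direction that changes only the acceleration. It is seen by the last
        connection map alone, so the pairing with the velocity isolates \<open>B\<close>.\<close>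
      define w where "w = (0::'e, 0::'e, \<zeta>)"
      have fK: "K1 Y w = 0" "K2 Y w = (1/2) *\<^sub>R \<zeta>" if "Y \<in> U \<times> UNIV" for Y
        using that by (auto simp: K1_def K2_def w_def \<Gamma>_simps linear_0 [OF fd_christoffel_linear(2)])
      have d1: "((\<lambda>s. G (c s) ((1/2) *\<^sub>R B s) ((1/2) *\<^sub>R \<zeta>)) has_vector_derivative
          fd (\<lambda>Y. jet_metric Y (vderiv C t) (vderiv C t)) (C t) w / 2) (at t)"
        by (rule has_vector_derivative_transform_within_open [OF _ J t, of "\<lambda>s. jet_metric (C s) (vderiv C s) w"])
           (use EL [OF t, of w] Z t CU cU in \<open>simp_all add: metric fK G_simps J.G_simps w_def [THEN arg_cong [where f = fst]]\<close>)
      have d2: "((\<lambda>s. G (c s) ((1/2) *\<^sub>R B s) ((1/2) *\<^sub>R \<zeta>)) has_vector_derivative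
          G (c t) ((1/2) *\<^sub>R (vderiv B t + \<Gamma> (c t) (a t) (B t))) ((1/2) *\<^sub>R \<zeta>) +
          G (c t) ((1/2) *\<^sub>R B t) ((1/2) *\<^sub>R \<Gamma> (c t) (a t) \<zeta>)) (at t)"
        using covariant_product_rule [OF cU [OF t] dc [OF t]
            has_vector_derivative_scaleR [OF DERIV_const D [OF sB t], of "1/2"]
            has_vector_derivative_const [of "(1/2) *\<^sub>R \<zeta>"]]
        by (simp add: \<Gamma>_simps cU [OF t] scaleR_add_right)
      \<comment> \<open>In this direction the base point and the first connection map stay fixed,
        and the second one changes by half of \<Gamma>(\<zeta>, a) when evaluated on the velocity.
        The result is exactly the term of \<open>d2\<close> in which the constant vector is
        differentiated, so only the covariant derivative of \<open>B\<close> remains.\<close>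
      have d3: "fd (\<lambda>Y. jet_metric Y (vderiv C t) (vderiv C t)) (C t) w / 2 =
          G (c t) ((1/2) *\<^sub>R B t) ((1/2) *\<^sub>R \<Gamma> (c t) (a t) \<zeta>)"
      proof -
        have line: "((\<lambda>s::real. k (C t + s *\<^sub>R w)) has_vector_derivative fd k (C t) w) (at 0)"
          if "smooth_on (U \<times> UNIV) k" for k :: "'e \<times> 'e \<times> 'e \<Rightarrow> 'e"
          using has_vector_derivative_compose_fd [OF _ has_vector_derivative_line [of "C t" w 0], of k]
            smooth_on_differentiable [OF that CU [OF t]] by simp
        have "K1 (C t + s *\<^sub>R w) v = K1 (C t) v" for s v
          by (simp add: K1_def w_def)
        then have "fd (\<lambda>Y. K1 Y v) (C t) w = 0" for v
          using vector_derivative_unique_at [OF line [OF K1_smooth [of v]]] by simp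
        moreover have "fd (\<lambda>Y. K2 Y v) (C t) w = (1/2) *\<^sub>R \<Gamma> (c t) \<zeta> (fst v)" for v
        proof -
          have "K2 (C t + s *\<^sub>R w) v = K2 (C t) v + s *\<^sub>R (1/2) *\<^sub>R \<Gamma> (c t) \<zeta> (fst v)" for s
            by (simp add: K2_def K1_def w_def C_def \<Gamma>_simps cU [OF t] algebra_simps)
          with line [OF K2_smooth [of v]]
          have "((\<lambda>s. K2 (C t) v + s *\<^sub>R (1/2) *\<^sub>R \<Gamma> (c t) \<zeta> (fst v)) has_vector_derivative
              fd (\<lambda>Y. K2 Y v) (C t) w) (at 0)" by simp
          then show ?thesis by (rule vector_derivative_unique_at [OF _ has_vector_derivative_line])
        qed
        moreover have "fst w = 0" by (simp add: w_def)
        ultimately show ?thesis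
          unfolding fd_jet_metric [OF CU [OF t]] K1 [OF t] K2 [OF t] fstC fstC' [OF t]
            christoffel_sym [OF cU [OF t], of "a t" \<zeta>]
          by (simp add: fstC' [OF t] \<Gamma>_simps G_simps cU [OF t])
      qed
      have "G (c t) ((1/2) *\<^sub>R (vderiv B t + \<Gamma> (c t) (a t) (B t))) ((1/2) *\<^sub>R \<zeta>) = 0"
        using vector_derivative_unique_at [OF d1 d2] unfolding d3 by linarith
      then show "G (c t) (vderiv B t + \<Gamma> (c t) (a t) (B t)) \<zeta> = G (c t) 0 \<zeta>"
        by (simp add: G_simps cU [OF t])
    qed
    note P = sym [OF cU]
    \<comment> \<open>Half the derivative of the constant squared speed; the term of
      \<open>B\<close> drops out because \<open>B\<close> is parallel.\<close>
    have 1: "G (c t) (a t) (A t) + G (c t) (A t) (B t) = 0" if t: "t \<in> J" for t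
    proof -
      have "((\<lambda>s. jet_metric (C s) (vderiv C s) (vderiv C s)) has_vector_derivative 0) (at t)"
        using J.covariant_product_rule [OF CU [OF t] D [OF sC t] D [OF smooth_on_vderiv [OF J sC] t]
          D [OF smooth_on_vderiv [OF J sC] t], folded Z_def] Z t by (simp add: J.G_simps(7,8) [OF CU [OF t]])
      then have d1: "((\<lambda>s. G (c s) (a s) (a s) + G (c s) (A s) (A s) + (1/4) * G (c s) (B s) (B s)) has_vector_derivative 0) (at t)"
        by (rule has_vector_derivative_transform_within_open [OF _ J t])
           (simp add: metric K1 K2 fstC' G_simps cU)
      have d2: "((\<lambda>s. G (c s) (a s) (a s) + G (c s) (A s) (A s) + (1/4) * G (c s) (B s) (B s)) has_vector_derivative
          (2 * G (c t) (a t) (A t) + 2 * G (c t) (A t) (B t))) (at t)"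
        using prod [OF t sa sa] prod [OF t sA sA] prod [OF t sB sB] P [OF t]
        unfolding par [OF t] A_def [symmetric] B_def [symmetric]
        by (auto intro!: derivative_eq_intros simp: G_simps cU [OF t])
      show ?thesis using vector_derivative_unique_at [OF d1 d2] by linarith
    qed
    \<comment> \<open>The derivative of 1: the first product gives the first two terms, the second
      one gives the square of \<open>B\<close>, again because \<open>B\<close> is parallel.\<close>
    have 2: "G (c t) (A t) (A t) + G (c t) (a t) (B t) + G (c t) (B t) (B t) = 0" if t: "t \<in> J" for t
    proof (rule has_vector_derivative_const_on [OF J t 1])
      show "((\<lambda>s. G (c s) (a s) (A s) + G (c s) (A s) (B s)) has_vector_derivative
          G (c t) (A t) (A t) + G (c t) (a t) (B t) + G (c t) (B t) (B t)) (at t)"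
        using has_vector_derivative_add [OF prod [OF t sa sA] prod [OF t sA sB]]
        unfolding par [OF t] A_def [symmetric] B_def [symmetric]
        by (simp add: G_simps cU [OF t] add.assoc)
    qed
    have 3: "G (c t) (A t) (B t) = 0" if t: "t \<in> J" for t
    proof -
      \<comment> \<open>The derivative of 2: the square of \<open>A\<close> contributes twice the
        pairing, the product of \<open>a\<close> and \<open>B\<close> once, and the square of
        \<open>B\<close> is constant.\<close>
      have "3 * G (c t) (A t) (B t) = 0"
      proof (rule has_vector_derivative_const_on [OF J t 2])
        show "((\<lambda>s. G (c s) (A s) (A s) + G (c s) (a s) (B s) + G (c s) (B s) (B s)) has_vector_derivative
            3 * G (c t) (A t) (B t)) (at t)"
          using has_vector_derivative_add [OF has_vector_derivative_add [OF prod [OF t sA sA] prod [OF t sa sB]]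
              prod [OF t sB sB]] P [OF t, of "B t" "A t"]
          unfolding par [OF t] A_def [symmetric] B_def [symmetric]
          by (simp add: G_simps cU [OF t])
      qed
      then show ?thesis by simp
    qed
    have "B t = 0" if t: "t \<in> J" for t
    proof -
      have "G (c t) (B t) (B t) = 0"
      proof (rule has_vector_derivative_const_on [OF J t 3])
        show "((\<lambda>s. G (c s) (A s) (B s)) has_vector_derivative G (c t) (B t) (B t)) (at t)"
          using prod [OF t sA sB] unfolding par [OF t] B_def [symmetric]
          by (simp add: G_simps cU [OF t])
      qed
      then show ?thesis using zero_iff cU [OF t] by simp
    qed
    \<comment> \<open>With \<open>B\<close> gone, identity 2 is reduced to the square of
      \<open>A\<close>.\<close>
    then show "\<forall>t\<in>J. A t = 0" using 2 zero_iff cU by (simp add: G_simps cU)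
  next
    assume A: "\<forall>t\<in>J. A t = 0"
    \<comment> \<open>\<open>A\<close> vanishes on all of the open set \<open>J\<close>, hence so do
      its derivative and its covariant derivative.\<close>
    have B: "B t = 0" if t: "t \<in> J" for t
    proof -
      have "vderiv A t = vderiv (\<lambda>_. 0) t" by (rule vderiv_cong [OF J t]) (use A in simp)
      also have "\<dots> = 0" by (rule vderiv_eqI) simp
      finally show ?thesis using A t cU [OF t] by (simp add: B_def \<Gamma>_simps)
    qed
    show "\<forall>t\<in>J. Z t = 0"
    proof (intro ballI J.nondegenerate [OF CU])
      fix t w assume t: "t \<in> J"
      have d1: "((\<lambda>s. G (c s) (a s) (fst w)) has_vector_derivative
          jet_metric (C t) (Z t) w + fd (\<lambda>Y. jet_metric Y (vderiv C t) (vderiv C t)) (C t) w / 2) (at t)"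
        by (rule has_vector_derivative_transform_within_open [OF EL [OF t] J t])
           (simp add: metric A B G_simps cU)
      have d2: "((\<lambda>s. G (c s) (a s) (fst w)) has_vector_derivative
          G (c t) (A t) (fst w) + G (c t) (a t) (\<Gamma> (c t) (a t) (fst w))) (at t)"
        using covariant_product_rule [OF cU [OF t] dc [OF t] D [OF sa t] has_vector_derivative_const [of "fst w"]]
        by (simp add: A_def)
      \<comment> \<open>With \<open>A\<close> and \<open>B\<close> zero only the base term is left,
        and it is the same term that the constant direction contributes in \<open>d2\<close>;
        comparison leaves the pairing of \<open>Z t\<close>.\<close>
      have d3: "fd (\<lambda>Y. jet_metric Y (vderiv C t) (vderiv C t)) (C t) w / 2 =
          G (c t) (a t) (\<Gamma> (c t) (a t) (fst w))"
        unfolding fd_jet_metric [OF CU [OF t]] K1 [OF t] K2 [OF t]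
        using A t B [OF t] by (simp add: fstC fstC' [OF t] G_simps cU [OF t] christoffel_sym [of "c t" "fst w"])
      have "jet_metric (C t) (Z t) w = 0"
        using vector_derivative_unique_at [OF d1 d2] A t unfolding d3 by (simp add: G_simps cU [OF t])
      then show "jet_metric (C t) (Z t) w = jet_metric (C t) 0 w" by (simp add: J.G_simps CU [OF t])
    qed
  qed
  then show ?thesis by (simp add: Z_def A_def a_def)
qed

end

section \<open>The atlas of the jet manifold\<close>

lemma smooth_map_on_local:
  assumes "\<And>x. x \<in> S \<Longrightarrow> \<exists>U\<subseteq>S. x \<in> U \<and> smooth_map_on A U f"
  shows "smooth_map_on A S f"
  unfolding smooth_map_on_def
proof (intro ballI conjI)
  fix x assume "x \<in> S"
  then obtain U where U: "U \<subseteq> S" "x \<in> U" "smooth_map_on A U f" using assms by blast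
  then show "f x \<in> points A" by (simp add: smooth_map_on_def)
  fix C assume C: "C \<in> A"
  obtain D \<phi> where Dp: "C = (D, \<phi>)" by fastforce
  have "f x \<in> D \<longrightarrow> (\<exists>V\<subseteq>U. open V \<and> x \<in> V \<and> f ` V \<subseteq> D \<and> smooth_on V (\<phi> \<circ> f))"
    using bspec [OF conjunct2 [OF bspec [OF U(3) [unfolded smooth_map_on_def] U(2)]] C] Dp by simp
  then show "case C of (D, \<phi>) \<Rightarrow> f x \<in> D \<longrightarrow> (\<exists>U\<subseteq>S. open U \<and> x \<in> U \<and> f ` U \<subseteq> D \<and> smooth_on U (\<phi> \<circ> f))"
    using U(1) unfolding Dp prod.case by (meson subset_trans)
qed

lemma vderiv_quadratic:
  "vderiv (\<lambda>t. x + t *\<^sub>R y + (t\<^sup>2 / 2) *\<^sub>R z) = (\<lambda>t. y + t *\<^sub>R z)" "vderiv (\<lambda>t. y + t *\<^sub>R z) = (\<lambda>t. z)"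
proof -
  show "vderiv (\<lambda>t. y + t *\<^sub>R z) = (\<lambda>t. z)"
    by (rule ext, rule vderiv_eqI, rule has_vector_derivative_line)
  have "((\<lambda>t. x + t *\<^sub>R y + (t\<^sup>2 / 2) *\<^sub>R z) has_vector_derivative y + t *\<^sub>R z) (at t)" for t
    by (auto intro!: derivative_eq_intros simp: has_vector_derivative_def fun_eq_iff algebra_simps)
  then show "vderiv (\<lambda>t. x + t *\<^sub>R y + (t\<^sup>2 / 2) *\<^sub>R z) = (\<lambda>t. y + t *\<^sub>R z)"
    using vderiv_eqI by blast
qed

context atlas
begin

definition jet_dom :: "'a set \<Rightarrow> 'a jet set"
  where "jet_dom D = {jet A 2 c | c. c \<in> curve_germs A \<and> c 0 \<in> D}"

definition jet_chart :: "('a \<Rightarrow> 'e) \<Rightarrow> 'a jet \<Rightarrow> 'e \<times> 'e \<times> 'e"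
  where "jet_chart \<phi> u = (jet_coord \<phi> 0 u, jet_coord \<phi> 1 u, jet_coord \<phi> 2 u)"

lemma jet2_atlas_eq: "jet2_atlas A = (\<lambda>(D, \<phi>). (jet_dom D, jet_chart \<phi>)) ` A"
  unfolding jet2_atlas_def jet_dom_def jet_chart_def by (rule image_cong) auto

lemma jet2_atlasI: "(D, \<phi>) \<in> A \<Longrightarrow> (jet_dom D, jet_chart \<phi>) \<in> jet2_atlas A"
  unfolding jet2_atlas_eq by force

lemma ball_jet2_atlas: "(\<forall>(D, \<phi>)\<in>jet2_atlas A. P D \<phi>) \<longleftrightarrow> (\<forall>(D, \<phi>)\<in>A. P (jet_dom D) (jet_chart \<phi>))"
  unfolding jet2_atlas_eq by auto

lemma jet_chart_jet:
  assumes "c \<in> curve_germs A" "(D, \<phi>) \<in> A" "c 0 \<in> D"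
  shows "jet_chart \<phi> (jet A 2 c) = (\<phi> (c 0), vderiv (\<phi> \<circ> c) 0, vderiv (vderiv (\<phi> \<circ> c)) 0)"
  unfolding jet_chart_def using jet_coord_jet [OF assms] by (simp add: numeral_2_eq_2)

lemma jet_mem_jet_dom: "c \<in> curve_germs A \<Longrightarrow> jet A 2 c \<in> jet_dom D \<longleftrightarrow> c 0 \<in> D"
  unfolding jet_dom_def using jet_base_jet by (auto, metis)

lemma jet_domE:
  assumes "u \<in> jet_dom D"
  obtains c where "u = jet A 2 c" "c \<in> curve_germs A" "c 0 \<in> D"
  using assms unfolding jet_dom_def by blast

lemma jet_dom_Int: "jet_dom D \<inter> jet_dom E = jet_dom (D \<inter> E)"
proof -
  have "u \<in> jet_dom D \<inter> jet_dom E \<longleftrightarrow> u \<in> jet_dom (D \<inter> E)" for u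
    by (metis IntD1 IntD2 IntI jet_domE jet_mem_jet_dom)
  then show ?thesis by blast
qed

lemma jet_base_chart:
  assumes "(D, \<phi>) \<in> A" "u \<in> jet_dom D"
  shows "jet_base u \<in> D" "\<phi> (jet_base u) = fst (jet_chart \<phi> u)"
  using assms by (auto elim!: jet_domE simp: jet_base_jet jet_chart_jet)

lemma jet_chart_inj: "(D, \<phi>) \<in> A \<Longrightarrow> inj_on (jet_chart \<phi>) (jet_dom D)"
proof (rule inj_onI)
  fix u v assume D: "(D, \<phi>) \<in> A" and u: "u \<in> jet_dom D" and v: "v \<in> jet_dom D"
    and eq: "jet_chart \<phi> u = jet_chart \<phi> v"
  obtain c where c: "u = jet A 2 c" "c \<in> curve_germs A" "c 0 \<in> D" using jet_domE [OF u] .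
  obtain d where d: "v = jet A 2 d" "d \<in> curve_germs A" "d 0 \<in> D" using jet_domE [OF v] .
  have e: "\<phi> (c 0) = \<phi> (d 0)" "vderiv (\<phi> \<circ> c) 0 = vderiv (\<phi> \<circ> d) 0"
    "vderiv (vderiv (\<phi> \<circ> c)) 0 = vderiv (vderiv (\<phi> \<circ> d)) 0"
    using eq unfolding c(1) d(1) jet_chart_jet [OF c(2) D c(3)] jet_chart_jet [OF d(2) D d(3)] by auto
  have "c 0 = d 0" using inj_onD [OF chart_inj [OF D] e(1)] c d by blast
  have "same_jet 2 c d"
  proof (rule same_jetI [OF c(2) d(2) D c(3) \<open>c 0 = d 0\<close>])
    show "(vderiv ^^ k) (\<phi> \<circ> c) 0 = (vderiv ^^ k) (\<phi> \<circ> d) 0" if "k \<le> 2" for k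
      using that by (rule le2_cases) (simp_all add: e numeral_2_eq_2)
  qed simp
  then show "u = v" using c d jet_eqI by blast
qed

text \<open>The Taylor parabola with the prescribed coefficients, drawn in the chart. Hence the
  fibre of the jet chart is the whole space of velocities and accelerations.\<close>

lemma ex_jet:
  assumes D: "(D, \<phi>) \<in> A" and x: "x \<in> \<phi> ` D"
  obtains c where "c \<in> curve_germs A" "c 0 \<in> D" "jet_chart \<phi> (jet A 2 c) = (x, y, z)"
proof -
  define f where "f t = x + t *\<^sub>R y + (t\<^sup>2 / 2) *\<^sub>R z" for t :: real
  define c where "c t = inv_into D \<phi> (f t)" for t
  define U where "U = f -` (\<phi> ` D)"
  have U: "open U" unfolding U_def f_def
    by (intro open_vimage chart_open [OF D] continuous_intros) auto
  have U0: "0 \<in> U" using x by (simp add: U_def f_def)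
  have eq: "f t = (\<phi> \<circ> c) t" if "t \<in> U" for t
    using that chart_inv [of "f t" \<phi> D] by (simp add: U_def c_def)
  have cD: "c ` U \<subseteq> D" by (auto simp: U_def c_def inv_chart_mem)
  have sf: "smooth_on U f" unfolding f_def power2_eq_square divide_inverse
    by (intro smooth_on_add smooth_on_scaleR smooth_on_mult smooth_on_const smooth_on_ident U)
  have germ: "c \<in> curve_germs A"
    by (rule curve_germsI [OF D U U0 cD smooth_on_cong [OF U sf eq]])
  have "(vderiv ^^ k) f 0 = (vderiv ^^ k) (\<phi> \<circ> c) 0" for k
    by (rule funpow_vderiv_cong [OF U U0 eq])
  note this [of 0] this [of 1] this [of 2]
  moreover have "f 0 = x" "vderiv f 0 = y" "vderiv (vderiv f) 0 = z"
    unfolding f_def by (simp_all add: vderiv_quadratic)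
  ultimately have "jet_chart \<phi> (jet A 2 c) = (x, y, z)"
    using jet_chart_jet [OF germ D] cD U0 by (auto simp: numeral_2_eq_2)
  then show ?thesis using that germ cD U0 by blast
qed

lemma jet_chart_image_overlap:
  assumes "(D, \<phi>) \<in> A"
  shows "jet_chart \<phi> ` jet_dom (D \<inter> E) = \<phi> ` (D \<inter> E) \<times> UNIV"
proof -
  have "jet_chart \<phi> u \<in> \<phi> ` (D \<inter> E) \<times> UNIV" if "u \<in> jet_dom (D \<inter> E)" for u
    using that assms by (auto elim!: jet_domE simp: jet_chart_jet)
  moreover have "(x, y, z) \<in> jet_chart \<phi> ` jet_dom (D \<inter> E)" if x: "x \<in> \<phi> ` (D \<inter> E)" for x y z
  proof -
    obtain c where c: "c \<in> curve_germs A" "c 0 \<in> D" "jet_chart \<phi> (jet A 2 c) = (x, y, z)"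
      by (rule ex_jet [OF assms, of x y z]) (use x in auto)
    then have "x = \<phi> (c 0)" using jet_chart_jet [OF c(1) assms c(2)] by simp
    then have "c 0 \<in> D \<inter> E" using chart_mem_overlap [OF assms c(2), of E] x c by simp
    then have "jet A 2 c \<in> jet_dom (D \<inter> E)" using c jet_mem_jet_dom by blast
    then show ?thesis using c(3) by (metis imageI)
  qed
  ultimately show ?thesis
    by (metis (no_types, lifting) SigmaE image_subsetI subsetI subset_antisym prod.collapse)
qed

lemma jet_chart_image: "(D, \<phi>) \<in> A \<Longrightarrow> jet_chart \<phi> ` jet_dom D = \<phi> ` D \<times> UNIV"
  using jet_chart_image_overlap [of D \<phi> D] by simp

text \<open>The second prolongation of \<tau>, read off from a curve with the given 2-jet by the
  chain rules. The last component is quadratic in \<open>y\<close>, so fibre coordinates do not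
  change linearly.\<close>

lemma jet_transition:
  assumes D: "(D, \<phi>) \<in> A" and E: "(E, \<psi>) \<in> A" and x: "x \<in> \<phi> ` (D \<inter> E)"
  defines "\<tau> \<equiv> \<psi> \<circ> inv_into D \<phi>"
  shows "(jet_chart \<psi> \<circ> inv_into (jet_dom D) (jet_chart \<phi>)) (x, y, z) =
    (\<tau> x, fd \<tau> x y, fd (\<lambda>x. fd \<tau> x y) x y + fd \<tau> x z)"
proof -
  obtain c where c: "c \<in> curve_germs A" "c 0 \<in> D" "jet_chart \<phi> (jet A 2 c) = (x, y, z)"
    by (rule ex_jet [OF D, of x y z]) (use x in auto)
  have u: "inv_into (jet_dom D) (jet_chart \<phi>) (x, y, z) = jet A 2 c"
    using inv_into_f_f [OF jet_chart_inj [OF D], of "jet A 2 c"] c jet_mem_jet_dom by simp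
  have xyz: "x = \<phi> (c 0)" "y = vderiv (\<phi> \<circ> c) 0" "z = vderiv (vderiv (\<phi> \<circ> c)) 0"
    using jet_chart_jet [OF c(1) D c(2)] c(3) by auto
  then have cE: "c 0 \<in> E" using chart_mem_overlap [OF D c(2), of E] x by simp
  obtain U where U: "open U" "0 \<in> U" "c ` U \<subseteq> D" "smooth_on U (\<phi> \<circ> c)"
    by (rule curve_germsE [OF c(1) D c(2)])
  obtain W where W: "open W" "W \<subseteq> U" "0 \<in> W" "c ` W \<subseteq> D \<inter> E" "smooth_on W (\<phi> \<circ> c)"
    "smooth_on W (\<psi> \<circ> c)" "(\<phi> \<circ> c) ` W \<subseteq> \<phi> ` (D \<inter> E)"
    "\<forall>y\<in>W. ((\<psi> \<circ> inv_into D \<phi>) \<circ> (\<phi> \<circ> c)) y = (\<psi> \<circ> c) y"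
    by (rule curve_meets_overlap [OF D E U(1,3,4,2) cE])
  have eq: "(vderiv ^^ k) (\<tau> \<circ> (\<phi> \<circ> c)) 0 = (vderiv ^^ k) (\<psi> \<circ> c) 0" for k
    unfolding \<tau>_def by (rule funpow_vderiv_cong [OF W(1,3)]) (rule bspec [OF W(8)])
  note t = W(1,5) transition_smooth [OF D E, folded \<tau>_def] W(7) overlap_open [OF D E] W(3)
  show ?thesis
    using eq [of 0] eq [of 1] eq [of 2] vderiv_compose [OF t] vderiv2_compose [OF t]
    unfolding o_apply u jet_chart_jet [OF c(1) E cE] by (simp add: xyz eval_nat_numeral o_def)
qed

lemma smooth_on_jet_transition:
  fixes \<tau> :: "'e \<Rightarrow> 'e"
  assumes N: "open N" "smooth_on N \<tau>"
  shows "smooth_on (N \<times> UNIV) (\<lambda>X. (\<tau> (fst X), fd \<tau> (fst X) (fst (snd X)),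
    fd (\<lambda>x. fd \<tau> x (fst (snd X))) (fst X) (fst (snd X)) + fd \<tau> (fst X) (snd (snd X))))"
proof -
  have op: "open (N \<times> (UNIV :: ('e \<times> 'e) set))" by (intro open_Times N open_UNIV)
  note S = smooth_on_fst [OF op] smooth_on_snd [OF op] smooth_on_ident
  have fst: "fst ` (N \<times> (UNIV :: ('e \<times> 'e) set)) \<subseteq> N" by auto
  have 0: "smooth_on (N \<times> (UNIV :: ('e \<times> 'e) set)) (\<lambda>X. \<tau> (fst X))"
    by (rule smooth_on_compose [where f = fst, OF op _ N(2)]) (auto intro!: S)
  have 1: "smooth_on (N \<times> UNIV) a \<Longrightarrow> smooth_on (N \<times> UNIV) (\<lambda>X. fd \<tau> (fst X) (a X))"
    for a :: "'e \<times> 'e \<times> 'e \<Rightarrow> 'e"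
    by (rule smooth_on_family [where H = "\<lambda>x v. fd \<tau> x v" and p = fst and U = N])
       (auto intro!: S op smooth_on_fd N linear_fd)
  \<comment> \<open>The quadratic term is a bilinear map on the diagonal; linearity in the inner
    argument comes from the symmetry of the second derivative.\<close>
  have bl: "bilinear (\<lambda>y v. fd (\<lambda>x. fd \<tau> x y) x v)" if "x \<in> N" for x
    unfolding bilinear_def
  proof (intro conjI allI)
    show l: "linear (fd (\<lambda>x. fd \<tau> x y) x)" for y by (rule linear_fd [OF smooth_on_fd [OF N(2)] that])
    show "linear (\<lambda>y. fd (\<lambda>x. fd \<tau> x y) x v)" for v
      unfolding symmetric_second_derivative [OF N that, of _ v] by (rule l)
  qed
  have 2: "smooth_on (N \<times> (UNIV :: ('e \<times> 'e) set)) (\<lambda>X. fd (\<lambda>x. fd \<tau> x (fst (snd X))) (fst X) (fst (snd X)))"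
    by (rule smooth_on_bifamily [where H = "\<lambda>x y v. fd (\<lambda>x. fd \<tau> x y) x v" and p = fst and U = N])
       (auto intro!: S op smooth_on_fd N bl)
  show ?thesis by (intro smooth_on_Pair smooth_on_add op 0 1 2 S)
qed

lemma smooth_atlas_jet2: "smooth_atlas (jet2_atlas A)"
  unfolding smooth_atlas_def ball_jet2_atlas
proof (intro conjI)
  show "\<forall>(D, \<phi>)\<in>A. inj_on (jet_chart \<phi>) (jet_dom D) \<and> open (jet_chart \<phi> ` jet_dom D)"
    by (auto simp: jet_chart_inj jet_chart_image intro!: open_Times chart_open)
  show "\<forall>(D, \<phi>)\<in>A. \<forall>(E, \<psi>)\<in>A. open (jet_chart \<phi> ` (jet_dom D \<inter> jet_dom E)) \<and>
    smooth_on (jet_chart \<phi> ` (jet_dom D \<inter> jet_dom E)) (jet_chart \<psi> \<circ> inv_into (jet_dom D) (jet_chart \<phi>))"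
  proof clarify
    fix D \<phi> E \<psi> assume D: "(D, \<phi>) \<in> A" and E: "(E, \<psi>) \<in> A"
    have op: "open (\<phi> ` (D \<inter> E) \<times> (UNIV :: ('e \<times> 'e) set))"
      by (intro open_Times overlap_open [OF D E] open_UNIV)
    have "smooth_on (\<phi> ` (D \<inter> E) \<times> UNIV) (jet_chart \<psi> \<circ> inv_into (jet_dom D) (jet_chart \<phi>))"
      by (rule smooth_on_cong [OF op smooth_on_jet_transition [OF overlap_open [OF D E] transition_smooth [OF D E]]])
         (use jet_transition [OF D E] in force)
    with op show "open (jet_chart \<phi> ` (jet_dom D \<inter> jet_dom E)) \<and>
      smooth_on (jet_chart \<phi> ` (jet_dom D \<inter> jet_dom E)) (jet_chart \<psi> \<circ> inv_into (jet_dom D) (jet_chart \<phi>))"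
      by (simp add: jet_dom_Int jet_chart_image_overlap [OF D])
  qed
qed

interpretation T: atlas "jet2_atlas A" by unfold_locales (rule smooth_atlas_jet2)

lemma jet_lift_near:
  assumes q: "smooth_map_on A I q" and D: "(D, \<phi>) \<in> A" and U: "open U" "U \<subseteq> I" "q ` U \<subseteq> D" "smooth_on U (\<phi> \<circ> q)"
  shows "\<And>t. t \<in> U \<Longrightarrow> (jet_chart \<phi> \<circ> jet_lift A 2 q) t =
      ((\<phi> \<circ> q) t, vderiv (\<phi> \<circ> q) t, vderiv (vderiv (\<phi> \<circ> q)) t)"
    "smooth_on U (jet_chart \<phi> \<circ> jet_lift A 2 q)" "jet_lift A 2 q ` U \<subseteq> jet_dom D"
proof -
  show eq: "(jet_chart \<phi> \<circ> jet_lift A 2 q) t = ((\<phi> \<circ> q) t, vderiv (\<phi> \<circ> q) t, vderiv (vderiv (\<phi> \<circ> q)) t)"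
    if "t \<in> U" for t
  proof -
    have "jet_coord \<phi> k (jet_lift A 2 q t) = (vderiv ^^ k) (\<phi> \<circ> q) t" if "k \<le> 2" for k
      by (rule jet_coord_jet_lift [OF q _ D _ that]) (use U \<open>t \<in> U\<close> in auto)
    from this [of 0] this [of 1] this [of 2] show ?thesis by (simp add: jet_chart_def eval_nat_numeral)
  qed
  show "smooth_on U (jet_chart \<phi> \<circ> jet_lift A 2 q)"
    by (rule smooth_on_cong [OF U(1) _ eq [symmetric]])
       (intro smooth_on_Pair smooth_on_vderiv U)
  show "jet_lift A 2 q ` U \<subseteq> jet_dom D"
  proof
    fix u assume "u \<in> jet_lift A 2 q ` U"
    then obtain t where t: "t \<in> U" "u = jet_lift A 2 q t" by blast
    then have "(\<lambda>s. q (t + s)) \<in> curve_germs A" "q t \<in> D" using U by (auto intro: shift_curve_germ [OF q])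
    then show "u \<in> jet_dom D" by (simp add: t(2) jet_lift_def jet_mem_jet_dom)
  qed
qed

lemma jet_lift_smooth:
  assumes "smooth_map_on A I q"
  shows "smooth_map_on (jet2_atlas A) I (jet_lift A 2 q)"
proof (rule smooth_map_on_local)
  fix t assume t: "t \<in> I"
  obtain D \<phi> where D: "(D, \<phi>) \<in> A" "q t \<in> D" by (rule smooth_map_on_chart_ex [OF assms t])
  obtain U where U: "open U" "U \<subseteq> I" "t \<in> U" "q ` U \<subseteq> D" "smooth_on U (\<phi> \<circ> q)"
    by (rule smooth_map_onE [OF assms t D])
  note n = jet_lift_near [OF assms D(1) U(1,2,4,5)]
  have "smooth_map_on (jet2_atlas A) U (jet_lift A 2 q)"
    by (rule T.smooth_map_onI [OF jet2_atlasI [OF D(1)] U(1) n(3,2)])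
  then show "\<exists>U\<subseteq>I. t \<in> U \<and> smooth_map_on (jet2_atlas A) U (jet_lift A 2 q)" using U by blast
qed

lemma jet_lift_mem_jet_dom:
  "smooth_map_on A I q \<Longrightarrow> t \<in> I \<Longrightarrow> jet_lift A 2 q t \<in> jet_dom D \<longleftrightarrow> q t \<in> D"
  using shift_curve_germ [of I q t] by (simp add: jet_lift_def jet_mem_jet_dom)

end

section \<open>The 2-Sasaki metric on the jet manifold\<close>

text \<open>The coordinate expression of the 2-Sasaki metric is known on the chart image only, and
  \<open>christoffel\<close> sees no more than the metric near the point.\<close>

lemma (in local_metric) christoffel_cong:
  assumes "x \<in> U" "\<And>y. y \<in> U \<Longrightarrow> G' y = G y"
  shows "christoffel G' x = christoffel G x"
proof -
  have "fd (\<lambda>y. G' y v w) x = fd (\<lambda>y. G y v w) x" for v w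
    by (rule fd_G_cong [OF assms(1)]) (simp add: assms(2))
  then show ?thesis unfolding christoffel_def assms(2) [OF assms(1)] by (simp only:)
qed

section \<open>Families of curves and mixed partial derivatives\<close>

lemma
  fixes f :: "real \<times> real \<Rightarrow> 'b::real_normed_vector"
  assumes "smooth_on S f" "(s, t) \<in> S"
  shows has_vector_derivative_partial1: "((\<lambda>s. f (s, t)) has_vector_derivative fd f (s, t) (1, 0)) (at s)"
    and has_vector_derivative_partial2: "((\<lambda>t. f (s, t)) has_vector_derivative fd f (s, t) (0, 1)) (at t)"
  by (rule has_vector_derivative_compose_fd [where f = f]; use smooth_on_differentiable [OF assms] in
    \<open>auto intro!: has_vector_derivative_Pair derivative_eq_intros simp: has_vector_derivative_id\<close>)+

text \<open>\<open>h\<close> is the variation field in coordinates. Its first derivative needs one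
  exchange of \<partial>s and \<partial>t, its second derivative a further exchange applied to the
  t-derivative of \<open>f\<close>.\<close>

lemma mixed_partials:
  fixes f :: "real \<times> real \<Rightarrow> 'b::euclidean_space"
  assumes B: "open B" "0 \<in> B" and f: "smooth_on (B \<times> B) f"
  defines "h \<equiv> \<lambda>t. fd f (0, t) (1, 0)"
  shows "((\<lambda>s. (f (s, 0), vderiv (\<lambda>t. f (s, t)) 0, vderiv (vderiv (\<lambda>t. f (s, t))) 0)) has_vector_derivative
    (h 0, vderiv h 0, vderiv (vderiv h) 0)) (at 0)"
proof -
  have op: "open (B \<times> B)" using B by (intro open_Times)
  define f2 where "f2 p = fd f p (0, 1)" for p
  define f22 where "f22 p = fd f2 p (0, 1)" for p
  have s1: "smooth_on (B \<times> B) (\<lambda>p. fd f p (1, 0))" by (rule smooth_on_fd [OF f])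
  have s2: "smooth_on (B \<times> B) f2" unfolding f2_def by (rule smooth_on_fd [OF f])
  have s12: "smooth_on (B \<times> B) (\<lambda>p. fd f2 p (1, 0))" by (rule smooth_on_fd [OF s2])
  have s22: "smooth_on (B \<times> B) f22" unfolding f22_def by (rule smooth_on_fd [OF s2])
  have v1: "vderiv (\<lambda>t. f (s, t)) t = f2 (s, t)" if "s \<in> B" "t \<in> B" for s t
    unfolding f2_def by (rule vderiv_eqI [OF has_vector_derivative_partial2 [OF f]]) (use that in simp)
  have v2: "vderiv (vderiv (\<lambda>t. f (s, t))) 0 = f22 (s, 0)" if s: "s \<in> B" for s
  proof -
    have "vderiv (vderiv (\<lambda>t. f (s, t))) 0 = vderiv (\<lambda>t. f2 (s, t)) 0"
      by (rule vderiv_cong [OF B]) (rule v1 [OF s])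
    also have "\<dots> = f22 (s, 0)"
      unfolding f22_def by (rule vderiv_eqI [OF has_vector_derivative_partial2 [OF s2]]) (use s B in simp)
    finally show ?thesis .
  qed
  have h1: "vderiv h t = fd f2 (0, t) (1, 0)" if "t \<in> B" for t
  proof -
    have "vderiv h t = fd (\<lambda>p. fd f p (1, 0)) (0, t) (0, 1)"
      unfolding h_def by (rule vderiv_eqI [OF has_vector_derivative_partial2 [OF s1]]) (use that B in simp)
    also have "\<dots> = fd f2 (0, t) (1, 0)"
      unfolding f2_def by (rule symmetric_second_derivative [OF op f]) (use that B in simp)
    finally show ?thesis .
  qed
  have h2: "vderiv (vderiv h) 0 = fd f22 (0, 0) (1, 0)"
  proof -
    have "vderiv (vderiv h) 0 = vderiv (\<lambda>t. fd f2 (0, t) (1, 0)) 0"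
      by (rule vderiv_cong [OF B]) (rule h1)
    also have "\<dots> = fd (\<lambda>p. fd f2 p (1, 0)) (0, 0) (0, 1)"
      by (rule vderiv_eqI [OF has_vector_derivative_partial2 [OF s12]]) (use B in simp)
    also have "\<dots> = fd f22 (0, 0) (1, 0)"
      unfolding f22_def by (rule symmetric_second_derivative [OF op s2]) (use B in simp)
    finally show ?thesis .
  qed
  have z: "(0, 0) \<in> B \<times> B" using B by simp
  have "((\<lambda>s. (f (s, 0), f2 (s, 0), f22 (s, 0))) has_vector_derivative
      (fd f (0, 0) (1, 0), fd f2 (0, 0) (1, 0), fd f22 (0, 0) (1, 0))) (at 0)"
    by (intro has_vector_derivative_Pair has_vector_derivative_partial1 [OF f z]
        has_vector_derivative_partial1 [OF s2 z] has_vector_derivative_partial1 [OF s22 z])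
  then have "((\<lambda>s. (f (s, 0), vderiv (\<lambda>t. f (s, t)) 0, vderiv (vderiv (\<lambda>t. f (s, t))) 0)) has_vector_derivative
      (fd f (0, 0) (1, 0), fd f2 (0, 0) (1, 0), fd f22 (0, 0) (1, 0))) (at 0)"
    by (rule has_vector_derivative_transform_within_open [OF _ B]) (use B in \<open>simp add: v1 v2\<close>)
  then show ?thesis using h1 [OF B(2)] h2 by (simp add: h_def)
qed

lemma open_contains_square:
  fixes S :: "(real \<times> real) set"
  assumes "open S" "(0, 0) \<in> S"
  obtains e where "e > 0" "{- e<..<e} \<times> {- e<..<e} \<subseteq> S"
proof -
  obtain P Q where PQ: "open P" "open Q" "(0, 0) \<in> P \<times> Q" "P \<times> Q \<subseteq> S"
    using open_prod_elim [OF assms] .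
  obtain a where a: "a > 0" "ball 0 a \<subseteq> P" using PQ openE [of P 0] by auto
  obtain b where b: "b > 0" "ball 0 b \<subseteq> Q" using PQ openE [of Q 0] by auto
  have "{- min a b<..<min a b} \<times> {- min a b<..<min a b} \<subseteq> P \<times> Q"
    using a b by (auto simp: subset_iff dist_real_def)
  then show ?thesis using that [of "min a b"] a b PQ by auto
qed

context atlas
begin

interpretation T: atlas "jet2_atlas A" by unfold_locales (rule smooth_atlas_jet2)

text \<open>The jets X + s v form a straight line in the jet chart, and each of them is realized by
  its Taylor parabola. This makes the choice in \<open>sasaki_K\<close> meaningful.\<close>

lemma ex_represents_tangent:
  assumes D: "(D, \<phi>) \<in> A" and u: "u \<in> jet_dom D" and W: "W \<in> tangent_space (jet2_atlas A) u"
  shows "\<exists>\<gamma>. represents_tangent A \<gamma> W"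
proof -
  define X where "X = jet_chart \<phi> u"
  define v where "v = jet_coord (jet_chart \<phi>) 1 W"
  define P where "P = (\<lambda>(s, t). fst (X + s *\<^sub>R v) + t *\<^sub>R fst (snd (X + s *\<^sub>R v)) +
    (t\<^sup>2 / 2) *\<^sub>R snd (snd (X + s *\<^sub>R v)))"
  define \<gamma> where "\<gamma> s t = inv_into D \<phi> (P (s, t))" for s t
  have sP: "smooth_on S P" if "open S" for S :: "(real \<times> real) set"
    unfolding P_def split_def power2_eq_square divide_inverse
    by (intro smooth_on_add smooth_on_scaleR smooth_on_mult smooth_on_fst smooth_on_snd
        smooth_on_const smooth_on_ident that)
  have "(0, 0) \<in> P -` (\<phi> ` D)"
    using imageI [OF jet_base_chart(1) [OF D u], of \<phi>] jet_base_chart(2) [OF D u] by (simp add: P_def X_def)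
  moreover have "open (P -` (\<phi> ` D))"
    using continuous_open_vimage [OF chart_open [OF D]] smooth_on_continuous_on [OF sP [OF open_UNIV]]
    by (metis continuous_on_eq_continuous_at UNIV_I open_UNIV)
  \<comment> \<open>On a small square all the parabolas stay inside the chart image.\<close>
  ultimately obtain e where e: "e > 0" "{- e<..<e} \<times> {- e<..<e} \<subseteq> P -` (\<phi> ` D)"
    using open_contains_square by metis
  define B where "B = {- e<..<e}"
  have B: "open B" "0 \<in> B" using e by (auto simp: B_def)
  have BD: "P (s, t) \<in> \<phi> ` D" if "s \<in> B" "t \<in> B" for s t using e(2) that unfolding B_def by blast
  have \<gamma>D: "\<gamma> s t \<in> D" and \<phi>\<gamma>: "\<phi> (\<gamma> s t) = P (s, t)" if "s \<in> B" "t \<in> B" for s t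
    using BD [OF that] by (simp_all add: \<gamma>_def inv_chart_mem chart_inv)
  have opB: "open (B \<times> B)" using B by (intro open_Times)
  have sm: "smooth_map_on A (B \<times> B) (\<lambda>(s, t). \<gamma> s t)"
  proof (rule smooth_map_onI [OF D opB])
    show "(\<lambda>(s, t). \<gamma> s t) ` (B \<times> B) \<subseteq> D" using \<gamma>D by auto
    show "smooth_on (B \<times> B) (\<phi> \<circ> (\<lambda>(s, t). \<gamma> s t))"
      by (rule smooth_on_cong [OF opB sP [OF opB]]) (auto simp: \<phi>\<gamma>)
  qed
  have jet: "jet_chart \<phi> (jet A 2 (\<gamma> s)) = X + s *\<^sub>R v" "jet A 2 (\<gamma> s) \<in> jet_dom D" if s: "s \<in> B" for s
  proof -
    define f where "f t = fst (X + s *\<^sub>R v) + t *\<^sub>R fst (snd (X + s *\<^sub>R v)) + (t\<^sup>2 / 2) *\<^sub>R snd (snd (X + s *\<^sub>R v))" for t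
    have eq: "f t = (\<phi> \<circ> \<gamma> s) t" if "t \<in> B" for t using \<phi>\<gamma> [OF s that] by (simp add: f_def P_def)
    have "smooth_on B f" unfolding f_def power2_eq_square divide_inverse
      by (intro smooth_on_add smooth_on_scaleR smooth_on_mult smooth_on_const smooth_on_ident B)
    from smooth_on_cong [OF B(1) this eq]
    have germ: "\<gamma> s \<in> curve_germs A" by (intro curve_germsI [OF D B]) (use \<gamma>D s in \<open>auto simp: o_def\<close>)
    have "(vderiv ^^ k) f 0 = (vderiv ^^ k) (\<phi> \<circ> \<gamma> s) 0" for k
      by (rule funpow_vderiv_cong [OF B eq])
    note this [of 0] this [of 1] this [of 2]
    moreover have "f 0 = fst (X + s *\<^sub>R v)" "vderiv f 0 = fst (snd (X + s *\<^sub>R v))"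
      "vderiv (vderiv f) 0 = snd (snd (X + s *\<^sub>R v))"
      unfolding f_def by (simp_all add: vderiv_quadratic)
    ultimately show "jet_chart \<phi> (jet A 2 (\<gamma> s)) = X + s *\<^sub>R v"
      unfolding jet_chart_jet [OF germ D \<gamma>D [OF s B(2)]] by (simp add: eval_nat_numeral prod_eq_iff)
    show "jet A 2 (\<gamma> s) \<in> jet_dom D" using germ jet_mem_jet_dom \<gamma>D [OF s B(2)] by blast
  qed
  define C where "C s = jet A 2 (\<gamma> s)" for s
  have sC: "smooth_on B (jet_chart \<phi> \<circ> C)"
    by (rule smooth_on_cong [OF B(1), of "\<lambda>s. X + s *\<^sub>R v"])
       (auto intro!: smooth_on_add smooth_on_scaleR smooth_on_const smooth_on_ident B simp: C_def jet)
  have CD: "C ` B \<subseteq> jet_dom D" using jet by (auto simp: C_def)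
  note vel = T.velocity_coord_near [OF B jet2_atlasI [OF D] CD sC]
  have "jet_chart \<phi> (C 0) = jet_chart \<phi> u" using jet(1) [OF B(2)] by (simp add: C_def X_def)
  then have C0: "C 0 = u" using inj_onD [OF jet_chart_inj [OF D]] u CD B(2) by blast
  have "vderiv (jet_chart \<phi> \<circ> C) 0 = v"
  proof -
    have "vderiv (jet_chart \<phi> \<circ> C) 0 = vderiv (\<lambda>s. X + s *\<^sub>R v) 0"
      by (rule vderiv_cong [OF B]) (simp add: C_def jet)
    then show ?thesis by (simp add: vderiv_quadratic)
  qed
  then have "velocity (jet2_atlas A) C 0 = W"
    using T.tangent_eqI [OF vel(1) [unfolded C0] W jet2_atlasI [OF D] u] vel(2) by (simp add: v_def)
  then show ?thesis
    unfolding represents_tangent_def using sm e(1) unfolding B_def C_def by blast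
qed

text \<open>Whatever family represents the tangent vector, the base curve has 2-jet \<open>u\<close>
  and the coordinates of \<open>W\<close> are those of the 2-jet of the variation field
  \<open>h\<close>. As the connection maps use just these data, they do not depend on the chosen
  family.\<close>

lemma represents_tangentE:
  assumes D: "(D, \<phi>) \<in> A" and u: "u \<in> jet_dom D" and W: "W \<in> tangent_space (jet2_atlas A) u"
    and \<gamma>: "represents_tangent A \<gamma> W"
  obtains B h where "open B" "0 \<in> B" "\<gamma> 0 ` B \<subseteq> D" "smooth_on B (\<phi> \<circ> \<gamma> 0)" "smooth_on B h"
    "\<gamma> 0 0 = jet_base u"
    "jet_chart \<phi> u = ((\<phi> \<circ> \<gamma> 0) 0, vderiv (\<phi> \<circ> \<gamma> 0) 0, vderiv (vderiv (\<phi> \<circ> \<gamma> 0)) 0)"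
    "jet_coord (jet_chart \<phi>) 1 W = (h 0, vderiv h 0, vderiv (vderiv h) 0)"
    "\<forall>t\<in>B. velocity A (\<lambda>s. \<gamma> s t) 0 \<in> tangent_space A (\<gamma> 0 t) \<and>
      jet_coord \<phi> 1 (velocity A (\<lambda>s. \<gamma> s t) 0) = h t"
proof -
  obtain e where e: "e > 0" "smooth_map_on A ({- e<..<e} \<times> {- e<..<e}) (\<lambda>(s, t). \<gamma> s t)"
    and vel: "velocity (jet2_atlas A) (\<lambda>s. jet A 2 (\<gamma> s)) 0 = W"
    using \<gamma> unfolding represents_tangent_def by blast
  obtain C where C: "W = jet (jet2_atlas A) 1 C" "C \<in> curve_germs (jet2_atlas A)" "C 0 = u"
    using W unfolding tangent_space_def by blast
  \<comment> \<open>Nothing is known yet about smoothness of the curve of jets, so the coordinates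
    of \<open>W\<close> are taken from a germ \<open>C\<close> that has the same 1-jet.\<close>
  have same: "T.same_jet 1 C (\<lambda>s. jet A 2 (\<gamma> s))"
    using vel C(1) T.jet_eq_iff [OF C(2), of 1 "\<lambda>s. jet A 2 (\<gamma> s)"] by (simp add: jet_lift_def)
  then have u\<gamma>: "u = jet A 2 (\<gamma> 0)" using C(3) unfolding T.same_jet_def by simp
  have z: "(0, 0) \<in> {- e<..<e} \<times> {- e<..<e}" using e by simp
  have restrict: "smooth_on B (\<lambda>t. F (s, t))" "smooth_on B (\<lambda>t. F (t, s))"
    if "open B" "s \<in> B" "smooth_on (B \<times> B) F" for B s and F :: "real \<times> real \<Rightarrow> 'e"
    by (rule smooth_on_compose [OF that(1) _ that(3)];
        use that in \<open>auto intro!: smooth_on_Pair smooth_on_const smooth_on_ident\<close>)+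
  \<comment> \<open>The chart at \<open>u\<close> cannot be used yet: that the family starts in
    \<open>D\<close> follows from its jet being \<open>u\<close>, which requires the base curve to
    be a germ. Some chart at the point \<open>\<gamma> 0 0\<close> shows this first.\<close>
  have \<gamma>0: "\<gamma> 0 \<in> curve_germs A"
  proof -
    obtain E \<psi> where E: "(E, \<psi>) \<in> A" "(\<lambda>(s, t). \<gamma> s t) (0, 0) \<in> E"
      by (rule smooth_map_on_chart_ex [OF e(2) z])
    obtain S where S: "open S" "S \<subseteq> {- e<..<e} \<times> {- e<..<e}" "(0, 0) \<in> S"
      "(\<lambda>(s, t). \<gamma> s t) ` S \<subseteq> E" "smooth_on S (\<psi> \<circ> (\<lambda>(s, t). \<gamma> s t))"
      by (rule smooth_map_onE [OF e(2) z E])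
    obtain d where d: "d > 0" "{- d<..<d} \<times> {- d<..<d} \<subseteq> S" by (rule open_contains_square [OF S(1,3)])
    have dm: "open {- d<..<d}" "0 \<in> {- d<..<d}" using d by auto
    have "\<gamma> 0 t \<in> E" if "t \<in> {- d<..<d}" for t
    proof -
      have "(0, t) \<in> S" using d dm(2) that by blast
      then show ?thesis using S(4) by (auto simp: image_subset_iff)
    qed
    then show ?thesis
      using restrict(1) [OF dm smooth_on_subset [OF S(5) d(2)]]
      by (intro curve_germsI [OF E(1) dm]) (auto simp: o_def)
  qed
  have base: "\<gamma> 0 0 = jet_base u" using jet_base_jet [OF \<gamma>0] u\<gamma> by simp
  then have zD: "\<gamma> 0 0 \<in> D" "(\<lambda>(s, t). \<gamma> s t) (0, 0) \<in> D" using jet_base_chart [OF D u] by simp_all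
  define f where "f = \<phi> \<circ> (\<lambda>(s, t). \<gamma> s t)"
  obtain S where S: "open S" "S \<subseteq> {- e<..<e} \<times> {- e<..<e}" "(0, 0) \<in> S"
    "(\<lambda>(s, t). \<gamma> s t) ` S \<subseteq> D" "smooth_on S f"
    unfolding f_def by (rule smooth_map_onE [OF e(2) z D zD(2)])
  obtain d where d: "d > 0" "{- d<..<d} \<times> {- d<..<d} \<subseteq> S" by (rule open_contains_square [OF S(1,3)])
  define B where "B = {- d<..<d}"
  have B: "open B" "0 \<in> B" using d by (auto simp: B_def)
  have sf: "smooth_on (B \<times> B) f" using smooth_on_subset [OF S(5)] d by (simp add: B_def)
  have BD: "\<gamma> s t \<in> D" if "s \<in> B" "t \<in> B" for s t
    using S(4) d(2) that unfolding B_def [symmetric] by (auto simp: image_subset_iff)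
  define h where "h t = fd f (0, t) (1, 0)" for t
  have s\<gamma>: "smooth_on B (\<phi> \<circ> \<gamma> s)" "smooth_on B (\<phi> \<circ> (\<lambda>t. \<gamma> t s))" if "s \<in> B" for s
    using restrict [OF B(1) that sf] by (simp_all add: f_def o_def)
  have germ: "\<gamma> s \<in> curve_germs A" if "s \<in> B" for s
    by (rule curve_germsI [OF D B _ s\<gamma>(1) [OF that]]) (use BD that in auto)
  have chart: "jet_chart \<phi> (jet A 2 (\<gamma> s)) = (f (s, 0), vderiv (\<lambda>t. f (s, t)) 0, vderiv (vderiv (\<lambda>t. f (s, t))) 0)"
    if "s \<in> B" for s
    using jet_chart_jet [OF germ [OF that] D BD [OF that B(2)]] by (simp add: f_def o_def)
  have "jet_coord (jet_chart \<phi>) 1 W = vderiv (jet_chart \<phi> \<circ> C) 0"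
    using T.jet_coord_jet [OF C(2) jet2_atlasI [OF D], of 1 1] C u by simp
  also have "\<dots> = vderiv (jet_chart \<phi> \<circ> (\<lambda>s. jet A 2 (\<gamma> s))) 0"
    using T.same_jetD [OF same jet2_atlasI [OF D], of 1] C u by simp
  also have "\<dots> = vderiv (\<lambda>s. (f (s, 0), vderiv (\<lambda>t. f (s, t)) 0, vderiv (vderiv (\<lambda>t. f (s, t))) 0)) 0"
    by (rule vderiv_cong [OF B]) (simp add: chart)
  also have "\<dots> = (h 0, vderiv h 0, vderiv (vderiv h) 0)"
    unfolding h_def by (rule vderiv_eqI [OF mixed_partials [OF B sf]])
  finally have W1: "jet_coord (jet_chart \<phi>) 1 W = (h 0, vderiv h 0, vderiv (vderiv h) 0)" .
  have V: "velocity A (\<lambda>s. \<gamma> s t) 0 \<in> tangent_space A (\<gamma> 0 t) \<and>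
      jet_coord \<phi> 1 (velocity A (\<lambda>s. \<gamma> s t) 0) = h t" if t: "t \<in> B" for t
  proof -
    have im: "(\<lambda>s. \<gamma> s t) ` B \<subseteq> D" using BD t by auto
    have "vderiv (\<phi> \<circ> (\<lambda>s. \<gamma> s t)) 0 = h t"
      unfolding h_def using has_vector_derivative_partial1 [OF sf, of 0 t] B t
      by (intro vderiv_eqI) (simp add: f_def o_def)
    with velocity_coord_near [OF B D im s\<gamma>(2) [OF t]] show ?thesis by simp
  qed
  show ?thesis
  proof (rule that [OF B _ s\<gamma>(1) [OF B(2)] _ base _ W1])
    show "\<gamma> 0 ` B \<subseteq> D" using BD B by auto
    show "smooth_on B h" unfolding h_def by (rule restrict(1) [OF B smooth_on_fd [OF sf]])
    show "jet_chart \<phi> u = ((\<phi> \<circ> \<gamma> 0) 0, vderiv (\<phi> \<circ> \<gamma> 0) 0, vderiv (vderiv (\<phi> \<circ> \<gamma> 0)) 0)"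
      using jet_chart_jet [OF \<gamma>0 D zD(1)] u\<gamma> by simp
  qed (use V in blast)
qed

section \<open>The connection maps and the 2-Sasaki metric in coordinates\<close>

lemma sasaki_K_0:
  assumes D: "(D, \<phi>) \<in> A" and u: "u \<in> jet_dom D" and W: "W \<in> tangent_space (jet2_atlas A) u"
  shows "sasaki_K A g 0 W \<in> tangent_space A (jet_base u)"
    "jet_coord \<phi> 1 (sasaki_K A g 0 W) = fst (jet_coord (jet_chart \<phi>) 1 W)"
proof -
  obtain C where C: "W = jet (jet2_atlas A) 1 C" "C \<in> curve_germs (jet2_atlas A)" "C 0 = u"
    using W unfolding tangent_space_def by blast
  define R where "R = repr W"
  have R: "R \<in> curve_germs (jet2_atlas A)" "R 0 = u" using T.repr_jet [OF C(2)] C by (auto simp: R_def)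
  obtain U where U: "open U" "0 \<in> U" "R ` U \<subseteq> jet_dom D" "smooth_on U (jet_chart \<phi> \<circ> R)"
    by (rule T.curve_germsE [OF R(1) jet2_atlasI [OF D]]) (use R u in auto)
  have eq: "fst ((jet_chart \<phi> \<circ> R) s) = (\<phi> \<circ> (jet_base \<circ> R)) s" if "s \<in> U" for s
    using U that jet_base_chart(2) [OF D] by auto
  have sm: "smooth_on U (\<phi> \<circ> (jet_base \<circ> R))"
    by (rule smooth_on_cong [OF U(1) smooth_on_fst [OF U(1,4)] eq])
  have im: "(jet_base \<circ> R) ` U \<subseteq> D" using U jet_base_chart(1) [OF D] by auto
  have germ: "jet_base \<circ> R \<in> curve_germs A"
    by (rule curve_germsI [OF D U(1,2) im sm])
  have K: "sasaki_K A g 0 W = jet A 1 (jet_base \<circ> R)"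
    by (simp add: sasaki_K_def pushforward_def R_def)
  show "sasaki_K A g 0 W \<in> tangent_space A (jet_base u)"
    unfolding K tangent_space_def using germ R by force
  have "jet_coord \<phi> 1 (sasaki_K A g 0 W) = vderiv (\<phi> \<circ> (jet_base \<circ> R)) 0"
    unfolding K using jet_coord_jet [OF germ D, of 1 1] im U by auto
  also have "\<dots> = vderiv (\<lambda>s. fst ((jet_chart \<phi> \<circ> R) s)) 0"
    by (rule vderiv_cong [OF U(1,2)]) (rule eq [symmetric])
  also have "\<dots> = fst (vderiv (jet_chart \<phi> \<circ> R) 0)"
    by (rule vderiv_eqI [OF bounded_linear.has_vector_derivative [OF bounded_linear_fst smooth_on_has_vderiv [OF U(4,2)]]])
  finally show "jet_coord \<phi> 1 (sasaki_K A g 0 W) = fst (jet_coord (jet_chart \<phi>) 1 W)"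
    by (simp add: jet_coord_def R_def)
qed

end

context riemannian_atlas
begin

interpretation T: atlas "jet2_atlas A" by unfold_locales (rule smooth_atlas_jet2)

lemma
  assumes D: "(D, \<phi>) \<in> A" and u: "u \<in> jet_dom D" and W: "W \<in> tangent_space (jet2_atlas A) u"
  defines "X \<equiv> jet_chart \<phi> u" and "v \<equiv> jet_coord (jet_chart \<phi>) 1 W"
  shows sasaki_K_1: "sasaki_K A g 1 W \<in> tangent_space A (jet_base u)"
      "jet_coord \<phi> 1 (sasaki_K A g 1 W) = local_metric.K1 (metric_coord A g (D, \<phi>)) X v"
    and sasaki_K_2: "sasaki_K A g 2 W \<in> tangent_space A (jet_base u)"
      "jet_coord \<phi> 1 (sasaki_K A g 2 W) = local_metric.K2 (metric_coord A g (D, \<phi>)) X v"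
proof -
  interpret M: local_metric "\<phi> ` D" "metric_coord A g (D, \<phi>)" by (rule local_metric [OF D])
  define \<gamma> where "\<gamma> = (SOME \<gamma>. represents_tangent A \<gamma> W)"
  have \<gamma>: "represents_tangent A \<gamma> W"
    unfolding \<gamma>_def by (rule someI_ex [OF ex_represents_tangent [OF D u W]])
  obtain B h where B: "open B" "0 \<in> B" "\<gamma> 0 ` B \<subseteq> D" "smooth_on B (\<phi> \<circ> \<gamma> 0)" "smooth_on B h"
    "\<gamma> 0 0 = jet_base u"
    "jet_chart \<phi> u = ((\<phi> \<circ> \<gamma> 0) 0, vderiv (\<phi> \<circ> \<gamma> 0) 0, vderiv (vderiv (\<phi> \<circ> \<gamma> 0)) 0)"
    "jet_coord (jet_chart \<phi>) 1 W = (h 0, vderiv h 0, vderiv (vderiv h) 0)"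
    "\<forall>t\<in>B. velocity A (\<lambda>s. \<gamma> s t) 0 \<in> tangent_space A (\<gamma> 0 t) \<and>
      jet_coord \<phi> 1 (velocity A (\<lambda>s. \<gamma> s t) 0) = h t"
    by (rule represents_tangentE [OF D u W \<gamma>])
  define c where "c = \<phi> \<circ> \<gamma> 0"
  define V where "V t = velocity A (\<lambda>s. \<gamma> s t) 0" for t
  define N where "N s = vderiv h s + M.\<Gamma> (c s) (vderiv c s) (h s)" for s
  have X: "X = (c 0, vderiv c 0, vderiv (vderiv c) 0)" using B(7) by (simp add: X_def c_def)
  have v: "v = (h 0, vderiv h 0, vderiv (vderiv h) 0)" using B(8) by (simp add: v_def)
  have sc: "smooth_on B c" using B(4) by (simp add: c_def)
  have im: "c ` B \<subseteq> \<phi> ` D" using B(3) by (auto simp: c_def)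
  note k = M.K2_along_curve [OF B(1) sc B(5,2) im, folded X v N_def]
  have V: "V t \<in> tangent_space A (\<gamma> 0 t)" "jet_coord \<phi> 1 (V t) = h t" if "t \<in> B" for t
    using B(9) that by (simp_all add: V_def)
  \<comment> \<open>Stated on the whole neighbourhood \<open>B\<close>, because the second covariant
    derivative at 0 needs the coordinates of the first one near 0.\<close>
  have step: "cov_deriv A g (\<gamma> 0) Y t \<in> tangent_space A (\<gamma> 0 t)"
    "jet_coord \<phi> 1 (cov_deriv A g (\<gamma> 0) Y t) = vderiv y t + M.\<Gamma> (c t) (vderiv c t) (y t)"
    if t: "t \<in> B" and Y: "\<And>t. t \<in> B \<Longrightarrow> Y t \<in> tangent_space A (\<gamma> 0 t)"
      "\<And>t. t \<in> B \<Longrightarrow> jet_coord \<phi> 1 (Y t) = y t" and y: "smooth_on B y" for Y y t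
  proof -
    have "smooth_on B (\<lambda>t. jet_coord \<phi> 1 (Y t))"
      by (rule smooth_on_cong [OF B(1) y]) (rule Y(2) [symmetric])
    note cd = cov_deriv_coord [OF D B(1) t B(3,4) Y(1) smooth_on_differentiable [OF this t]]
    show "cov_deriv A g (\<gamma> 0) Y t \<in> tangent_space A (\<gamma> 0 t)" by (rule cd(1))
    have "vderiv (\<lambda>s. jet_coord \<phi> 1 (Y s)) t = vderiv y t"
      by (rule vderiv_cong [OF B(1) t]) (rule Y(2))
    then show "jet_coord \<phi> 1 (cov_deriv A g (\<gamma> 0) Y t) = vderiv y t + M.\<Gamma> (c t) (vderiv c t) (y t)"
      using cd(2) Y(2) [OF t] by (simp add: c_def levi_civita_eq_christoffel)
  qed
  define V1 where "V1 = cov_deriv A g (\<gamma> 0) V"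
  have V1: "V1 t \<in> tangent_space A (\<gamma> 0 t)" "jet_coord \<phi> 1 (V1 t) = N t" if "t \<in> B" for t
    unfolding V1_def N_def by (rule step [OF that V B(5)]; assumption)+
  have sN: "smooth_on B N"
    unfolding N_def
    by (intro smooth_on_add smooth_on_vderiv B smooth_on_bifamily [where H = M.\<Gamma>, OF B(1) M.christoffel_smooth
        M.christoffel_bilinear sc im] sc)
  note V2 = step [OF B(2) V1 sN]
  have V2c: "jet_coord \<phi> 1 (cov_deriv A g (\<gamma> 0) V1 0) = 2 *\<^sub>R M.K2 X v"
    using V2(2) vderiv_eqI [OF k(1)] by simp
  have K: "sasaki_K A g 1 W = scale_tangent A 1 (V1 0)"
    "sasaki_K A g 2 W = scale_tangent A (1/2) (cov_deriv A g (\<gamma> 0) V1 0)"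
    by (simp_all add: sasaki_K_def Let_def \<gamma>_def [symmetric] V1_def V_def [abs_def] fact_2 eval_nat_numeral)
  have \<gamma>D: "\<gamma> 0 0 \<in> D" using B by auto
  show "sasaki_K A g 1 W \<in> tangent_space A (jet_base u)" "jet_coord \<phi> 1 (sasaki_K A g 1 W) = M.K1 X v"
    unfolding K using scale_tangent [OF V1(1) [OF B(2)] D \<gamma>D, of 1] V1(2) [OF B(2)] k(2) B(6) by simp_all
  show "sasaki_K A g 2 W \<in> tangent_space A (jet_base u)" "jet_coord \<phi> 1 (sasaki_K A g 2 W) = M.K2 X v"
    unfolding K using scale_tangent [OF V2(1) D \<gamma>D, of "1/2"] V2c B(6) by simp_all
qed

lemma sasaki2_coord:
  assumes D: "(D, \<phi>) \<in> A" and X: "X \<in> \<phi> ` D \<times> UNIV"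
  shows "metric_coord (jet2_atlas A) (sasaki2 A g) (jet_dom D, jet_chart \<phi>) X =
    local_metric.jet_metric (metric_coord A g (D, \<phi>)) X"
proof (intro ext)
  fix v w
  interpret M: local_metric "\<phi> ` D" "metric_coord A g (D, \<phi>)" by (rule local_metric [OF D])
  note D2 = jet2_atlasI [OF D]
  define u where "u = inv_into (jet_dom D) (jet_chart \<phi>) X"
  have X': "X \<in> jet_chart \<phi> ` jet_dom D" using X jet_chart_image [OF D] by simp
  have u: "u \<in> jet_dom D" "jet_chart \<phi> u = X"
    unfolding u_def using X' by (rule inv_into_into, rule f_inv_into_f)
  define W where "W v = tangent_of (jet2_atlas A) (jet_dom D, jet_chart \<phi>) u v" for v
  have W: "W v \<in> tangent_space (jet2_atlas A) u" "jet_coord (jet_chart \<phi>) 1 (W v) = v" for v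
    unfolding W_def by (rule T.tangent_of_mem [OF D2 u(1)], rule T.tangent_of_coord [OF D2 u(1)])
  have base: "jet_base u \<in> D" "\<phi> (jet_base u) = fst X" using jet_base_chart [OF D u(1)] u(2) by auto
  have "metric_coord (jet2_atlas A) (sasaki2 A g) (jet_dom D, jet_chart \<phi>) X v w = sasaki2 A g (W v) (W w)"
    by (simp add: metric_coord_def W_def u_def)
  also have "\<dots> = g (sasaki_K A g 0 (W v)) (sasaki_K A g 0 (W w)) + g (sasaki_K A g 1 (W v)) (sasaki_K A g 1 (W w)) +
      g (sasaki_K A g 2 (W v)) (sasaki_K A g 2 (W w))"
    by (simp add: sasaki2_def eval_nat_numeral)
  also have "\<dots> = M.jet_metric X v w"
    unfolding metric_eq_coord [OF D base(1) sasaki_K_0(1) [OF D u(1) W(1)] sasaki_K_0(1) [OF D u(1) W(1)]]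
      metric_eq_coord [OF D base(1) sasaki_K_1(1) [OF D u(1) W(1)] sasaki_K_1(1) [OF D u(1) W(1)]]
      metric_eq_coord [OF D base(1) sasaki_K_2(1) [OF D u(1) W(1)] sasaki_K_2(1) [OF D u(1) W(1)]]
      sasaki_K_0(2) [OF D u(1) W(1)] sasaki_K_1(2) [OF D u(1) W(1)] sasaki_K_2(2) [OF D u(1) W(1)] W(2) u(2) base(2)
    by (simp add: M.jet_metric_def)
  finally show "metric_coord (jet2_atlas A) (sasaki2 A g) (jet_dom D, jet_chart \<phi>) X v w = M.jet_metric X v w" .
qed

theorem riemannian_metric_sasaki2: "riemannian_metric (jet2_atlas A) (sasaki2 A g)"
  unfolding riemannian_metric_def ball_jet2_atlas Let_def
proof clarify
  fix D \<phi> assume D: "(D, \<phi>) \<in> A"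
  interpret M: local_metric "\<phi> ` D" "metric_coord A g (D, \<phi>)" by (rule local_metric [OF D])
  interpret J: local_metric "\<phi> ` D \<times> UNIV" M.jet_metric by (rule M.local_metric_jet)
  let ?G = "metric_coord (jet2_atlas A) (sasaki2 A g) (jet_dom D, jet_chart \<phi>)"
  have "smooth_on (\<phi> ` D \<times> UNIV) (\<lambda>x. ?G x v w)" for v w
    by (rule smooth_on_cong [OF J.open_dom J.smooth]) (simp add: sasaki2_coord [OF D])
  moreover have "bilinear (?G x) \<and> (\<forall>v w. ?G x v w = ?G x w v) \<and> (\<forall>v. v \<noteq> 0 \<longrightarrow> ?G x v v > 0)"
    if "x \<in> \<phi> ` D \<times> UNIV" for x
    unfolding sasaki2_coord [OF D that]
    using J.bilinear [OF that] J.sym [OF that] J.pos [OF that] by blast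
  ultimately show "(\<forall>x\<in>jet_chart \<phi> ` jet_dom D. bilinear (?G x) \<and> (\<forall>v w. ?G x v w = ?G x w v) \<and>
      (\<forall>v. v \<noteq> 0 \<longrightarrow> ?G x v v > 0)) \<and> (\<forall>v w. smooth_on (jet_chart \<phi> ` jet_dom D) (\<lambda>x. ?G x v w))"
    unfolding jet_chart_image [OF D] by blast
qed

section \<open>From the equations in charts to geodesics\<close>

lemma geodesic_equation_jet_lift:
  assumes q: "smooth_map_on A I q" and D: "(D, \<phi>) \<in> A"
    and U: "open U" "U \<subseteq> I" "q ` U \<subseteq> D" "smooth_on U (\<phi> \<circ> q)"
  defines "Q \<equiv> jet_chart \<phi> \<circ> jet_lift A 2 q"
  shows "(\<forall>t\<in>U. vderiv (vderiv Q) t + levi_civita (jet2_atlas A) (sasaki2 A g) (jet_dom D, jet_chart \<phi>)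
      (jet_chart \<phi> (jet_lift A 2 q t)) (vderiv Q t) (vderiv Q t) = 0) \<longleftrightarrow>
    (\<forall>t\<in>U. vderiv (vderiv (\<phi> \<circ> q)) t +
      levi_civita A g (D, \<phi>) (\<phi> (q t)) (vderiv (\<phi> \<circ> q) t) (vderiv (\<phi> \<circ> q) t) = 0)"
proof -
  interpret M: local_metric "\<phi> ` D" "metric_coord A g (D, \<phi>)" by (rule local_metric [OF D])
  interpret J: local_metric "\<phi> ` D \<times> UNIV" M.jet_metric by (rule M.local_metric_jet)
  define C where "C t = ((\<phi> \<circ> q) t, vderiv (\<phi> \<circ> q) t, vderiv (vderiv (\<phi> \<circ> q)) t)" for t
  have QC: "Q t = C t" if "t \<in> U" for t
    unfolding Q_def C_def by (rule jet_lift_near(1) [OF q D U that])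
  have Q1: "vderiv Q t = vderiv C t" if "t \<in> U" for t
    by (rule vderiv_cong [OF U(1) that]) (rule QC)
  have Q2: "vderiv (vderiv Q) t = vderiv (vderiv C) t" if "t \<in> U" for t
    by (rule vderiv_cong [OF U(1) that]) (rule Q1)
  have CD: "C t \<in> \<phi> ` D \<times> UNIV" if "t \<in> U" for t using U that by (auto simp: C_def)
  have "levi_civita (jet2_atlas A) (sasaki2 A g) (jet_dom D, jet_chart \<phi>) (jet_chart \<phi> (jet_lift A 2 q t)) =
      christoffel M.jet_metric (C t)" if "t \<in> U" for t
    using J.christoffel_cong [OF CD [OF that] sasaki2_coord [OF D]] QC [OF that]
    by (simp add: levi_civita_eq_christoffel Q_def)
  moreover have "(\<phi> \<circ> q) ` U \<subseteq> \<phi> ` D" using U by auto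
  note M.jet_geodesic_equation_iff [OF U(1,4) this, folded C_def]
  ultimately show ?thesis by (simp add: Q1 Q2 levi_civita_eq_christoffel)
qed

theorem geodesic_jet_lift_iff:
  assumes q: "smooth_map_on A I q"
  shows "geodesic (jet2_atlas A) (sasaki2 A g) I (jet_lift A 2 q) \<longleftrightarrow> geodesic A g I q"
proof -
  interpret TR: riemannian_atlas "jet2_atlas A" "sasaki2 A g"
    by unfold_locales (rule riemannian_metric_sasaki2)
  define P where "P D \<phi> t \<longleftrightarrow> vderiv (vderiv (\<phi> \<circ> q)) t +
      levi_civita A g (D, \<phi>) (\<phi> (q t)) (vderiv (\<phi> \<circ> q) t) (vderiv (\<phi> \<circ> q) t) = 0" for D \<phi> t
  define P' where "P' D \<phi> t \<longleftrightarrow> vderiv (vderiv (jet_chart \<phi> \<circ> jet_lift A 2 q)) t +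
      levi_civita (jet2_atlas A) (sasaki2 A g) (jet_dom D, jet_chart \<phi>)
      (jet_chart \<phi> (jet_lift A 2 q t)) (vderiv (jet_chart \<phi> \<circ> jet_lift A 2 q) t)
      (vderiv (jet_chart \<phi> \<circ> jet_lift A 2 q) t) = 0" for D \<phi> t
  \<comment> \<open>The chartwise equivalence compares the two equations on an open set rather than
    at a point, so every parameter is taken together with a neighbourhood that is mapped into the
    chart domain.\<close>
  have loc: "\<exists>U. t \<in> U \<and> U \<subseteq> I \<and> q ` U \<subseteq> D \<and> ((\<forall>s\<in>U. P' D \<phi> s) \<longleftrightarrow> (\<forall>s\<in>U. P D \<phi> s))"
    if t: "t \<in> I" and D: "(D, \<phi>) \<in> A" "q t \<in> D" for t D \<phi>
  proof -
    obtain U where U: "open U" "U \<subseteq> I" "t \<in> U" "q ` U \<subseteq> D" "smooth_on U (\<phi> \<circ> q)"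
      by (rule smooth_map_onE [OF q t D])
    with geodesic_equation_jet_lift [OF q D(1) U(1,2,4,5), folded P_def P'_def] show ?thesis by blast
  qed
  have "geodesic (jet2_atlas A) (sasaki2 A g) I (jet_lift A 2 q) \<longleftrightarrow>
      (\<forall>t\<in>I. \<forall>(D, \<phi>)\<in>A. q t \<in> D \<longrightarrow> P' D \<phi> t)"
    unfolding TR.geodesic_iff [OF jet_lift_smooth [OF q]] ball_jet2_atlas P'_def
    using jet_lift_mem_jet_dom [OF q] by (intro ball_cong refl) auto
  also have "\<dots> \<longleftrightarrow> (\<forall>t\<in>I. \<forall>(D, \<phi>)\<in>A. q t \<in> D \<longrightarrow> P D \<phi> t)"
  proof (intro iffI ballI case_prodI2 impI; clarify)
    fix t D \<phi> assume all: "\<forall>t\<in>I. \<forall>(D, \<phi>)\<in>A. q t \<in> D \<longrightarrow> P' D \<phi> t" and t: "t \<in> I" "(D, \<phi>) \<in> A" "q t \<in> D"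
    obtain U where "t \<in> U" "U \<subseteq> I" "q ` U \<subseteq> D" "(\<forall>s\<in>U. P' D \<phi> s) \<longleftrightarrow> (\<forall>s\<in>U. P D \<phi> s)"
      using loc [OF t] by blast
    moreover have "P' D \<phi> s" if "s \<in> I" "q s \<in> D" for s using all that t(2) by auto
    ultimately show "P D \<phi> t" by blast
  next
    fix t D \<phi> assume all: "\<forall>t\<in>I. \<forall>(D, \<phi>)\<in>A. q t \<in> D \<longrightarrow> P D \<phi> t" and t: "t \<in> I" "(D, \<phi>) \<in> A" "q t \<in> D"
    obtain U where "t \<in> U" "U \<subseteq> I" "q ` U \<subseteq> D" "(\<forall>s\<in>U. P' D \<phi> s) \<longleftrightarrow> (\<forall>s\<in>U. P D \<phi> s)"
      using loc [OF t] by blast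
    moreover have "P D \<phi> s" if "s \<in> I" "q s \<in> D" for s using all that t(2) by auto
    ultimately show "P' D \<phi> t" by blast
  qed
  also have "\<dots> \<longleftrightarrow> geodesic A g I q"
    unfolding geodesic_iff [OF q] P_def ..
  finally show ?thesis .
qed

end

theorem corollary27:
  fixes A :: "('a, 'e::euclidean_space) chart set"
    and g :: "'a metric"
    and I :: "real set"
    and q :: "real \<Rightarrow> 'a"
  assumes "riemannian_manifold A g"
    and "open I" and "is_interval I"
    and "smooth_map_on A I q"
  shows "geodesic (jet2_atlas A) (sasaki2 A g) I (jet_lift A 2 q) \<longleftrightarrow> geodesic A g I q"
proof -
  interpret riemannian_atlas A g
    using assms(1) by unfold_locales (auto simp: riemannian_manifold_def smooth_manifold_def)
  show ?thesis by (rule geodesic_jet_lift_iff [OF assms(4)])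
qed

end
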